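(* There are constants $c_1,c_2\ge 0$ such that for every ideal hyperbolic quadrilateral $Q$, \[ \frac{\pi}{2}\sqrt{[Q]}-c_1\;\le\; m(Q)\;\le\;\frac{\pi}{2}\sqrt{[Q]}+c_2 . \]
   Context: An ideal hyperbolic quadrilateral $Q$ is the hyperbolic convex hull in the unit disk $\mathbb{D}$ of four distinct points (vertices) of the unit circle. The cross ratio of four points is $[z_1,z_2,z_3,z_4]=\frac{(z_1-z_3)(z_2-z_4)}{(z_1-z_2)(z_3-z_4)}$. The number $[Q]$ is the unique value $\ge 2$ among the cross ratios $[z_1,z_2,z_3,z_4]$ of the vertices of $Q$ taken over all orderings of the vertices (a set of the form $\{\lambda,1-\lambda,\frac{\lambda}{\lambda-1},\frac1\lambda,\frac1{1-\lambda},1-\frac1\lambda\}$). The modulus $m(Q)\ge 1$ is the unique number $m\ge1$ such that there is a conformal map of the interior of $Q$ onto the rectangle $(0,m)\times(0,1)$ whose boundary extension takes the four vertices of $Q$ to the four vertices of the rectangle. *)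

theory Defs
  imports "HOL-Complex_Analysis.Complex_Analysis"
begin

text \<open>
  The maps \<open>Moebius_function \<theta> w\<close> with \<open>norm w < 1\<close> are the orientation preserving isometries of
  the unit disk, so the hyperbolic geodesic segments, rays and lines, with any ideal endpoints
  included, are exactly the images under these maps of the intervals \<open>{s..t} \<subseteq> {-1..1}\<close> of the
  real diameter.
\<close>

definition hyp_convex :: "complex set \<Rightarrow> bool" where
  "hyp_convex S \<longleftrightarrow> S \<subseteq> cball 0 1 \<and>
     (\<forall>\<theta> w s t. norm w < 1 \<longrightarrow> -1 \<le> s \<longrightarrow> s \<le> t \<longrightarrow> t \<le> 1 \<longrightarrow>
        Moebius_function \<theta> w (of_real s) \<in> S \<longrightarrow> Moebius_function \<theta> w (of_real t) \<in> S \<longrightarrow>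
        (\<forall>u\<in>{s..t}. Moebius_function \<theta> w (of_real u) \<in> S))"

text \<open>
  An ideal quadrilateral is given by its set of vertices. The hull is taken in the closed disk, as
  the vertices are ideal points, and then restricted to the open disk.
\<close>

definition ideal_vertices :: "complex set \<Rightarrow> bool" where
  "ideal_vertices V \<longleftrightarrow> V \<subseteq> sphere 0 1 \<and> card V = 4"

definition ideal_quad :: "complex set \<Rightarrow> complex set" where
  "ideal_quad V = (hyp_convex hull V) \<inter> ball 0 1"

definition cross_ratio :: "complex \<Rightarrow> complex \<Rightarrow> complex \<Rightarrow> complex \<Rightarrow> complex" where
  "cross_ratio z1 z2 z3 z4 = ((z1 - z3) * (z2 - z4)) / ((z1 - z2) * (z3 - z4))"

text \<open>
  For \<open>card V = 4\<close> the condition \<open>{z1, z2, z3, z4} = V\<close> says that \<open>z1, z2, z3, z4\<close> is an ordering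
  of \<open>V\<close>, without repetitions.
\<close>

definition quad_cross_ratio :: "complex set \<Rightarrow> real" where
  "quad_cross_ratio V =
     (THE x. x \<ge> 2 \<and> (\<exists>z1 z2 z3 z4. {z1, z2, z3, z4} = V \<and> cross_ratio z1 z2 z3 z4 = of_real x))"

text \<open>
  A conformal map onto the rectangle together with its boundary extension (a homeomorphism of the
  closures) is a single function \<open>f\<close> on the closure of the interior. Closures are taken in the
  plane, so that they contain the vertices.
\<close>

definition conformal_onto_rectangle :: "complex set \<Rightarrow> real \<Rightarrow> bool" where
  "conformal_onto_rectangle V m \<longleftrightarrow>
     (\<exists>f g. f holomorphic_on interior (ideal_quad V) \<and>
            inj_on f (interior (ideal_quad V)) \<and>
            f ` interior (ideal_quad V) = box 0 (Complex m 1) \<and>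
            homeomorphism (closure (interior (ideal_quad V))) (cbox 0 (Complex m 1)) f g \<and>
            f ` V = {0, Complex m 0, Complex m 1, Complex 0 1})"

definition quad_modulus :: "complex set \<Rightarrow> real" where
  "quad_modulus V = (THE m. m \<ge> 1 \<and> conformal_onto_rectangle V m)"

end

theory Submission
  imports Defs
begin

text \<open>
  Every ideal quadrilateral is isometric to one with vertices \<open>\<plusminus> c \<plusminus> s \<i>\<close>, where \<open>c\<^sup>2 + s\<^sup>2 = 1\<close> and
  \<open>c \<le> s\<close>, and then \<open>[Q] = 1 / c\<^sup>2\<close>. In the Klein model the hull is the Euclidean rectangle
  \<open>|x| \<le> c, |y| \<le> s\<close>. A modulus exists because the Riemann map to the disk extends to the
  boundary (by the length-area method) and a Schwarz-Christoffel integral maps the disk onto a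
  rectangle with prescribed corners; it is unique because the length-area inequality, applied to
  the map between two such rectangles, bounds each modulus by the other.

  In the strip coordinate \<open>2 artanh z\<close> the quadrilateral has width \<open>2 e\<close>, with \<open>e = artanh c\<close>, and
  height at most \<open>\<pi>\<close>, and it contains the rectangle \<open>|x| < e, |y| < arcsin s\<close>. Applying the
  length-area inequality to the vertical segments of the quadrilateral and to the horizontal
  segments of this rectangle gives \<open>(arcsin s) / e \<le> m \<le> \<pi> / (2 e)\<close>, which is
  \<open>\<pi> / (2 c) + O(1)\<close>. If instead the conformal map exchanges the two pairs of opposite sides, then
  \<open>m \<le> e / arcsin s\<close>, so that \<open>c\<close> is bounded below and all quantities are bounded.
\<close>

section \<open>The length-area inequality\<close>

text \<open>The modulus is a definite description, so no estimate has a meaning until a conformal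
  map is known to exist and its number to be unique; most of the development serves that. No
  elliptic integral is evaluated: the Schwarz-Christoffel map only has to exist for any four points
  of the circle, and the asymptotics come from two comparison regions alone. The definition fixes
  the image of the vertex set, not of each vertex, so every comparison must first find out which
  sides land opposite each other; connectedness of the sides settles this, at the price of one extra
  case each time.

  The two bounds agree up to O(1) because artanh c = c + O(c^3) and arcsin s = pi/2 - O(c) as c
  tends to 0. The expected pairing of sides loses 4 below and nothing above. The constants 48 and 24
  stem from the exchanged pairing: there 1 <= m <= 24 c, hence c >= 1/24 and pi / (2 c) <=
  48.\<close>

unbundle no fps_syntax

text \<open>The integrand is the Jacobian of \<open>h\<close>, so for injective \<open>h\<close> the
  integral is the area of the image of \<open>U\<close>, which lies in the rectangle. The plane
  appears as \<open>real^2\<close> because the change of variables formula speaks of the determinant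
  of a matrix.\<close>

lemma nn_integral_deriv_sq_le_vec:
  fixes h :: "complex \<Rightarrow> complex"
  assumes "open U" and holo: "h holomorphic_on U" and inj: "inj_on h U" and sub: "h ` U \<subseteq> cbox p q"
    and pq: "Re p \<le> Re q" "Im p \<le> Im q"
  shows "(\<integral>\<^sup>+ v. ennreal (indicat_real {v. Complex (v$1) (v$2) \<in> U} v *
            (cmod (deriv h (Complex (v$1) (v$2))))\<^sup>2) \<partial>(lborel :: (real^2) measure))
         \<le> ennreal ((Re q - Re p) * (Im q - Im p))"
proof -
  define c :: "real^2 \<Rightarrow> complex" where "c v = Complex (v$1) (v$2)" for v
  define d :: "complex \<Rightarrow> real^2" where "d z = vector [Re z, Im z]" for z
  define V where "V = {v. c v \<in> U}"
  define g where "g v = d (h (c v))" for v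
  have bl_c: "bounded_linear c"
    by (rule linear_conv_bounded_linear[THEN iffD1], rule linearI) (auto simp: c_def complex_eq_iff)
  have bl_d: "bounded_linear d"
    by (rule linear_conv_bounded_linear[THEN iffD1], rule linearI) (auto simp: d_def vec_eq_iff forall_2)
  have cd: "c (d z) = z" for z by (simp add: c_def d_def)
  have dc: "d (c v) = v" for v by (simp add: c_def d_def vec_eq_iff forall_2)
  have contc: "continuous_on A c" for A using bl_c by (simp add: linear_continuous_on)
  have "open V"
    unfolding V_def using continuous_open_preimage[OF contc[of UNIV] open_UNIV \<open>open U\<close>]
    by (simp add: vimage_def)
  define g' where "g' v t = d (deriv h (c v) * c t)" for v t
  have der: "(g has_derivative g' v) (at v within V)" if "v \<in> V" for v
  proof -
    have "(h has_field_derivative deriv h (c v)) (at (c v))"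
      using holo that \<open>open U\<close> by (auto simp: V_def intro: holomorphic_derivI)
    then have h1: "(h has_derivative (\<lambda>t. deriv h (c v) * t)) (at (c v))"
      by (simp add: has_field_derivative_def)
    have "((\<lambda>v. h (c v)) has_derivative (\<lambda>t. deriv h (c v) * c t)) (at v)"
      by (rule has_derivative_compose[OF bounded_linear_imp_has_derivative[OF bl_c] h1])
    from bounded_linear.has_derivative[OF bl_d this]
    have "(g has_derivative g' v) (at v)"
      by (simp add: g_def[abs_def] g'_def[abs_def])
    then show ?thesis by (rule has_derivative_at_withinI)
  qed
  have injg: "inj_on g V"
  proof (rule inj_onI)
    fix v w assume *: "v \<in> V" "w \<in> V" "g v = g w"
    then have "h (c v) = h (c w)" by (metis g_def cd)
    then have "c v = c w" using * inj by (auto simp: V_def dest: inj_onD)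
    then show "v = w" by (metis dc)
  qed
  have det: "\<bar>det (matrix (g' v))\<bar> = (cmod (deriv h (c v)))\<^sup>2" for v
  proof -
    have "det (matrix (g' v)) = (Re (deriv h (c v)))\<^sup>2 + (Im (deriv h (c v)))\<^sup>2"
      by (simp add: det_2 matrix_def g'_def d_def c_def axis_def power2_eq_square)
    then show ?thesis by (simp add: cmod_power2)
  qed
  have gV: "g ` V \<subseteq> cbox (d p) (d q)"
  proof
    fix x assume "x \<in> g ` V"
    then obtain v where v: "v \<in> V" "x = g v" by auto
    then have "h (c v) \<in> cbox p q" using sub by (auto simp: V_def)
    then show "x \<in> cbox (d p) (d q)"
      by (simp add: v g_def d_def mem_box_cart forall_2 in_cbox_complex_iff)
  qed
  have "g ` V = c -` (h ` U)"
  proof (auto simp: g_def cd V_def)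
    fix x u assume "c x = h u" "u \<in> U"
    then show "x \<in> (\<lambda>v. d (h (c v))) ` {v. c v \<in> U}"
      by (intro image_eqI[of _ _ "d u"]) (auto simp: cd dc simp flip: \<open>c x = h u\<close>)
  qed
  moreover have "open (h ` U)" using holo \<open>open U\<close> inj by (rule open_mapping_thm3)
  ultimately have "open (g ` V)"
    using continuous_open_preimage[OF contc[of UNIV] open_UNIV] by (simp add: vimage_def)
  moreover have "bounded (g ` V)" using gV bounded_subset bounded_cbox by blast
  ultimately have lm: "g ` V \<in> lmeasurable" by (rule lmeasurable_open[rotated])
  have mle: "measure lebesgue (g ` V) \<le> (Re q - Re p) * (Im q - Im p)"
  proof -
    have "measure lebesgue (g ` V) \<le> measure lebesgue (cbox (d p) (d q))"
      using gV lm by (intro measure_mono_fmeasurable) (auto)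
    also have "\<dots> = (Re q - Re p) * (Im q - Im p)"
    proof -
      have "cbox (d p) (d q) \<noteq> {}"
        using pq by (simp add: interval_ne_empty_cart forall_2 d_def)
      then show ?thesis
        by (simp add: content_cbox_cart UNIV_2 d_def)
    qed
    finally show ?thesis .
  qed
  have "((\<lambda>v. \<bar>det (matrix (g' v))\<bar>) has_integral measure lebesgue (g ` V)) V"
    using has_measure_differentiable_image[of V g g' "measure lebesgue (g ` V)"] der injg lm \<open>open V\<close>
    by auto
  then have "((\<lambda>v. (cmod (deriv h (c v)))\<^sup>2) has_integral measure lebesgue (g ` V)) V"
    by (simp only: det)
  from nn_integral_has_integral_lebesgue[OF _ this]
  have "(\<integral>\<^sup>+ v. ennreal (indicat_real V v * (cmod (deriv h (c v)))\<^sup>2) \<partial>lborel) = ennreal (measure lebesgue (g ` V))"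
    by simp
  also have "\<dots> \<le> ennreal ((Re q - Re p) * (Im q - Im p))"
    using mle by (rule ennreal_leI)
  finally show ?thesis
    unfolding V_def c_def .
qed

text \<open>Bridge between the area formula on \<open>real^2\<close> and Fubini on a product
  measure: both measures give a box the product of its side lengths, and this determines Lebesgue
  measure.\<close>

lemma lborel_vec2_eq_distr:
  "(lborel :: (real^2) measure) =
     distr (lborel \<Otimes>\<^sub>M lborel) borel (\<lambda>(x, y). vector [x, y])"
proof (rule lborel_eqI)
  have cont: "continuous_on UNIV (\<lambda>z :: real \<times> real. vector [fst z, snd z] :: real^2)"
    by (rule linear_continuous_on, rule linear_conv_bounded_linear[THEN iffD1], rule linearI)
       (auto simp: vec_eq_iff forall_2)
  have meas: "(\<lambda>(x, y). vector [x, y] :: real^2) \<in> lborel \<Otimes>\<^sub>M lborel \<rightarrow>\<^sub>M borel"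
    using borel_measurable_continuous_onI[OF cont] by (simp add: lborel_prod case_prod_unfold)
  fix l u :: "real^2"
  assume lu: "\<And>b. b \<in> Basis \<Longrightarrow> l \<bullet> b \<le> u \<bullet> b"
  have l12: "l$1 \<le> u$1" "l$2 \<le> u$2"
    using lu[of "axis 1 1"] lu[of "axis 2 1"] by (auto simp: inner_axis axis_in_Basis_iff)
  have "emeasure (distr (lborel \<Otimes>\<^sub>M lborel) borel (\<lambda>(x, y). vector [x, y])) (box l u)
      = emeasure (lborel \<Otimes>\<^sub>M lborel) ({l$1<..<u$1} \<times> {l$2<..<u$2})"
    by (subst emeasure_distr[OF meas])
       (auto simp: mem_box_cart forall_2 space_pair_measure intro!: arg_cong2[where f=emeasure])
  also have "\<dots> = ennreal (u$1 - l$1) * ennreal (u$2 - l$2)"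
    using l12 by (subst lborel.emeasure_pair_measure_Times) auto
  also have "\<dots> = ennreal (prod ((\<bullet>) (u - l)) Basis)"
  proof -
    have "prod ((\<bullet>) (u - l)) Basis = measure lborel (cbox l u)"
      using lu by (subst content_cbox) (auto simp: inner_diff_left)
    also have "\<dots> = (u$1 - l$1) * (u$2 - l$2)"
      using l12 by (subst content_cbox_cart) (auto simp: UNIV_2 interval_ne_empty_cart forall_2)
    finally show ?thesis using l12 by (simp add: ennreal_mult)
  qed
  finally show "emeasure (distr (lborel \<Otimes>\<^sub>M lborel) borel (\<lambda>(x, y). vector [x, y])) (box l u) =
       ennreal (prod ((\<bullet>) (u - l)) Basis)" .
qed simp

text \<open>By the fundamental theorem of calculus every slice contributes at least \<open>L\<close>
  to the integral of |h'|. Integrating over the slices and comparing with the integral of |h'|^2,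
  which is an area, gives the bound by Cauchy-Schwarz.\<close>

lemma length_area:
  fixes h :: "complex \<Rightarrow> complex"
  assumes "open U" and holo: "h holomorphic_on U" and inj: "inj_on h U" and sub: "h ` U \<subseteq> cbox p q"
    and U: "\<And>z. z \<in> U \<Longrightarrow> a < Re z \<and> Re z < b \<and> c < Im z \<and> Im z < d"
    and "a < b" "0 \<le> L"
    and slice: "\<And>x. a < x \<Longrightarrow> x < b \<Longrightarrow> \<exists>y1 y2. y1 \<le> y2 \<and> (\<forall>y\<in>{y1..y2}. Complex x y \<in> U) \<and>
                   L \<le> cmod (h (Complex x y2) - h (Complex x y1))"
  shows "(b - a) * L\<^sup>2 \<le> (d - c) * ((Re q - Re p) * (Im q - Im p))"
proof -
  define M where "M = (Re q - Re p) * (Im q - Im p)"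
  define C where "C z = Complex (fst z) (snd z)" for z
  define U' where "U' = {z. C z \<in> U}"
  define \<phi> where "\<phi> z = indicat_real U' z * cmod (deriv h (C z))" for z
  obtain y0 where y0: "Complex ((a+b)/2) y0 \<in> U"
    using slice[of "(a+b)/2"] \<open>a < b\<close> by force
  have "c < d" using U[OF y0] by simp
  have pq: "Re p \<le> Re q" "Im p \<le> Im q"
    using sub y0 by (auto simp: in_cbox_complex_iff)
  have contC: "continuous_on A C" for A
    unfolding C_def Complex_eq by (intro continuous_intros)
  have "open U'"
    using continuous_open_preimage[OF contC[of UNIV] open_UNIV \<open>open U\<close>] by (simp add: U'_def vimage_def)
  have contD: "continuous_on U' (\<lambda>z. cmod (deriv h (C z)))"
    by (intro continuous_on_norm continuous_on_compose2[OF holomorphic_on_imp_continuous_on[OF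
          holomorphic_deriv[OF holo \<open>open U\<close>]] contC]) (auto simp: U'_def)
  have meas: "\<phi> \<in> borel_measurable borel"
    unfolding \<phi>_def[abs_def]
    using borel_measurable_continuous_on_indicator[OF borel_open[OF \<open>open U'\<close>] contD] by simp
  have meas2: "\<phi> \<in> borel_measurable (lborel \<Otimes>\<^sub>M lborel)"
    using meas by (simp add: lborel_prod)
  have meas1: "(\<lambda>y. \<phi> (x, y)) \<in> borel_measurable borel" for x
  proof -
    have "(\<lambda>y. \<phi> (x, y)) \<in> borel_measurable lborel" using meas2 by measurable
    then show ?thesis by simp
  qed
  have sq: "(\<integral>\<^sup>+ x. \<integral>\<^sup>+ y. ennreal ((\<phi> (x, y))\<^sup>2) \<partial>lborel \<partial>lborel) \<le> ennreal M"
  proof -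
    have m: "(\<lambda>z. ennreal ((\<phi> z)\<^sup>2)) \<in> borel_measurable (lborel \<Otimes>\<^sub>M lborel)"
      using meas2 by measurable
    have cont: "continuous_on UNIV (\<lambda>z :: real \<times> real. vector [fst z, snd z] :: real^2)"
      by (rule linear_continuous_on, rule linear_conv_bounded_linear[THEN iffD1], rule linearI)
         (auto simp: vec_eq_iff forall_2)
    have mv: "(\<lambda>(x, y). vector [x, y] :: real^2) \<in> lborel \<Otimes>\<^sub>M lborel \<rightarrow>\<^sub>M borel"
      using borel_measurable_continuous_onI[OF cont] by (simp add: lborel_prod case_prod_unfold)
    let ?k = "\<lambda>v :: real^2. ennreal (indicat_real {v. Complex (v$1) (v$2) \<in> U} v *
            (cmod (deriv h (Complex (v$1) (v$2))))\<^sup>2)"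
    have kphi: "?k v = ennreal ((\<phi> (v$1, v$2))\<^sup>2)" for v
      by (auto simp: \<phi>_def C_def U'_def indicator_def)
    have "continuous_on UNIV (\<lambda>v::real^2. (v$1, v$2))" by (intro continuous_intros)
    then have "(\<lambda>v::real^2. (v$1, v$2)) \<in> borel_measurable borel"
      by (rule borel_measurable_continuous_onI)
    from measurable_compose[OF this meas] have "(\<lambda>v::real^2. \<phi> (v$1, v$2)) \<in> borel_measurable borel" .
    then have mk: "?k \<in> borel_measurable borel" unfolding kphi by measurable
    have "(\<integral>\<^sup>+ x. \<integral>\<^sup>+ y. ennreal ((\<phi> (x, y))\<^sup>2) \<partial>lborel \<partial>lborel)
          = (\<integral>\<^sup>+ z. ennreal ((\<phi> z)\<^sup>2) \<partial>(lborel \<Otimes>\<^sub>M lborel))"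
      using m by (rule lborel.nn_integral_fst)
    also have "\<dots> = (\<integral>\<^sup>+ z. ?k (case z of (x, y) \<Rightarrow> vector [x, y]) \<partial>(lborel \<Otimes>\<^sub>M lborel))"
      unfolding kphi by (auto intro!: nn_integral_cong)
    also have "\<dots> = (\<integral>\<^sup>+ v. ?k v \<partial>distr (lborel \<Otimes>\<^sub>M lborel) borel (\<lambda>(x, y). vector [x, y]))"
      using mk by (subst nn_integral_distr[OF mv]) (auto)
    also have "\<dots> = (\<integral>\<^sup>+ v. ?k v \<partial>lborel)"
      by (simp only: lborel_vec2_eq_distr[symmetric])
    also have "\<dots> \<le> ennreal M"
      unfolding M_def by (rule nn_integral_deriv_sq_le_vec) fact+
    finally show ?thesis .
  qed
  have low: "ennreal L \<le> (\<integral>\<^sup>+ y. ennreal (\<phi> (x, y)) \<partial>lborel)" if x: "a < x" "x < b" for x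
  proof -
    obtain y1 y2 where y: "y1 \<le> y2" "\<And>y. y \<in> {y1..y2} \<Longrightarrow> Complex x y \<in> U"
       "L \<le> cmod (h (Complex x y2) - h (Complex x y1))" using slice[OF x] by blast
    have der: "((\<lambda>y. h (Complex x y)) has_vector_derivative (\<i> * deriv h (Complex x y))) (at y within {y1..y2})"
      if "y \<in> {y1..y2}" for y
    proof -
      have "(h has_field_derivative deriv h (Complex x y)) (at (Complex x y))"
        using y(2)[OF that] holo \<open>open U\<close> by (auto intro: holomorphic_derivI)
      moreover have "((\<lambda>y. Complex x y) has_vector_derivative \<i>) (at y within {y1..y2})"
        unfolding Complex_eq by (auto intro!: derivative_eq_intros)
      ultimately show ?thesis
        using field_vector_diff_chain_within[of "Complex x" \<i> y "{y1..y2}" h "deriv h (Complex x y)"]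
        by (simp add: has_field_derivative_at_within o_def)
    qed
    have int: "((\<lambda>y. \<i> * deriv h (Complex x y)) has_integral (h (Complex x y2) - h (Complex x y1))) {y1..y2}"
      using y(1) der by (intro fundamental_theorem_of_calculus) auto
    have cont: "continuous_on {y1..y2} (\<lambda>y. cmod (deriv h (Complex x y)))"
    proof -
      have "continuous_on {y1..y2} (Complex x)"
        unfolding Complex_eq by (intro continuous_intros)
      then show ?thesis
        by (intro continuous_on_norm continuous_on_compose2[OF holomorphic_on_imp_continuous_on[OF
          holomorphic_deriv[OF holo \<open>open U\<close>]]]) (auto simp: y(2))
    qed
    then have int2: "(\<lambda>y. cmod (deriv h (Complex x y))) integrable_on {y1..y2}"
      by (rule integrable_continuous_interval)
    have "L \<le> integral {y1..y2} (\<lambda>y. cmod (deriv h (Complex x y)))"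
    proof -
      have "cmod (integral {y1..y2} (\<lambda>y. \<i> * deriv h (Complex x y)))
            \<le> integral {y1..y2} (\<lambda>y. cmod (deriv h (Complex x y)))"
        by (rule integral_norm_bound_integral[OF has_integral_integrable[OF int] int2])
           (simp add: norm_mult)
      then show ?thesis using y(3) unfolding integral_unique[OF int] by linarith
    qed
    then have "ennreal L \<le> ennreal (integral {y1..y2} (\<lambda>y. cmod (deriv h (Complex x y))))"
      by (rule ennreal_leI)
    also have "\<dots> = (\<integral>\<^sup>+ y. ennreal (indicat_real {y1..y2} y * cmod (deriv h (Complex x y))) \<partial>lborel)"
      using nn_integral_has_integral_lebesgue[OF _ integrable_integral[OF int2]] by simp
    also have "\<dots> \<le> (\<integral>\<^sup>+ y. ennreal (\<phi> (x, y)) \<partial>lborel)"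
      using y(2) by (intro nn_integral_mono ennreal_leI) (auto simp: \<phi>_def U'_def C_def indicator_def)
    finally show ?thesis .
  qed
  \<comment> \<open>Cauchy-Schwarz in linearised form: 2 t \<phi> <= t^2 + \<phi>^2 pointwise, where
    the t^2 is charged only to the rectangle that contains \<open>U\<close>.\<close>
  have key: "2 * t * L * (b - a) \<le> t\<^sup>2 * ((b - a) * (d - c)) + M" if "t > 0" for t
  proof -
    have "ennreal (2 * t * L * (b - a)) = (\<integral>\<^sup>+ x. ennreal (2 * t * L) * indicator {a<..<b} x \<partial>lborel)"
      using \<open>a < b\<close> that \<open>0 \<le> L\<close> by (simp add: nn_integral_cmult_indicator ennreal_mult)
    also have "\<dots> \<le> (\<integral>\<^sup>+ x. \<integral>\<^sup>+ y. ennreal (2 * t * \<phi> (x, y)) \<partial>lborel \<partial>lborel)"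
    proof (rule nn_integral_mono)
      fix x :: real
      have "ennreal (2 * t * L) \<le> (\<integral>\<^sup>+ y. ennreal (2 * t * \<phi> (x, y)) \<partial>lborel)" if "x \<in> {a<..<b}"
      proof -
        have "(\<integral>\<^sup>+ y. ennreal (2 * t * \<phi> (x, y)) \<partial>lborel)
              = (\<integral>\<^sup>+ y. ennreal (2 * t) * ennreal (\<phi> (x, y)) \<partial>lborel)"
          using \<open>t > 0\<close> by (intro nn_integral_cong) (simp add: \<phi>_def flip: ennreal_mult)
        also have "\<dots> = ennreal (2 * t) * (\<integral>\<^sup>+ y. ennreal (\<phi> (x, y)) \<partial>lborel)"
          using meas1[of x] by (intro nn_integral_cmult) measurable
        finally show ?thesis
          using low[of x] that \<open>t > 0\<close> \<open>0 \<le> L\<close> by (simp add: ennreal_mult mult_left_mono)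
      qed
      then show "ennreal (2 * t * L) * indicator {a<..<b} x \<le> (\<integral>\<^sup>+ y. ennreal (2 * t * \<phi> (x, y)) \<partial>lborel)"
        by (auto simp: indicator_def)
    qed
    also have "\<dots> \<le> (\<integral>\<^sup>+ x. \<integral>\<^sup>+ y. (ennreal (t\<^sup>2) * indicator {a<..<b} x * indicator {c<..<d} y
                       + ennreal ((\<phi> (x, y))\<^sup>2)) \<partial>lborel \<partial>lborel)"
    proof (intro nn_integral_mono)
      fix x y :: real
      show "ennreal (2 * t * \<phi> (x, y)) \<le> ennreal (t\<^sup>2) * indicator {a<..<b} x * indicator {c<..<d} y
                       + ennreal ((\<phi> (x, y))\<^sup>2)"
      proof (cases "Complex x y \<in> U")
        case True
        have "2 * t * \<phi> (x, y) \<le> t\<^sup>2 + (\<phi> (x, y))\<^sup>2" using sum_squares_bound[of t "\<phi> (x,y)"] by simp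
        then have "ennreal (2 * t * \<phi> (x, y)) \<le> ennreal (t\<^sup>2) + ennreal ((\<phi> (x, y))\<^sup>2)"
          by (simp add: ennreal_leI flip: ennreal_plus)
        then show ?thesis using U[OF True] by simp
      qed (simp add: \<phi>_def U'_def C_def)
    qed
    also have "\<dots> = (\<integral>\<^sup>+ x. (ennreal (t\<^sup>2 * (d - c)) * indicator {a<..<b} x
                       + (\<integral>\<^sup>+ y. ennreal ((\<phi> (x, y))\<^sup>2) \<partial>lborel)) \<partial>lborel)"
    proof (rule nn_integral_cong)
      fix x :: real
      have "(\<integral>\<^sup>+ y. ennreal (t\<^sup>2) * indicator {a<..<b} x * indicator {c<..<d} y \<partial>lborel)
           = ennreal (t\<^sup>2 * (d - c)) * indicator {a<..<b} x"
        using \<open>c < d\<close> by (subst nn_integral_cmult_indicator) (auto simp: ennreal_mult mult_ac)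
      then show "(\<integral>\<^sup>+ y. (ennreal (t\<^sup>2) * indicator {a<..<b} x * indicator {c<..<d} y
                       + ennreal ((\<phi> (x, y))\<^sup>2)) \<partial>lborel) =
             ennreal (t\<^sup>2 * (d - c)) * indicator {a<..<b} x
                       + (\<integral>\<^sup>+ y. ennreal ((\<phi> (x, y))\<^sup>2) \<partial>lborel)"
        using meas1[of x] by (subst nn_integral_add) (auto)
    qed
    also have "\<dots> = ennreal (t\<^sup>2 * (d - c)) * ennreal (b - a)
                 + (\<integral>\<^sup>+ x. \<integral>\<^sup>+ y. ennreal ((\<phi> (x, y))\<^sup>2) \<partial>lborel \<partial>lborel)"
      using meas2 \<open>a < b\<close> by (subst nn_integral_add) (auto simp: nn_integral_cmult_indicator
          intro!: lborel.borel_measurable_nn_integral_fst)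
    also have "\<dots> \<le> ennreal (t\<^sup>2 * (d - c)) * ennreal (b - a) + ennreal M"
      using sq by (rule add_left_mono)
    also have "\<dots> = ennreal (t\<^sup>2 * ((b - a) * (d - c)) + M)"
      using \<open>a < b\<close> \<open>c < d\<close> pq by (simp add: M_def mult_ac flip: ennreal_mult ennreal_plus)
    finally show ?thesis
      using \<open>a < b\<close> \<open>c < d\<close> pq by (subst (asm) ennreal_le_iff) (auto simp: M_def)
  qed
  show ?thesis
  proof (cases "L = 0")
    case True
    then show ?thesis using \<open>c < d\<close> pq by simp
  next
    case False
    then have "L > 0" using \<open>0 \<le> L\<close> by simp
    define e where "e = d - c"
    have "e > 0" using \<open>c < d\<close> by (simp add: e_def)
    \<comment> \<open>\<open>t = L / e\<close> maximises 2 t L - t^2 e, so \<open>key\<close> is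
      sharpest there.\<close>
    have "2 * (L / e) * L * (b - a) \<le> (L / e)\<^sup>2 * ((b - a) * e) + M"
      using key[of "L / e"] \<open>e > 0\<close> \<open>L > 0\<close> by (simp add: e_def)
    then have "2 * (L / e) * L * (b - a) * e \<le> ((L / e)\<^sup>2 * ((b - a) * e) + M) * e"
      using \<open>e > 0\<close> by (intro mult_right_mono) auto
    moreover have "2 * (L / e) * L * (b - a) * e = 2 * ((b - a) * L\<^sup>2)"
      "((L / e)\<^sup>2 * ((b - a) * e) + M) * e = (b - a) * L\<^sup>2 + e * M"
      using \<open>e > 0\<close> by (auto simp: field_simps power2_eq_square)
    ultimately show ?thesis unfolding e_def[symmetric] M_def[symmetric] by linarith
  qed
qed

section \<open>Boundary extension of biholomorphic maps\<close>

text \<open>The condition ranges over the closure: for fixed t < 1 the multiples t z of its points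
  form a compact subset of \<Omega>, and what a radius leaves outside this subset is short when t is
  near 1.\<close>

definition strictly_star :: "complex set \<Rightarrow> bool" where
  "strictly_star \<Omega> \<longleftrightarrow> open \<Omega> \<and> bounded \<Omega> \<and> 0 \<in> \<Omega> \<and>
     (\<forall>z\<in>closure \<Omega>. \<forall>t. 0 \<le> t \<longrightarrow> t < 1 \<longrightarrow> of_real t * z \<in> \<Omega>)"

text \<open>
  Small circles about \<open>p\<close> meet \<open>\<Omega>\<close> in a single arc. Angles are measured from the direction \<open>- u\<close>, and
  the condition on \<open>p + r u\<close> ensures that no point of \<open>\<Omega>\<close> is lost at \<open>\<theta> = \<plusminus>\<pi>\<close>.
\<close>

definition arc_cuts :: "complex set \<Rightarrow> complex \<Rightarrow> bool" where
  "arc_cuts \<Omega> p \<longleftrightarrow> (\<exists>u r0. cmod u = 1 \<and> 0 < r0 \<and> (\<forall>r. 0 < r \<longrightarrow> r < r0 \<longrightarrow>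
     p + of_real r * u \<notin> \<Omega> \<and>
     is_interval {\<theta>. -pi < \<theta> \<and> \<theta> < pi \<and> p - of_real r * u * cis \<theta> \<in> \<Omega>}))"

text \<open>
  The length-area inequality in the logarithmic coordinate \<open>z = p - u e\<^sup>w\<close>: the annuli about \<open>p\<close>
  become rectangles of unbounded width and fixed height, so the image arcs cannot all be long.
\<close>

lemma small_crosscut:
  assumes "open \<Omega>" and holo: "F holomorphic_on \<Omega>" and inj: "inj_on F \<Omega>" and bdd: "bounded (F ` \<Omega>)"
    and "arc_cuts \<Omega> p" "0 < \<delta>" "0 < \<rho>"
  shows "\<exists>r. 0 < r \<and> r < \<rho> \<and> (\<forall>z\<in>\<Omega> \<inter> sphere p r. \<forall>z'\<in>\<Omega> \<inter> sphere p r. cmod (F z - F z') < \<delta>)"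
proof (rule ccontr)
  assume neg: "\<not> ?thesis"
  obtain u r0 where u: "cmod u = 1" and "0 < r0"
    and cut: "\<And>r. 0 < r \<Longrightarrow> r < r0 \<Longrightarrow> p + of_real r * u \<notin> \<Omega>"
      "\<And>r. 0 < r \<Longrightarrow> r < r0 \<Longrightarrow> is_interval {\<theta>. -pi < \<theta> \<and> \<theta> < pi \<and> p - of_real r * u * cis \<theta> \<in> \<Omega>}"
    using \<open>arc_cuts \<Omega> p\<close> unfolding arc_cuts_def by blast
  obtain q where q: "F ` \<Omega> \<subseteq> cbox (-q) q" using bdd bounded_subset_cbox_symmetric by blast
  define M where "M = (Re q - Re (-q)) * (Im q - Im (-q))"
  define b where "b = ln (min r0 \<rho>)"
  define k where "k w = p - u * exp w" for w
  have "u \<noteq> 0" using u by auto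
  have holok: "k holomorphic_on A" for A unfolding k_def[abs_def] by (intro holomorphic_intros)
  have bound: "N * \<delta>\<^sup>2 \<le> 2 * pi * M" if "N > 0" for N
  proof -
    define U where "U = {w. b - N < Re w \<and> Re w < b \<and> -pi < Im w \<and> Im w < pi \<and> k w \<in> \<Omega>}"
    have Ueq: "U = {w. b - N < Re w} \<inter> {w. Re w < b} \<inter> {w. -pi < Im w} \<inter> {w. Im w < pi} \<inter> k -` \<Omega>"
      by (auto simp: U_def)
    have "open (k -` \<Omega>)"
      using continuous_open_preimage[OF holomorphic_on_imp_continuous_on[OF holok[of UNIV]] open_UNIV \<open>open \<Omega>\<close>]
      by simp
    then have "open U"
      unfolding Ueq by (intro open_Int open_halfspace_Re_gt open_halfspace_Re_lt open_halfspace_Im_gt open_halfspace_Im_lt)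
    have 1: "(F \<circ> k) holomorphic_on U"
      using holok holo by (intro holomorphic_on_compose_gen[of k U F \<Omega>]) (auto simp: U_def)
    have 2: "inj_on (F \<circ> k) U"
    proof (rule comp_inj_on)
      show "inj_on k U"
      proof (rule inj_onI)
        fix w w' assume *: "w \<in> U" "w' \<in> U" "k w = k w'"
        then have "exp w = exp w'" using \<open>u \<noteq> 0\<close> by (simp add: k_def)
        moreover have "\<bar>Im w - Im w'\<bar> < 2 * pi" using * by (auto simp: U_def)
        ultimately show "w = w'" by (rule exp_complex_eqI[rotated])
      qed
      show "inj_on F (k ` U)" using inj by (rule inj_on_subset) (auto simp: U_def)
    qed
    have 3: "(F \<circ> k) ` U \<subseteq> cbox (-q) q" using q by (auto simp: U_def)
    have 4: "\<exists>y1 y2. y1 \<le> y2 \<and> (\<forall>y\<in>{y1..y2}. Complex x y \<in> U) \<and>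
                   \<delta> \<le> cmod ((F \<circ> k) (Complex x y2) - (F \<circ> k) (Complex x y1))"
      if x: "b - N < x" "x < b" for x
    proof -
      define r where "r = exp x"
      have r: "0 < r" "r < min r0 \<rho>"
      proof -
        have "exp x < exp (ln (min r0 \<rho>))" using x by (simp add: b_def)
        also have "\<dots> = min r0 \<rho>" using \<open>0 < r0\<close> \<open>0 < \<rho>\<close> by (intro exp_ln) auto
        finally show "r < min r0 \<rho>" by (simp add: r_def)
      qed (simp add: r_def)
      then obtain z z' where z: "z \<in> \<Omega>" "z \<in> sphere p r" "z' \<in> \<Omega>" "z' \<in> sphere p r" "\<delta> \<le> cmod (F z - F z')"
      proof -
        have "\<not> (\<forall>z\<in>\<Omega> \<inter> sphere p r. \<forall>z'\<in>\<Omega> \<inter> sphere p r. cmod (F z - F z') < \<delta>)"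
          using neg r by auto
        then show ?thesis using that by (meson IntD1 IntD2 not_less)
      qed
      have kx: "k (Complex x y) = p - of_real r * u * cis y" for y
        by (simp add: k_def r_def exp_eq_polar exp_of_real)
      have ang: "\<exists>\<theta>. -pi < \<theta> \<and> \<theta> < pi \<and> z = p - of_real r * u * cis \<theta>"
        if "z \<in> \<Omega>" "z \<in> sphere p r" for z
      proof -
        define \<theta> where "\<theta> = Arg ((p - z) / u)"
        have "cmod ((p - z) / u) = r" using that u by (simp add: norm_divide dist_norm)
        then have "(p - z) / u = of_real r * cis \<theta>"
          by (metis \<theta>_def rcis_def rcis_cmod_Arg)
        then have eq: "z = p - of_real r * u * cis \<theta>" using \<open>u \<noteq> 0\<close> by (simp add: field_simps)
        have "\<theta> \<noteq> pi"
        proof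
          assume "\<theta> = pi"
          then have "z = p + of_real r * u" using eq by (simp)
          then show False using cut(1)[of r] r that by simp
        qed
        moreover have "-pi < \<theta>" "\<theta> \<le> pi" unfolding \<theta>_def using Arg_bounded by auto
        ultimately show ?thesis using eq by (metis order_le_less)
      qed
      obtain \<theta> \<theta>' where \<theta>: "-pi < \<theta>" "\<theta> < pi" "z = p - of_real r * u * cis \<theta>"
        "-pi < \<theta>'" "\<theta>' < pi" "z' = p - of_real r * u * cis \<theta>'"
        using ang[OF z(1,2)] ang[OF z(3,4)] by metis
      have iv: "is_interval {\<theta>. -pi < \<theta> \<and> \<theta> < pi \<and> p - of_real r * u * cis \<theta> \<in> \<Omega>}" (is "is_interval ?I")
        using cut(2) r by simp
      have I: "\<theta> \<in> ?I" "\<theta>' \<in> ?I" using \<theta> z by auto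
      have "y \<in> ?I" if "y \<in> {min \<theta> \<theta>'..max \<theta> \<theta>'}" for y
      proof (cases "\<theta> \<le> \<theta>'")
        case True then show ?thesis using iv I that mem_is_interval_1_I[of ?I \<theta> \<theta>' y] by auto
      next
        case False then show ?thesis using iv I that mem_is_interval_1_I[of ?I \<theta>' \<theta> y] by auto
      qed
      then have "Complex x y \<in> U" if "y \<in> {min \<theta> \<theta>'..max \<theta> \<theta>'}" for y
        using that x by (auto simp: U_def kx)
      moreover have "\<delta> \<le> cmod ((F \<circ> k) (Complex x (max \<theta> \<theta>')) - (F \<circ> k) (Complex x (min \<theta> \<theta>')))"
        using z(5) \<theta>(3,6) by (cases "\<theta> \<le> \<theta>'") (simp_all add: kx max_def min_def norm_minus_commute)
      ultimately show ?thesis by (intro exI[of _ "min \<theta> \<theta>'"] exI[of _ "max \<theta> \<theta>'"]) auto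
    qed
    have "(b - (b - N)) * \<delta>\<^sup>2 \<le> (pi - (-pi)) * ((Re q - Re (-q)) * (Im q - Im (-q)))"
      using \<open>0 < \<delta>\<close> that by (intro length_area[OF \<open>open U\<close> 1 2 3 _ _ _ 4]) (auto simp: U_def)
    then show ?thesis by (simp add: M_def)
  qed
  \<comment> \<open>A width N with N \<delta>^2 = 2 pi |M| + \<delta>^2 exceeds the bound; the
    absolute value makes N positive whatever the sign of M.\<close>
  have "(2 * pi * \<bar>M\<bar> / \<delta>\<^sup>2 + 1) * \<delta>\<^sup>2 \<le> 2 * pi * M"
    by (rule bound) (simp add: add_nonneg_pos)
  then have "2 * pi * \<bar>M\<bar> + \<delta>\<^sup>2 \<le> 2 * pi * M" using \<open>0 < \<delta>\<close> by (simp add: distrib_right)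
  moreover have "2 * pi * M \<le> 2 * pi * \<bar>M\<bar>" by (intro mult_left_mono) auto
  ultimately show False using zero_less_power[OF \<open>0 < \<delta>\<close>, of 2] by linarith
qed

text \<open>
  The point \<open>F z\<close> lies near the boundary of \<open>\<Omega>2\<close>, and the radial segment from \<open>F z\<close> to \<open>0\<close> pulls back
  to a path leaving \<open>ball p r\<close>. It crosses \<open>sphere p r\<close> before the segment gets far from \<open>F z\<close>, and
  all points of \<open>\<Omega>1\<close> on that circle have nearby images.
\<close>

lemma cauchy_at_frontier:
  assumes star: "strictly_star \<Omega>2" and "open \<Omega>1" and cut: "arc_cuts \<Omega>1 p" and "p \<notin> \<Omega>1"
    and holo: "F holomorphic_on \<Omega>1" and contG: "continuous_on \<Omega>2 G"
    and F: "\<And>z. z \<in> \<Omega>1 \<Longrightarrow> F z \<in> \<Omega>2 \<and> G (F z) = z"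
    and G: "\<And>z. z \<in> \<Omega>2 \<Longrightarrow> G z \<in> \<Omega>1 \<and> F (G z) = z"
    and "0 < \<epsilon>"
  shows "\<exists>r>0. \<forall>z\<in>\<Omega>1 \<inter> ball p r. \<forall>z'\<in>\<Omega>1 \<inter> ball p r. cmod (F z - F z') < \<epsilon>"
proof -
  have \<Omega>2: "open \<Omega>2" "bounded \<Omega>2" "0 \<in> \<Omega>2"
     "\<And>z t. z \<in> closure \<Omega>2 \<Longrightarrow> 0 \<le> t \<Longrightarrow> t < 1 \<Longrightarrow> of_real t * z \<in> \<Omega>2"
    using star by (auto simp: strictly_star_def)
  obtain B where B: "B > 0" "\<And>z. z \<in> \<Omega>2 \<Longrightarrow> cmod z \<le> B" using \<Omega>2(2) bounded_pos by metis
  \<comment> \<open>\<eta> B <= \<epsilon>/4 bounds the length of the radial piece outside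
    \<open>K\<close>. Three quarters are spent in the end: two radial pieces and one jump along the
    crosscut.\<close>
  define \<eta> where "\<eta> = min (1/2) (\<epsilon> / (4 * B))"
  have \<eta>: "0 < \<eta>" "\<eta> < 1" "\<eta> * B \<le> \<epsilon> / 4"
    using B(1) \<open>0 < \<epsilon>\<close> by (auto simp: \<eta>_def min_def field_simps)
  define K where "K = (\<lambda>z. of_real (1 - \<eta>) * z) ` closure \<Omega>2"
  have "compact K" unfolding K_def
    by (intro compact_continuous_image continuous_intros compact_closure[THEN iffD2] \<Omega>2(2))
  have "K \<subseteq> \<Omega>2" using \<Omega>2(4) \<eta> by (auto simp: K_def simp del: of_real_diff)
  have "compact (G ` K)"
    using \<open>compact K\<close> continuous_on_subset[OF contG \<open>K \<subseteq> \<Omega>2\<close>] by (intro compact_continuous_image)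
  moreover have "p \<notin> G ` K" using G \<open>K \<subseteq> \<Omega>2\<close> \<open>p \<notin> \<Omega>1\<close> by auto
  ultimately obtain \<rho> where \<rho>: "\<rho> > 0" "ball p \<rho> \<subseteq> - G ` K"
    using openE[of "- G ` K" p] compact_imp_closed[of "G ` K"] by (metis ComplI open_Compl)
  have injF: "inj_on F \<Omega>1" using F by (metis inj_onI)
  have "bounded (F ` \<Omega>1)" using F \<Omega>2(2) by (meson bounded_subset image_subsetI)
  from small_crosscut[OF \<open>open \<Omega>1\<close> holo injF this cut, of "\<epsilon>/4" \<rho>]
  obtain r where r: "0 < r" "r < \<rho>"
    "\<And>z z'. z \<in> \<Omega>1 \<Longrightarrow> z \<in> sphere p r \<Longrightarrow> z' \<in> \<Omega>1 \<Longrightarrow> z' \<in> sphere p r \<Longrightarrow> cmod (F z - F z') < \<epsilon>/4"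
    using \<open>0 < \<epsilon>\<close> \<rho>(1) by auto
  have near: "\<exists>b. b \<in> \<Omega>1 \<and> b \<in> sphere p r \<and> cmod (F z - F b) \<le> \<epsilon>/4" if z: "z \<in> \<Omega>1" "z \<in> ball p r" for z
  proof -
    define \<gamma> where "\<gamma> s = G (of_real s * F z)" for s :: real
    have Fz: "F z \<in> \<Omega>2" using F z by auto
    have seg: "of_real s * F z \<in> \<Omega>2" if "0 \<le> s" "s \<le> 1" for s
      using \<Omega>2(4)[of "F z" s] Fz closure_subset that by (cases "s = 1") auto
    have cont: "continuous_on {0..1} (\<lambda>s. dist p (\<gamma> s))"
      unfolding \<gamma>_def
      by (intro continuous_intros continuous_on_compose2[OF contG]) (use seg in auto)
    have "0 \<in> K" using \<Omega>2(3) closure_subset by (force simp: K_def image_iff)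
    then have "G 0 \<notin> ball p \<rho>" using \<rho>(2) by auto
    then have g0: "r \<le> dist p (\<gamma> 0)" using r by (simp add: \<gamma>_def)
    have g1: "dist p (\<gamma> 1) \<le> r" using z F by (simp add: \<gamma>_def)
    obtain s where s: "0 \<le> s" "s \<le> 1" "dist p (\<gamma> s) = r"
      using IVT2'[OF g1 g0 _ cont] by auto
    define b where "b = \<gamma> s"
    have b: "b \<in> \<Omega>1" "F b = of_real s * F z" using G[OF seg[OF s(1,2)]] by (auto simp: b_def \<gamma>_def)
    have "b \<notin> G ` K" using s(3) r(2) \<rho>(2) by (auto simp: b_def)
    then have notK: "of_real s * F z \<notin> K" using b_def \<gamma>_def by auto
    \<comment> \<open>If s were at most 1 - \<eta>, then s F z would be 1 - \<eta> times another
      point of the radial segment and would lie in \<open>K\<close>, whose image under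
      \<open>G\<close> misses \<open>ball p \<rho>\<close>.\<close>
    have "1 - \<eta> < s"
    proof (rule ccontr)
      assume "\<not> ?thesis"
      then have "s / (1 - \<eta>) \<le> 1" using \<eta> by (simp add: field_simps)
      then have "of_real (s / (1 - \<eta>)) * F z \<in> closure \<Omega>2"
        using seg[of "s / (1 - \<eta>)"] s \<eta> closure_subset by auto
      then have "of_real (1 - \<eta>) * (of_real (s / (1 - \<eta>)) * F z) \<in> K" unfolding K_def by blast
      moreover have "of_real (1 - \<eta>) * (of_real (s / (1 - \<eta>)) * F z) = of_real s * F z"
        using \<eta> by (simp flip: mult.assoc of_real_mult)
      ultimately show False using notK by simp
    qed
    have "cmod (F z - F b) = cmod (of_real (1 - s) * F z)" using b by (simp add: algebra_simps)
    also have "\<dots> = (1 - s) * cmod (F z)" using s by (simp only: norm_mult norm_of_real)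
    also have "\<dots> \<le> \<eta> * B" using \<open>1 - \<eta> < s\<close> s \<eta> B Fz by (intro mult_mono) auto
    finally show ?thesis using \<eta> b s by (intro exI[of _ b]) (auto simp: b_def)
  qed
  show ?thesis
  proof (intro exI[of _ r] conjI ballI)
    fix z z' assume "z \<in> \<Omega>1 \<inter> ball p r" "z' \<in> \<Omega>1 \<inter> ball p r"
    then obtain b b' where b: "b \<in> \<Omega>1" "b \<in> sphere p r" "cmod (F z - F b) \<le> \<epsilon>/4"
       "b' \<in> \<Omega>1" "b' \<in> sphere p r" "cmod (F z' - F b') \<le> \<epsilon>/4" using near[of z] near[of z'] by auto
    have "cmod (F z - F z') = cmod ((F z - F b) + (F b - F b') - (F z' - F b'))" by simp
    also have "\<dots> \<le> cmod (F z - F b) + cmod (F b - F b') + cmod (F z' - F b')"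
      by (metis norm_triangle_ineq4 norm_triangle_ineq add_right_mono order_trans)
    also have "\<dots> < \<epsilon>" using b r(3)[of b b'] \<open>0 < \<epsilon>\<close> by auto
    finally show "cmod (F z - F z') < \<epsilon>" .
  qed (use r in auto)
qed

text \<open>Each point of the compact closure has a ball on which \<open>F\<close> oscillates by
  less than \<epsilon>, by continuity inside and by \<open>cauchy_at_frontier\<close> on the
  frontier. A Lebesgue number of this cover is the required distance.\<close>

lemma biholomorphic_uniformly_continuous:
  assumes "strictly_star \<Omega>2" and "open \<Omega>1" "bounded \<Omega>1" and cut: "\<And>p. p \<in> closure \<Omega>1 - \<Omega>1 \<Longrightarrow> arc_cuts \<Omega>1 p"
    and holo: "F holomorphic_on \<Omega>1" and contG: "continuous_on \<Omega>2 G"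
    and F: "\<And>z. z \<in> \<Omega>1 \<Longrightarrow> F z \<in> \<Omega>2 \<and> G (F z) = z"
    and G: "\<And>z. z \<in> \<Omega>2 \<Longrightarrow> G z \<in> \<Omega>1 \<and> F (G z) = z"
  shows "uniformly_continuous_on \<Omega>1 F"
  unfolding uniformly_continuous_on_def
proof (intro allI impI)
  fix \<epsilon> :: real assume "0 < \<epsilon>"
  define C where "C p r \<longleftrightarrow> (\<forall>z\<in>\<Omega>1 \<inter> ball p r. \<forall>z'\<in>\<Omega>1 \<inter> ball p r. cmod (F z - F z') < \<epsilon>)" for p r
  have loc: "\<exists>r>0. C p r" if p: "p \<in> closure \<Omega>1" for p
  proof (cases "p \<in> \<Omega>1")
    case True
    have "continuous_on \<Omega>1 F" using holo by (rule holomorphic_on_imp_continuous_on)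
    then obtain d where d: "d > 0" "\<And>z. z \<in> \<Omega>1 \<Longrightarrow> dist z p < d \<Longrightarrow> dist (F z) (F p) < \<epsilon>/2"
      using True \<open>0 < \<epsilon>\<close> unfolding continuous_on_iff by (meson half_gt_zero)
    have "C p d" unfolding C_def
    proof (intro ballI)
      fix z z' assume "z \<in> \<Omega>1 \<inter> ball p d" "z' \<in> \<Omega>1 \<inter> ball p d"
      then have "dist (F z) (F p) < \<epsilon>/2" "dist (F z') (F p) < \<epsilon>/2"
        using d(2)[of z] d(2)[of z'] by (auto simp: dist_commute[of p])
      then have "dist (F z) (F z') < \<epsilon>" by (metis dist_triangle_half_l dist_commute)
      then show "cmod (F z - F z') < \<epsilon>" by (simp add: dist_norm)
    qed
    then show ?thesis using d by blast
  next
    case False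
    then show ?thesis
      unfolding C_def using cauchy_at_frontier[OF assms(1,2) cut _ holo contG F G \<open>0 < \<epsilon>\<close>, of p] p by blast
  qed
  obtain d where d: "d > 0" "\<And>x. x \<in> closure \<Omega>1 \<Longrightarrow> \<exists>B\<in>{ball p r | p r. C p r}. ball x d \<subseteq> B"
  proof (rule Heine_Borel_lemma[of "closure \<Omega>1" "{ball p r | p r. C p r}"])
    show "compact (closure \<Omega>1)" using \<open>bounded \<Omega>1\<close> by (simp add: compact_closure)
    show "closure \<Omega>1 \<subseteq> \<Union>{ball p r | p r. C p r}" 
    proof
      fix p assume "p \<in> closure \<Omega>1"
      then obtain r where "r > 0" "C p r" using loc by blast
      then have "p \<in> ball p r" "ball p r \<in> {ball p r | p r. C p r}" by auto
      then show "p \<in> \<Union>{ball p r | p r. C p r}" by blast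
    qed
  qed auto
  show "\<exists>d>0. \<forall>x\<in>\<Omega>1. \<forall>x'\<in>\<Omega>1. dist x' x < d \<longrightarrow> dist (F x') (F x) < \<epsilon>"
  proof (intro exI[of _ d] conjI ballI impI d(1))
    fix x x' assume x: "x \<in> \<Omega>1" "x' \<in> \<Omega>1" "dist x' x < d"
    then obtain p r where "C p r" "ball x d \<subseteq> ball p r" using d(2)[of x] closure_subset by blast
    moreover have "x \<in> ball x d" "x' \<in> ball x d" using x d(1) by (auto simp: dist_commute)
    ultimately show "dist (F x') (F x) < \<epsilon>" using x unfolding C_def dist_norm by blast
  qed
qed

text \<open>The hypotheses are symmetric, so \<open>F\<close> and \<open>G\<close> both extend.
  Their compositions are the identity on dense subsets, hence on the closures, and this replaces any
  separate argument for injectivity on the frontier.\<close>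

lemma biholomorphic_extends_to_closure:
  assumes "strictly_star \<Omega>1" "strictly_star \<Omega>2"
    and "\<And>p. p \<in> closure \<Omega>1 - \<Omega>1 \<Longrightarrow> arc_cuts \<Omega>1 p" "\<And>p. p \<in> closure \<Omega>2 - \<Omega>2 \<Longrightarrow> arc_cuts \<Omega>2 p"
    and holo: "F holomorphic_on \<Omega>1" "G holomorphic_on \<Omega>2"
    and F: "\<And>z. z \<in> \<Omega>1 \<Longrightarrow> F z \<in> \<Omega>2 \<and> G (F z) = z"
    and G: "\<And>z. z \<in> \<Omega>2 \<Longrightarrow> G z \<in> \<Omega>1 \<and> F (G z) = z"
  obtains F' G' where "homeomorphism (closure \<Omega>1) (closure \<Omega>2) F' G'" "\<And>z. z \<in> \<Omega>1 \<Longrightarrow> F' z = F z"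
proof -
  have o: "open \<Omega>1" "open \<Omega>2" "bounded \<Omega>1" "bounded \<Omega>2" using assms by (auto simp: strictly_star_def)
  note c = holomorphic_on_imp_continuous_on
  obtain F' where F': "uniformly_continuous_on (closure \<Omega>1) F'" "\<And>z. z \<in> \<Omega>1 \<Longrightarrow> F z = F' z"
    using uniformly_continuous_on_extension_on_closure[OF biholomorphic_uniformly_continuous[OF assms(2) o(1,3)
        assms(3) holo(1) c[OF holo(2)] F G]] by metis
  obtain G' where G': "uniformly_continuous_on (closure \<Omega>2) G'" "\<And>z. z \<in> \<Omega>2 \<Longrightarrow> G z = G' z"
    using uniformly_continuous_on_extension_on_closure[OF biholomorphic_uniformly_continuous[OF assms(1) o(2,4)
        assms(4) holo(2) c[OF holo(1)] G F]] by metis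
  have cont: "continuous_on (closure \<Omega>1) F'" "continuous_on (closure \<Omega>2) G'"
    using F' G' by (auto intro: uniformly_continuous_imp_continuous)
  have sub: "F' ` closure \<Omega>1 \<subseteq> closure \<Omega>2" "G' ` closure \<Omega>2 \<subseteq> closure \<Omega>1"
    using F F'(2) G G'(2) closure_subset
    by (intro image_closure_subset[OF cont(1)] image_closure_subset[OF cont(2)]; force)+
  have GF: "G' (F' z) = z" if "z \<in> closure \<Omega>1" for z
  proof (rule continuous_constant_on_closure[of \<Omega>1 "\<lambda>z. G' (F' z) - z" 0 z, simplified])
    show "continuous_on (closure \<Omega>1) (\<lambda>z. G' (F' z) - z)"
      by (intro continuous_intros continuous_on_compose2[OF cont(2) cont(1)] sub)
    show "\<And>z. z \<in> \<Omega>1 \<Longrightarrow> G' (F' z) = z" using F F' G' by metis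
  qed (use that in auto)
  have FG: "F' (G' z) = z" if "z \<in> closure \<Omega>2" for z
  proof (rule continuous_constant_on_closure[of \<Omega>2 "\<lambda>z. F' (G' z) - z" 0 z, simplified])
    show "continuous_on (closure \<Omega>2) (\<lambda>z. F' (G' z) - z)"
      by (intro continuous_intros continuous_on_compose2[OF cont(1) cont(2)] sub)
    show "\<And>z. z \<in> \<Omega>2 \<Longrightarrow> F' (G' z) = z" using G F' G' by metis
  qed (use that in auto)
  have "homeomorphism (closure \<Omega>1) (closure \<Omega>2) F' G'"
    by (rule homeomorphismI[OF cont sub GF FG])
  with F'(2) that show ?thesis by metis
qed

section \<open>The symmetric quadrilateral\<close>

text \<open>The Klein rectangle |x| < c, |y| < s pulled back along z |-> 2 z / (1 + |z|^2), with
  denominators cleared. The condition on \<open>cmod z\<close> selects the inside, since the other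
  two are invariant under inversion in the unit circle.\<close>

definition quad_dom :: "real \<Rightarrow> real \<Rightarrow> complex set" where
  "quad_dom c s = {z. cmod z < 1 \<and> 2 * \<bar>Re z\<bar> < (1 + (cmod z)\<^sup>2) * c \<and> 2 * \<bar>Im z\<bar> < (1 + (cmod z)\<^sup>2) * s}"

definition quad_cl :: "real \<Rightarrow> real \<Rightarrow> complex set" where
  "quad_cl c s = {z. cmod z \<le> 1 \<and> 2 * \<bar>Re z\<bar> \<le> (1 + (cmod z)\<^sup>2) * c \<and> 2 * \<bar>Im z\<bar> \<le> (1 + (cmod z)\<^sup>2) * s}"

lemma quad_dom_subset_quad_cl: "quad_dom c s \<subseteq> quad_cl c s"
  by (auto simp: quad_dom_def quad_cl_def)

text \<open>Scaling z by t multiplies its Klein coordinates by t (1 + n^2) / (1 + t^2 n^2) with n =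
  |z|. This factor is below 1 because (1 - t) (1 - t n^2) > 0.\<close>

lemma scale_quad_cl:
  assumes "0 < c" "0 < s" "z \<in> quad_cl c s" "0 \<le> t" "t < 1"
  shows "of_real t * z \<in> quad_dom c s"
proof -
  define n where "n = cmod z"
  have n: "0 \<le> n" "n \<le> 1" "2 * \<bar>Re z\<bar> \<le> (1 + n\<^sup>2) * c" "2 * \<bar>Im z\<bar> \<le> (1 + n\<^sup>2) * s"
    using assms by (auto simp: n_def quad_cl_def)
  have "t * n\<^sup>2 \<le> t * 1" using n assms by (intro mult_left_mono power_le_one) auto
  then have "t * n\<^sup>2 < 1" using assms by linarith
  then have "0 < (1 - t) * (1 - t * n\<^sup>2)" using assms by simp
  then have key: "t * (1 + n\<^sup>2) < 1 + (t * n)\<^sup>2" by (simp add: algebra_simps power2_eq_square)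
  have "2 * \<bar>t * Re z\<bar> < (1 + (t * n)\<^sup>2) * c" "2 * \<bar>t * Im z\<bar> < (1 + (t * n)\<^sup>2) * s"
  proof -
    have "2 * \<bar>t * Re z\<bar> = t * (2 * \<bar>Re z\<bar>)" using assms by (simp add: abs_mult)
    also have "\<dots> \<le> t * ((1 + n\<^sup>2) * c)" using n assms by (intro mult_left_mono) auto
    also have "\<dots> < (1 + (t * n)\<^sup>2) * c" using mult_strict_right_mono[OF key \<open>0 < c\<close>] by (simp add: mult_ac)
    finally show "2 * \<bar>t * Re z\<bar> < (1 + (t * n)\<^sup>2) * c" .
    have "2 * \<bar>t * Im z\<bar> = t * (2 * \<bar>Im z\<bar>)" using assms by (simp add: abs_mult)
    also have "\<dots> \<le> t * ((1 + n\<^sup>2) * s)" using n assms by (intro mult_left_mono) auto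
    also have "\<dots> < (1 + (t * n)\<^sup>2) * s" using mult_strict_right_mono[OF key \<open>0 < s\<close>] by (simp add: mult_ac)
    finally show "2 * \<bar>t * Im z\<bar> < (1 + (t * n)\<^sup>2) * s" .
  qed
  moreover have "t * n \<le> t * 1" using n assms by (intro mult_left_mono) auto
  then have "t * n < 1" using assms by linarith
  moreover have "cmod (of_real t * z) = t * n" using assms by (simp add: norm_mult n_def)
  ultimately show ?thesis by (simp add: quad_dom_def)
qed

lemma open_quad_dom: "open (quad_dom c s)"
proof -
  have "quad_dom c s = {z. cmod z < 1} \<inter> {z. 2 * \<bar>Re z\<bar> < (1 + (cmod z)\<^sup>2) * c} \<inter> {z. 2 * \<bar>Im z\<bar> < (1 + (cmod z)\<^sup>2) * s}"
    by (auto simp: quad_dom_def)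
  then show ?thesis by (auto intro!: open_Int open_Collect_less continuous_intros)
qed

lemma closed_quad_cl: "closed (quad_cl c s)"
proof -
  have "quad_cl c s = {z. cmod z \<le> 1} \<inter> {z. 2 * \<bar>Re z\<bar> \<le> (1 + (cmod z)\<^sup>2) * c} \<inter> {z. 2 * \<bar>Im z\<bar> \<le> (1 + (cmod z)\<^sup>2) * s}"
    by (auto simp: quad_cl_def)
  then show ?thesis by (auto intro!: closed_Int closed_Collect_le continuous_intros)
qed

lemma tendsto_scale_one: "(\<lambda>n. of_real (1 - 1 / real (Suc n)) * z) \<longlonglongrightarrow> (z::complex)"
proof -
  have "(\<lambda>n. 1 - inverse (real (Suc n))) \<longlonglongrightarrow> 1 - 0"
    by (intro tendsto_intros LIMSEQ_inverse_real_of_nat)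
  then have "(\<lambda>n. of_real (1 - inverse (real (Suc n))) * z) \<longlonglongrightarrow> of_real 1 * z"
    by (intro tendsto_intros) simp
  then show ?thesis by (simp add: inverse_eq_divide)
qed

lemma closure_eq_if_scaled:
  assumes "\<Omega> \<subseteq> C" "closed C" and scale: "\<And>z t. z \<in> C \<Longrightarrow> 0 \<le> t \<Longrightarrow> t < 1 \<Longrightarrow> of_real t * z \<in> \<Omega>"
  shows "closure \<Omega> = (C :: complex set)"
proof
  show "closure \<Omega> \<subseteq> C" using assms by (simp add: closure_minimal)
  show "C \<subseteq> closure \<Omega>"
  proof
    fix z assume z: "z \<in> C"
    have "of_real (1 - 1 / real (Suc n)) * z \<in> \<Omega>" for n
      by (rule scale[OF z]) (auto simp: divide_simps)
    then show "z \<in> closure \<Omega>"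
      using tendsto_scale_one[of z] unfolding closure_sequential by (intro exI[of _ "\<lambda>n. of_real (1 - 1 / real (Suc n)) * z"]) auto
  qed
qed

lemma closure_quad_dom: "0 < c \<Longrightarrow> 0 < s \<Longrightarrow> closure (quad_dom c s) = quad_cl c s"
  by (intro closure_eq_if_scaled quad_dom_subset_quad_cl closed_quad_cl scale_quad_cl)

lemma strictly_star_quad_dom:
  assumes "0 < c" "0 < s" shows "strictly_star (quad_dom c s)"
  unfolding strictly_star_def
proof (intro conjI ballI allI impI)
  show "bounded (quad_dom c s)"
    by (rule bounded_subset[of "ball 0 1"]) (auto simp: quad_dom_def)
  show "0 \<in> quad_dom c s" using assms by (simp add: quad_dom_def)
qed (use assms in \<open>auto simp: open_quad_dom closure_quad_dom scale_quad_cl\<close>)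

lemma strictly_star_unit_ball: "strictly_star (ball 0 1)"
  unfolding strictly_star_def
proof (intro conjI ballI allI impI)
  fix z :: complex and t :: real assume "z \<in> closure (ball 0 1)" "0 \<le> t" "t < 1"
  then have "cmod z \<le> 1" by simp
  then have "t * cmod z \<le> t * 1" using \<open>0 \<le> t\<close> by (intro mult_left_mono) auto
  then show "of_real t * z \<in> ball 0 1" using \<open>0 \<le> t\<close> \<open>t < 1\<close> by (simp add: norm_mult)
qed auto

section \<open>Arcs cut out of the disk and of the quadrilateral by small circles about frontier
  points\<close>

lemma cos_between:
  assumes "-pi < a" "a \<le> x" "x \<le> b" "b < pi" "k < cos a" "k < cos b"
  shows "k < cos x"
proof (cases "0 \<le> x")
  case True
  then have "cos b \<le> cos x" using assms by (intro cos_monotone_0_pi_le) auto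
  then show ?thesis using assms by simp
next
  case False
  then have "cos (-a) \<le> cos (-x)" using assms by (intro cos_monotone_0_pi_le) auto
  then show ?thesis using assms by simp
qed

lemma is_interval_cos_gt: "is_interval {\<theta>. - pi < \<theta> \<and> \<theta> < pi \<and> k < cos \<theta>}"
  unfolding is_interval_1
proof (intro ballI allI impI CollectI)
  fix x y \<theta> assume "x \<in> {\<theta>. - pi < \<theta> \<and> \<theta> < pi \<and> k < cos \<theta>}" "y \<in> {\<theta>. - pi < \<theta> \<and> \<theta> < pi \<and> k < cos \<theta>}"
    "x \<le> \<theta> \<and> \<theta> \<le> y"
  then show "- pi < \<theta> \<and> \<theta> < pi \<and> k < cos \<theta>"
    using cos_between[of x \<theta> y k] by auto
qed

lemma sin_between:
  assumes "-pi/2 < a" "a \<le> x" "x \<le> b" "b < pi/2" "m * sin a < k" "m * sin b < k"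
  shows "m * sin x < k"
proof -
  have le: "sin a \<le> sin x" "sin x \<le> sin b" using assms by (auto intro!: sin_monotone_2pi_le)
  show ?thesis
  proof (cases "0 \<le> m")
    case True
    then have "m * sin x \<le> m * sin b" using le by (intro mult_left_mono) auto
    then show ?thesis using assms by simp
  next
    case False
    then have "m * sin x \<le> m * sin a" using le by (intro mult_left_mono_neg) auto
    then show ?thesis using assms by simp
  qed
qed

lemma cos_pos_imp_half_pi:
  assumes "-pi < x" "x < pi" "0 < cos x" shows "-pi/2 < x \<and> x < pi/2"
proof (rule ccontr)
  assume "\<not> ?thesis"
  then have "pi/2 \<le> \<bar>x\<bar>" by linarith
  moreover have "\<bar>x\<bar> \<le> pi" using assms by linarith
  ultimately have "cos \<bar>x\<bar> \<le> cos (pi/2)" by (intro cos_monotone_0_pi_le) auto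
  then show False using assms by simp
qed

lemma cmod_cis_sq:
  "(cmod (of_real a + of_real r * cis \<theta>))\<^sup>2 = a\<^sup>2 + 2 * a * r * cos \<theta> + r\<^sup>2"
proof -
  have "(cmod (of_real a + of_real r * cis \<theta>))\<^sup>2 = (a + r * cos \<theta>)\<^sup>2 + (r * sin \<theta>)\<^sup>2"
    by (simp add: cmod_power2)
  also have "\<dots> = a\<^sup>2 + 2 * a * r * cos \<theta> + r\<^sup>2 * ((sin \<theta>)\<^sup>2 + (cos \<theta>)\<^sup>2)" by algebra
  finally show ?thesis by simp
qed

lemma cmod_i_cis_sq:
  "(cmod (\<i> * of_real a + of_real r * cis \<theta>))\<^sup>2 = a\<^sup>2 + 2 * a * r * sin \<theta> + r\<^sup>2"
proof -
  have "(cmod (\<i> * of_real a + of_real r * cis \<theta>))\<^sup>2 = (r * cos \<theta>)\<^sup>2 + (a + r * sin \<theta>)\<^sup>2"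
    by (simp add: cmod_power2)
  also have "\<dots> = a\<^sup>2 + 2 * a * r * sin \<theta> + r\<^sup>2 * ((sin \<theta>)\<^sup>2 + (cos \<theta>)\<^sup>2)" by algebra
  finally show ?thesis by simp
qed

lemma unit_circle_polar:
  assumes "cmod p = 1"
  shows "cmod (p - of_real r * p * cis \<theta>) < 1 \<longleftrightarrow> r\<^sup>2 < 2 * r * cos \<theta>"
proof -
  have eq: "p - of_real r * p * cis \<theta> = p * (of_real 1 + of_real (-r) * cis \<theta>)" by (simp add: algebra_simps)
  have "(cmod (p - of_real r * p * cis \<theta>))\<^sup>2 = 1 - 2 * r * cos \<theta> + r\<^sup>2"
    unfolding eq norm_mult assms using cmod_cis_sq[of 1 "-r" \<theta>] by simp
  moreover have "cmod w < 1 \<longleftrightarrow> (cmod w)\<^sup>2 < 1" for w :: complex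
    by (simp add: abs_square_less_1)
  ultimately show ?thesis by auto
qed

lemma arc_cuts_unit_ball:
  assumes "cmod p = 1" shows "arc_cuts (ball 0 1) p"
  unfolding arc_cuts_def
proof (intro exI[of _ p] exI[of _ 1] conjI allI impI)
  fix r :: real assume r: "0 < r" "r < 1"
  have "p + of_real r * p = of_real (1 + r) * p" by (simp add: algebra_simps)
  then show "p + of_real r * p \<notin> ball 0 1" using assms r by (simp only: mem_ball_0 norm_mult norm_of_real) simp
  have iff: "p - of_real r * p * cis \<theta> \<in> ball 0 1 \<longleftrightarrow> r / 2 < cos \<theta>" for \<theta>
    using unit_circle_polar[OF assms, of r \<theta>] r by (simp add: power2_eq_square mult.commute[of 2])
  show "is_interval {\<theta>. - pi < \<theta> \<and> \<theta> < pi \<and> p - of_real r * p * cis \<theta> \<in> ball 0 1}"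
    unfolding iff by (rule is_interval_cos_gt)
qed (use assms in auto)

text \<open>Two bounding circles cannot meet inside the disk: by c^2 + s^2 = 1, equality in both
  Klein conditions gives 4 n^2 = (1 + n^2)^2, hence n = 1. On the unit circle the conditions read
  |x| <= c and |y| <= s, while x^2 + y^2 = c^2 + s^2, which leaves the vertices only.\<close>

lemma quad_cl_frontier_cases:
  assumes cs: "0 < c" "0 < s" "c\<^sup>2 + s\<^sup>2 = 1" and p: "p \<in> quad_cl c s - quad_dom c s"
  shows "(cmod p = 1 \<and> \<bar>Re p\<bar> = c \<and> \<bar>Im p\<bar> = s) \<or>
         (cmod p < 1 \<and> 2 * \<bar>Re p\<bar> = (1 + (cmod p)\<^sup>2) * c \<and> 2 * \<bar>Im p\<bar> < (1 + (cmod p)\<^sup>2) * s) \<or>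
         (cmod p < 1 \<and> 2 * \<bar>Re p\<bar> < (1 + (cmod p)\<^sup>2) * c \<and> 2 * \<bar>Im p\<bar> = (1 + (cmod p)\<^sup>2) * s)"
proof -
  define n where "n = cmod p"
  have n2: "n\<^sup>2 = (Re p)\<^sup>2 + (Im p)\<^sup>2" by (simp add: n_def cmod_power2)
  have le: "n \<le> 1" "2 * \<bar>Re p\<bar> \<le> (1 + n\<^sup>2) * c" "2 * \<bar>Im p\<bar> \<le> (1 + n\<^sup>2) * s"
    and nle: "\<not> (n < 1 \<and> 2 * \<bar>Re p\<bar> < (1 + n\<^sup>2) * c \<and> 2 * \<bar>Im p\<bar> < (1 + n\<^sup>2) * s)"
    using p by (auto simp: n_def quad_cl_def quad_dom_def)
  show ?thesis
  proof (cases "n = 1")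
    case True
    then have xy: "\<bar>Re p\<bar> \<le> c" "\<bar>Im p\<bar> \<le> s" "(Re p)\<^sup>2 + (Im p)\<^sup>2 = c\<^sup>2 + s\<^sup>2" using le n2 cs by auto
    then have "(Re p)\<^sup>2 \<le> c\<^sup>2" "(Im p)\<^sup>2 \<le> s\<^sup>2" using cs by (auto simp: abs_le_square_iff[symmetric])
    then have "(Re p)\<^sup>2 = c\<^sup>2" "(Im p)\<^sup>2 = s\<^sup>2" using xy(3) by linarith+
    then show ?thesis using True cs unfolding n_def by (auto simp: power2_eq_iff)
  next
    case False
    then have "n < 1" "0 \<le> n" using le by (auto simp: n_def)
    have "\<not> (2 * \<bar>Re p\<bar> = (1 + n\<^sup>2) * c \<and> 2 * \<bar>Im p\<bar> = (1 + n\<^sup>2) * s)"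
    proof
      assume eq: "2 * \<bar>Re p\<bar> = (1 + n\<^sup>2) * c \<and> 2 * \<bar>Im p\<bar> = (1 + n\<^sup>2) * s"
      have "(2 * \<bar>Re p\<bar>)\<^sup>2 + (2 * \<bar>Im p\<bar>)\<^sup>2 = (1 + n\<^sup>2)\<^sup>2 * (c\<^sup>2 + s\<^sup>2)"
        unfolding eq[THEN conjunct1] eq[THEN conjunct2] by (simp only: power_mult_distrib distrib_left)
      then have "4 * n\<^sup>2 = (1 + n\<^sup>2)\<^sup>2" using cs n2 by (simp add: power_mult_distrib)
      then have "(1 - n\<^sup>2)\<^sup>2 = 0" by algebra
      then have "n\<^sup>2 = 1" by simp
      then show False using \<open>n < 1\<close> \<open>0 \<le> n\<close> by (simp add: power2_eq_1_iff)
    qed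
    then show ?thesis using le nle \<open>n < 1\<close> unfolding n_def by auto
  qed
qed

text \<open>Each side lies on a circle orthogonal to the unit circle. For the vertical sides the
  center is \<sigma> / c and the radius s / c, and 1 / c^2 = 1 + (s / c)^2 expresses the
  orthogonality; the horizontal ones exchange c and s.\<close>

lemma outside_circle_eq:
  assumes cs: "0 < c" "0 < s" "c\<^sup>2 + s\<^sup>2 = 1" and \<sigma>: "\<sigma> = 1 \<or> \<sigma> = -1"
  shows "(cmod (z - of_real (\<sigma> / c)))\<^sup>2 - (s / c)\<^sup>2 = ((1 + (cmod z)\<^sup>2) * c - 2 * \<sigma> * Re z) / c"
    and "(cmod (z - \<i> * of_real (\<sigma> / s)))\<^sup>2 - (c / s)\<^sup>2 = ((1 + (cmod z)\<^sup>2) * s - 2 * \<sigma> * Im z) / s"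
proof -
  have s2: "s\<^sup>2 = 1 - c\<^sup>2" "c\<^sup>2 = 1 - s\<^sup>2" "\<sigma> * \<sigma> = 1" using cs \<sigma> by auto
  show "(cmod (z - of_real (\<sigma> / c)))\<^sup>2 - (s / c)\<^sup>2 = ((1 + (cmod z)\<^sup>2) * c - 2 * \<sigma> * Re z) / c"
    using cs(1) unfolding cmod_power2 minus_complex.sel power_divide s2(1)
    by (simp add: power2_diff s2(3) field_simps power2_eq_square)
  show "(cmod (z - \<i> * of_real (\<sigma> / s)))\<^sup>2 - (c / s)\<^sup>2 = ((1 + (cmod z)\<^sup>2) * s - 2 * \<sigma> * Im z) / s"
    using cs(2) unfolding cmod_power2 minus_complex.sel power_divide s2(2)
    by (simp add: power2_diff s2(3) field_simps power2_eq_square)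
qed

lemma outside_circle_iff:
  assumes cs: "0 < c" "0 < s" "c\<^sup>2 + s\<^sup>2 = 1" and \<sigma>: "\<sigma> = 1 \<or> \<sigma> = -1"
  shows "(s / c)\<^sup>2 < (cmod (z - of_real (\<sigma> / c)))\<^sup>2 \<longleftrightarrow> 2 * \<sigma> * Re z < (1 + (cmod z)\<^sup>2) * c"
    and "(c / s)\<^sup>2 < (cmod (z - \<i> * of_real (\<sigma> / s)))\<^sup>2 \<longleftrightarrow> 2 * \<sigma> * Im z < (1 + (cmod z)\<^sup>2) * s"
  using outside_circle_eq[OF assms, of z]
    zero_less_divide_iff[of "(1 + (cmod z)\<^sup>2) * c - 2 * \<sigma> * Re z" c] cs
    zero_less_divide_iff[of "(1 + (cmod z)\<^sup>2) * s - 2 * \<sigma> * Im z" s]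
  by linarith+

text \<open>Near an inner point of a side the domain is the outside of one circle. With u pointing
  to its center, angles are measured from the direction away from it, and lying outside becomes cos
  \<theta> > - r / (2 \<rho>), an interval condition. The restriction r < 2 \<rho> excludes \<theta>
  = pi.\<close>

lemma arc_cuts_circle:
  assumes e: "0 < e" "\<And>z. z \<in> ball p e \<Longrightarrow> z \<in> \<Omega> \<longleftrightarrow> \<rho>\<^sup>2 < (cmod (z - k))\<^sup>2"
    and \<rho>: "0 < \<rho>" "cmod (p - k) = \<rho>"
  shows "arc_cuts \<Omega> p"
proof -
  define u where "u = (k - p) / of_real \<rho>"
  have u: "cmod u = 1" using \<rho> by (simp add: u_def norm_divide norm_minus_commute)
  have k: "k = p + of_real \<rho> * u" using \<rho> by (simp add: u_def)
  have iff: "p - of_real r * u * cis \<theta> \<in> \<Omega> \<longleftrightarrow> - (r / (2 * \<rho>)) < cos \<theta>" if r: "0 < r" "r < e" for r \<theta>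
  proof -
    have "p - of_real r * u * cis \<theta> \<in> ball p e" using r u by (simp add: dist_norm norm_mult)
    then have "p - of_real r * u * cis \<theta> \<in> \<Omega> \<longleftrightarrow> \<rho>\<^sup>2 < (cmod (p - of_real r * u * cis \<theta> - k))\<^sup>2" by (rule e(2))
    also have "p - of_real r * u * cis \<theta> - k = - u * (of_real \<rho> + of_real r * cis \<theta>)"
      unfolding k by (simp add: algebra_simps)
    also have "(cmod \<dots>)\<^sup>2 = \<rho>\<^sup>2 + 2 * \<rho> * r * cos \<theta> + r\<^sup>2"
      using u by (simp only: norm_mult norm_minus_cancel mult_1 cmod_cis_sq)
    also have "\<rho>\<^sup>2 < \<dots> \<longleftrightarrow> 0 < r * (2 * \<rho> * cos \<theta> + r)" by (simp add: algebra_simps power2_eq_square)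
    also have "\<dots> \<longleftrightarrow> 0 < 2 * \<rho> * cos \<theta> + r" using r by (simp add: zero_less_mult_iff)
    also have "\<dots> \<longleftrightarrow> - (r / (2 * \<rho>)) < cos \<theta>" using \<rho> by (auto simp: field_simps)
    finally show ?thesis .
  qed
  show ?thesis
    unfolding arc_cuts_def
  proof (intro exI[of _ u] exI[of _ "min e (2 * \<rho>)"] conjI allI impI)
    fix r assume r: "0 < r" "r < min e (2 * \<rho>)"
    have "\<not> - (r / (2 * \<rho>)) < cos pi" using r by simp
    then show "p + of_real r * u \<notin> \<Omega>" using iff[of r pi] r by simp
    have "is_interval {\<theta>. - pi < \<theta> \<and> \<theta> < pi \<and> - (r / (2 * \<rho>)) < cos \<theta>}"
      by (rule is_interval_cos_gt)
    then show "is_interval {\<theta>. - pi < \<theta> \<and> \<theta> < pi \<and> p - of_real r * u * cis \<theta> \<in> \<Omega>}"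
      using iff[of r] r by simp
  qed (use e \<rho> u in auto)
qed

text \<open>
  At an ideal vertex the unit circle and two orthogonal circles meet; orthogonality is expressed by
  the position of the centers \<open>k\<close> and \<open>l\<close> on the tangent at \<open>p\<close>.
\<close>

lemma arc_cuts_cusp:
  assumes e: "0 < e" "\<And>z. z \<in> ball p e \<Longrightarrow> z \<in> \<Omega> \<longleftrightarrow> cmod z < 1 \<and> a\<^sup>2 < (cmod (z - k))\<^sup>2 \<and> b\<^sup>2 < (cmod (z - l))\<^sup>2"
    and p: "cmod p = 1" "p - k = \<i> * of_real a * p" "p - l = \<i> * of_real b * p"
  shows "arc_cuts \<Omega> p"
proof -
  have aux: "a\<^sup>2 < (cmod (p - of_real r * p * cis \<theta> - k))\<^sup>2 \<longleftrightarrow> 2 * a * sin \<theta> < r"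
    if r: "0 < r" and k: "p - k = \<i> * of_real a * p" for r \<theta> a k
  proof -
    have "p - of_real r * p * cis \<theta> - k = (p - k) - of_real r * p * cis \<theta>" by (simp add: algebra_simps)
    also have "\<dots> = p * (\<i> * of_real a + of_real (-r) * cis \<theta>)"
      unfolding k by (simp add: algebra_simps)
    finally have "(cmod (p - of_real r * p * cis \<theta> - k))\<^sup>2 = a\<^sup>2 + 2 * a * (-r) * sin \<theta> + (-r)\<^sup>2"
      by (simp only: norm_mult p(1) mult_1 cmod_i_cis_sq)
    then have "a\<^sup>2 < (cmod (p - of_real r * p * cis \<theta> - k))\<^sup>2 \<longleftrightarrow> a\<^sup>2 < a\<^sup>2 + 2 * a * (-r) * sin \<theta> + (-r)\<^sup>2"
      by (simp only:)
    also have "\<dots> \<longleftrightarrow> 0 < r * (r - 2 * a * sin \<theta>)"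
      by (simp add: algebra_simps power2_eq_square)
    also have "\<dots> \<longleftrightarrow> 2 * a * sin \<theta> < r" using r by (simp add: zero_less_mult_iff)
    finally show ?thesis .
  qed
  have iff: "p - of_real r * p * cis \<theta> \<in> \<Omega> \<longleftrightarrow> r / 2 < cos \<theta> \<and> 2 * a * sin \<theta> < r \<and> 2 * b * sin \<theta> < r"
    if r: "0 < r" "r < e" for r \<theta>
  proof -
    have "p - of_real r * p * cis \<theta> \<in> ball p e" using r p by (simp add: dist_norm norm_mult)
    from e(2)[OF this] show ?thesis
      using unit_circle_polar[OF p(1), of r \<theta>] r aux[OF r(1) p(2)] aux[OF r(1) p(3)]
      by (simp add: power2_eq_square mult.commute[of 2])
  qed
  show ?thesis
    unfolding arc_cuts_def
  proof (intro exI[of _ p] exI[of _ e] conjI allI impI)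
    fix r assume r: "0 < r" "r < e"
    have "\<not> r / 2 < cos pi" using r by simp
    then show "p + of_real r * p \<notin> \<Omega>" using iff[of r pi] r by simp
    have "is_interval {\<theta>. - pi < \<theta> \<and> \<theta> < pi \<and> r / 2 < cos \<theta> \<and> 2 * a * sin \<theta> < r \<and> 2 * b * sin \<theta> < r}"
      unfolding is_interval_1
    proof (intro ballI allI impI CollectI)
      fix x y \<theta> assume xy: "x \<in> {\<theta>. - pi < \<theta> \<and> \<theta> < pi \<and> r / 2 < cos \<theta> \<and> 2 * a * sin \<theta> < r \<and> 2 * b * sin \<theta> < r}"
        "y \<in> {\<theta>. - pi < \<theta> \<and> \<theta> < pi \<and> r / 2 < cos \<theta> \<and> 2 * a * sin \<theta> < r \<and> 2 * b * sin \<theta> < r}"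
        "x \<le> \<theta> \<and> \<theta> \<le> y"
      \<comment> \<open>The condition coming from the unit circle confines the angles to (-pi/2,
        pi/2). There the sine is monotone, so the two conditions on sin \<theta> cut out intervals
        as well.\<close>
      have "0 < cos x" "0 < cos y" using xy r by auto
      then have "-pi/2 < x" "y < pi/2" using cos_pos_imp_half_pi[of x] cos_pos_imp_half_pi[of y] xy by auto
      moreover have "r / 2 < cos \<theta>" using xy by (intro cos_between[of x \<theta> y]) auto
      ultimately show "- pi < \<theta> \<and> \<theta> < pi \<and> r / 2 < cos \<theta> \<and> 2 * a * sin \<theta> < r \<and> 2 * b * sin \<theta> < r"
        using xy sin_between[of x \<theta> y "2 * a" r] sin_between[of x \<theta> y "2 * b" r] by auto
    qed
    then show "is_interval {\<theta>. - pi < \<theta> \<and> \<theta> < pi \<and> p - of_real r * p * cis \<theta> \<in> \<Omega>}"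
      using iff[of r] r by simp
  qed (use e p in auto)
qed

text \<open>The signs \<sigma> and \<tau> select the side of the axes on which p lies. In each case
  \<open>?W\<close> is an open neighborhood of p on which all inequalities hold except those that
  are equalities at p, so only the latter describe the domain near p.\<close>

lemma arc_cuts_quad_dom:
  assumes cs: "0 < c" "0 < s" "c\<^sup>2 + s\<^sup>2 = 1" and p: "p \<in> quad_cl c s - quad_dom c s"
  shows "arc_cuts (quad_dom c s) p"
proof -
  define \<sigma> where "\<sigma> = (if Re p \<ge> 0 then 1 else -1 :: real)"
  define \<tau> where "\<tau> = (if Im p \<ge> 0 then 1 else -1 :: real)"
  have \<sigma>: "\<sigma> = 1 \<or> \<sigma> = -1" "\<bar>Re p\<bar> = \<sigma> * Re p" "Re p = \<sigma> * \<bar>Re p\<bar>" by (auto simp: \<sigma>_def)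
  have \<tau>: "\<tau> = 1 \<or> \<tau> = -1" "\<bar>Im p\<bar> = \<tau> * Im p" "Im p = \<tau> * \<bar>Im p\<bar>" by (auto simp: \<tau>_def)
  have absR: "2 * \<bar>Re z\<bar> < k \<longleftrightarrow> 2 * \<sigma> * Re z < k \<and> - (2 * \<sigma> * Re z) < k" for z k using \<sigma>(1) by auto
  have absI: "2 * \<bar>Im z\<bar> < k \<longleftrightarrow> 2 * \<tau> * Im z < k \<and> - (2 * \<tau> * Im z) < k" for z k using \<tau>(1) by auto
  have pos: "0 < (1 + (cmod p)\<^sup>2) * c" "0 < (1 + (cmod p)\<^sup>2) * s" using cs by (simp_all add: add_pos_nonneg)
  note circ = outside_circle_eq[OF cs] outside_circle_iff[OF cs]
  consider (v) "cmod p = 1" "\<bar>Re p\<bar> = c" "\<bar>Im p\<bar> = s"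
    | (re) "cmod p < 1" "2 * \<bar>Re p\<bar> = (1 + (cmod p)\<^sup>2) * c" "2 * \<bar>Im p\<bar> < (1 + (cmod p)\<^sup>2) * s"
    | (im) "cmod p < 1" "2 * \<bar>Re p\<bar> < (1 + (cmod p)\<^sup>2) * c" "2 * \<bar>Im p\<bar> = (1 + (cmod p)\<^sup>2) * s"
    using quad_cl_frontier_cases[OF cs p] by blast
  then show ?thesis
  proof cases
    case v
    let ?W = "{z. - (2 * \<sigma> * Re z) < (1 + (cmod z)\<^sup>2) * c} \<inter> {z. - (2 * \<tau> * Im z) < (1 + (cmod z)\<^sup>2) * s}"
    have "open ?W" by (intro open_Int open_Collect_less continuous_intros)
    moreover have "p \<in> ?W" using pos \<sigma> \<tau> by auto
    ultimately obtain e where e: "0 < e" "ball p e \<subseteq> ?W" by (rule openE)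
    have peq: "p = of_real (\<sigma> * c) + \<i> * of_real (\<tau> * s)"
      using v \<sigma>(3) \<tau>(3) by (simp add: complex_eq_iff)
    have cc: "c * (c * c) + c * (s * s) = c" "s * (c * c) + s * (s * s) = s"
      "c * (c * s) + s * (s * s) = s"
      using cs(3) by (simp_all add: power2_eq_square flip: distrib_left) algebra+
    \<comment> \<open>The radii passed to \<open>arc_cuts_cusp\<close> are signed, since the centers
      may lie on either side of p on the tangent; the signs disappear in the squares.\<close>
    have s2: "(s / c)\<^sup>2 = (\<sigma> * \<tau> * s / c)\<^sup>2" "(c / s)\<^sup>2 = (- \<sigma> * \<tau> * c / s)\<^sup>2"
      using \<sigma>(1) \<tau>(1) by (auto simp: power2_eq_square)
    show ?thesis
    proof (rule arc_cuts_cusp[OF e(1), where a = "\<sigma> * \<tau> * s / c" and k = "of_real (\<sigma> / c)"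
          and b = "- \<sigma> * \<tau> * c / s" and l = "\<i> * of_real (\<tau> / s)"])
      fix z assume "z \<in> ball p e"
      then have "z \<in> ?W" using e(2) by blast
      then show "z \<in> quad_dom c s \<longleftrightarrow> cmod z < 1 \<and> (\<sigma> * \<tau> * s / c)\<^sup>2 < (cmod (z - of_real (\<sigma> / c)))\<^sup>2
            \<and> (- \<sigma> * \<tau> * c / s)\<^sup>2 < (cmod (z - \<i> * of_real (\<tau> / s)))\<^sup>2"
        unfolding s2[symmetric] circ(3)[OF \<sigma>(1)] circ(4)[OF \<tau>(1)] quad_dom_def mem_Collect_eq absR absI
        by auto
    next
      show "cmod p = 1" by (rule v)
      show "p - of_real (\<sigma> / c) = \<i> * of_real (\<sigma> * \<tau> * s / c) * p"
        using cs(1) \<sigma>(1) \<tau>(1) unfolding peq by (auto simp: complex_eq_iff field_simps cc)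
      show "p - \<i> * of_real (\<tau> / s) = \<i> * of_real (- \<sigma> * \<tau> * c / s) * p"
        using cs(2) \<sigma>(1) \<tau>(1) unfolding peq by (auto simp: complex_eq_iff field_simps cc)
    qed
  next
    case re
    let ?W = "{z. cmod z < 1} \<inter> {z. - (2 * \<sigma> * Re z) < (1 + (cmod z)\<^sup>2) * c} \<inter> {z. 2 * \<bar>Im z\<bar> < (1 + (cmod z)\<^sup>2) * s}"
    have "open ?W" by (intro open_Int open_Collect_less continuous_intros)
    moreover have "p \<in> ?W" using pos re \<sigma> by auto
    ultimately obtain e where e: "0 < e" "ball p e \<subseteq> ?W" by (rule openE)
    show ?thesis
    proof (rule arc_cuts_circle[OF e(1)])
      fix z assume "z \<in> ball p e"
      then have "z \<in> ?W" using e(2) by blast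
      then show "z \<in> quad_dom c s \<longleftrightarrow> (s / c)\<^sup>2 < (cmod (z - of_real (\<sigma> / c)))\<^sup>2"
        unfolding circ(3)[OF \<sigma>(1)] quad_dom_def mem_Collect_eq absR by auto
    next
      show "0 < s / c" using cs by simp
      have "(cmod (p - of_real (\<sigma> / c)))\<^sup>2 = (s / c)\<^sup>2" using circ(1)[OF \<sigma>(1), of p] re(2) \<sigma>(2) by (simp add: mult.assoc)
      then show "cmod (p - of_real (\<sigma> / c)) = s / c" using cs by (simp add: power2_eq_iff_nonneg)
    qed
  next
    case im
    let ?W = "{z. cmod z < 1} \<inter> {z. - (2 * \<tau> * Im z) < (1 + (cmod z)\<^sup>2) * s} \<inter> {z. 2 * \<bar>Re z\<bar> < (1 + (cmod z)\<^sup>2) * c}"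
    have "open ?W" by (intro open_Int open_Collect_less continuous_intros)
    moreover have "p \<in> ?W" using pos im \<tau> by auto
    ultimately obtain e where e: "0 < e" "ball p e \<subseteq> ?W" by (rule openE)
    show ?thesis
    proof (rule arc_cuts_circle[OF e(1)])
      fix z assume "z \<in> ball p e"
      then have "z \<in> ?W" using e(2) by blast
      then show "z \<in> quad_dom c s \<longleftrightarrow> (c / s)\<^sup>2 < (cmod (z - \<i> * of_real (\<tau> / s)))\<^sup>2"
        unfolding circ(4)[OF \<tau>(1)] quad_dom_def mem_Collect_eq absI by auto
    next
      show "0 < c / s" using cs by simp
      have "(cmod (p - \<i> * of_real (\<tau> / s)))\<^sup>2 = (c / s)\<^sup>2" using circ(2)[OF \<tau>(1), of p] im(3) \<tau>(2) by (simp add: mult.assoc)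
      then show "cmod (p - \<i> * of_real (\<tau> / s)) = c / s" using cs by (simp add: power2_eq_iff_nonneg)
    qed
  qed
qed

lemma quad_to_disc:
  assumes cs: "0 < c" "0 < s" "c\<^sup>2 + s\<^sup>2 = 1"
  obtains F G where "homeomorphism (quad_cl c s) (cball 0 1) F G"
    "F holomorphic_on quad_dom c s" "inj_on F (quad_dom c s)" "F ` quad_dom c s = ball 0 1"
proof -
  have star: "strictly_star (quad_dom c s)" using cs by (simp add: strictly_star_quad_dom)
  have "starlike (quad_dom c s)"
    unfolding starlike_def
  proof (intro bexI[of _ 0] ballI subsetI)
    fix z w assume z: "z \<in> quad_dom c s" "w \<in> closed_segment 0 z"
    then obtain t where t: "0 \<le> t" "t \<le> 1" "w = of_real t * z" by (auto simp: in_segment scaleR_conv_of_real)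
    then show "w \<in> quad_dom c s"
      using scale_quad_cl[OF cs(1,2), of z t] z quad_dom_subset_quad_cl by (cases "t = 1") auto
  next
    show "0 \<in> quad_dom c s" using star by (simp add: strictly_star_def)
  qed
  then have sc: "simply_connected (quad_dom c s)" by (rule starlike_imp_simply_connected)
  have "quad_dom c s \<noteq> {}" "bounded (quad_dom c s)" using star by (auto simp: strictly_star_def)
  then have ne: "quad_dom c s \<noteq> {}" "quad_dom c s \<noteq> UNIV" using not_bounded_UNIV by metis+
  obtain f g where fg: "f holomorphic_on quad_dom c s" "g holomorphic_on ball 0 1"
     "\<And>z. z \<in> quad_dom c s \<Longrightarrow> f z \<in> ball 0 1 \<and> g (f z) = z"
     "\<And>z. z \<in> ball 0 1 \<Longrightarrow> g z \<in> quad_dom c s \<and> f (g z) = z"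
    using simply_connected_eq_biholomorphic_to_disc[OF open_quad_dom, of c s] sc ne by metis
  have cut1: "\<And>p. p \<in> closure (quad_dom c s) - quad_dom c s \<Longrightarrow> arc_cuts (quad_dom c s) p"
    using cs by (simp add: closure_quad_dom arc_cuts_quad_dom)
  have cut2: "\<And>p. p \<in> closure (ball 0 1) - ball 0 1 \<Longrightarrow> arc_cuts (ball 0 1) p"
    by (intro arc_cuts_unit_ball) auto
  obtain F G where F: "homeomorphism (closure (quad_dom c s)) (closure (ball 0 1)) F G"
    "\<And>z. z \<in> quad_dom c s \<Longrightarrow> F z = f z"
    using biholomorphic_extends_to_closure[OF star strictly_star_unit_ball cut1 cut2 fg] by metis
  show ?thesis
  proof (rule that)
    show "homeomorphism (quad_cl c s) (cball 0 1) F G" using F(1) cs by (simp add: closure_quad_dom)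
    show "F holomorphic_on quad_dom c s" using fg(1) F(2) holomorphic_transform by metis
    show "inj_on F (quad_dom c s)" using F(2) fg(3) by (metis inj_onI)
    show "F ` quad_dom c s = ball 0 1"
    proof
      show "F ` quad_dom c s \<subseteq> ball 0 1" using fg(3) F(2) by auto
      show "ball 0 1 \<subseteq> F ` quad_dom c s" using fg(4) F(2) by (metis image_eqI subsetI)
    qed
  qed
qed

section \<open>The Schwarz-Christoffel map of the disk onto a rectangle\<close>

text \<open>The image W of the open disk is open, and its frontier lies in the image of the circle.
  A connected open set that misses the latter is therefore inside W or disjoint from it. The outside
  of the rectangle is unbounded, hence disjoint from W; the open rectangle meets W, hence is
  contained in it.\<close>

lemma open_rectangle_image:
  fixes F :: "complex \<Rightarrow> complex"
  assumes cont: "continuous_on (cball 0 1) F" and inj: "inj_on F (cball 0 1)"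
    and "F ` sphere 0 1 \<subseteq> cbox p q - box p q" and ne: "box p q \<noteq> {}"
  shows "F ` ball 0 1 = box p q" "F ` cball 0 1 = cbox p q"
proof -
  let ?W = "F ` ball 0 1"
  have oW: "open ?W"
    using continuous_on_subset[OF cont ball_subset_cball] inj_on_subset[OF inj ball_subset_cball]
    by (intro invariance_of_domain) auto
  have comp: "compact (F ` cball 0 1)" using cont by (intro compact_continuous_image) auto
  have un: "F ` cball 0 1 = ?W \<union> F ` sphere 0 1"
    unfolding image_Un[symmetric] by (rule arg_cong[where f="image F"]) auto
  have conn: "R \<subseteq> ?W \<or> R \<inter> ?W = {}" if R: "connected R" "open R" "R \<inter> F ` sphere 0 1 = {}" for R
  proof -
    have "?W \<inter> R = {} \<or> (- F ` cball 0 1) \<inter> R = {}"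
      using un R(3) by (intro connectedD[OF R(1) oW] open_Compl compact_imp_closed comp) auto
    then show ?thesis using un R(3) by blast
  qed
  have "?W \<subseteq> cbox p q"
  proof -
    have "connected (- cbox p q)"
      by (rule connected_complement_bounded_convex) (auto simp: DIM_complex)
    then have "- cbox p q \<subseteq> ?W \<or> - cbox p q \<inter> ?W = {}"
      using assms(3) by (intro conn) (auto simp: open_Compl)
    moreover have "\<not> - cbox p q \<subseteq> ?W"
    proof
      assume "- cbox p q \<subseteq> ?W"
      moreover have "bounded ?W"
        using comp by (rule bounded_subset[OF compact_imp_bounded]) auto
      ultimately have "bounded (- cbox p q)" by (rule bounded_subset[rotated])
      then have "bounded (- cbox p q \<union> cbox p q)" by (simp only: bounded_Un bounded_cbox)
      moreover have "- cbox p q \<union> cbox p q = UNIV" by auto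
      ultimately show False using not_bounded_UNIV by metis
    qed
    ultimately show ?thesis by auto
  qed
  then have "?W \<subseteq> box p q" using interior_maximal[OF _ oW, of "cbox p q"] by (simp add: interior_cbox)
  moreover have "box p q \<subseteq> ?W"
  proof -
    have "box p q \<subseteq> ?W \<or> box p q \<inter> ?W = {}"
      using assms(3) by (intro conn) (auto simp: convex_connected)
    moreover have "F 0 \<in> ?W" by auto
    ultimately show ?thesis using \<open>?W \<subseteq> box p q\<close> by blast
  qed
  ultimately show W: "?W = box p q" by blast
  show "F ` cball 0 1 = cbox p q"
  proof
    show "F ` cball 0 1 \<subseteq> cbox p q" unfolding un W using assms(3) box_subset_cbox by blast
    have "closure (box p q) \<subseteq> F ` cball 0 1"
      using comp un W by (intro closure_minimal compact_imp_closed) auto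
    then show "cbox p q \<subseteq> F ` cball 0 1" using ne by (simp add: closure_box)
  qed
qed

text \<open>The Schwarz-Christoffel integrand for the prevertices \<open>cis \<beta>\<close>,
  \<open>cis (- \<beta>)\<close> and their negatives, each with exponent -1/2; opposite prevertices
  share a factor in z^2. With one principal root per factor, both roots have argument below pi/4 in
  absolute value inside the disk.\<close>

definition sc_integrand :: "real \<Rightarrow> complex \<Rightarrow> complex" where
  "sc_integrand \<beta> z = inverse (csqrt (1 - cis (2 * \<beta>) * z\<^sup>2) * csqrt (1 - cis (- 2 * \<beta>) * z\<^sup>2))"

text \<open>Contains the open disk and all of the unit circle except the four prevertices, so a
  primitive on it is differentiable across the open sides.\<close>

definition sc_dom :: "real \<Rightarrow> complex set" where
  "sc_dom \<beta> = {z. 1 - cis (2 * \<beta>) * z\<^sup>2 \<notin> \<real>\<^sub>\<le>\<^sub>0 \<and> 1 - cis (- 2 * \<beta>) * z\<^sup>2 \<notin> \<real>\<^sub>\<le>\<^sub>0}"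

lemma open_sc_dom: "open (sc_dom \<beta>)"
proof -
  have "open ((\<lambda>z. 1 - w * z\<^sup>2) -` (- \<real>\<^sub>\<le>\<^sub>0))" for w :: complex
    by (intro continuous_open_vimage continuous_intros) (simp_all add: open_Compl closed_nonpos_Reals_complex)
  then have "open (((\<lambda>z. 1 - cis (2 * \<beta>) * z\<^sup>2) -` (- \<real>\<^sub>\<le>\<^sub>0)) \<inter> ((\<lambda>z. 1 - cis (- 2 * \<beta>) * z\<^sup>2) -` (- \<real>\<^sub>\<le>\<^sub>0)))"
    by blast
  moreover have "\<dots> = sc_dom \<beta>" by (auto simp: sc_dom_def)
  ultimately show ?thesis by simp
qed

text \<open>A point is removed when \<open>cis (2 * \<beta>) * z\<^sup>2\<close> or
  \<open>cis (- 2 * \<beta>) * z\<^sup>2\<close> is real and at least 1. These points form radial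
  rays running outwards, so no segment from 0 to a remaining point meets them.\<close>

lemma starlike_sc_dom: "starlike (sc_dom \<beta>)"
proof -
  have aux: "1 - w * z\<^sup>2 \<in> \<real>\<^sub>\<le>\<^sub>0" if "1 - w * (of_real t * z)\<^sup>2 \<in> \<real>\<^sub>\<le>\<^sub>0" "0 \<le> t" "t \<le> 1" for w z :: complex and t :: real
  proof -
    obtain r where r: "r \<le> 0" "1 - w * (of_real t * z)\<^sup>2 = of_real r"
    proof (rule that)
      show "Re (1 - w * (of_real t * z)\<^sup>2) \<le> 0" "1 - w * (of_real t * z)\<^sup>2 = of_real (Re (1 - w * (of_real t * z)\<^sup>2))"
        using \<open>1 - w * (of_real t * z)\<^sup>2 \<in> \<real>\<^sub>\<le>\<^sub>0\<close>
        unfolding complex_nonpos_Reals_iff complex_eq_iff by auto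
    qed
    have "t \<noteq> 0"
    proof
      assume "t = 0"
      then have "1 = complex_of_real r" using r(2) by simp
      then have "r = 1" by (metis of_real_1 of_real_eq_iff)
      then show False using r(1) by simp
    qed
    then have "w * z\<^sup>2 = of_real ((1 - r) / t\<^sup>2)"
      using r(2) by (simp add: field_simps power_mult_distrib)
    moreover have "1 \<le> (1 - r) / t\<^sup>2"
    proof -
      have "t\<^sup>2 \<le> 1" using that by (simp add: power_le_one)
      then show ?thesis using r(1) \<open>t \<noteq> 0\<close> by (simp add: le_divide_eq)
    qed
    moreover from calculation have "1 - w * z\<^sup>2 = of_real (1 - (1 - r) / t\<^sup>2)" by simp
    ultimately show ?thesis by (simp only: nonpos_Reals_of_real_iff diff_le_0_iff_le)
  qed
  show ?thesis
    unfolding starlike_def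
  proof (intro bexI[of _ 0] ballI subsetI)
    fix z w assume z: "z \<in> sc_dom \<beta>" "w \<in> closed_segment 0 z"
    then obtain t where t: "0 \<le> t" "t \<le> 1" "w = of_real t * z" by (auto simp: in_segment scaleR_conv_of_real)
    then show "w \<in> sc_dom \<beta>" using aux z(1) unfolding sc_dom_def by blast
  qed (simp add: sc_dom_def)
qed

lemma sc_integrand_holomorphic: "sc_integrand \<beta> holomorphic_on sc_dom \<beta>"
  unfolding sc_integrand_def[abs_def]
  by (intro holomorphic_intros) (auto simp: sc_dom_def)

lemma Re_one_minus_pos: "cmod x = 1 \<Longrightarrow> cmod z < 1 \<Longrightarrow> 0 < Re (1 - x * z\<^sup>2)"
proof -
  assume "cmod x = 1" "cmod z < 1"
  then have "cmod (x * z\<^sup>2) < 1" by (simp add: norm_mult norm_power power_less_one_iff abs_square_less_1)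
  then show ?thesis using complex_Re_le_cmod[of "x * z\<^sup>2"] by simp
qed

lemma ball_subset_sc_dom: "ball 0 1 \<subseteq> sc_dom \<beta>"
proof
  fix z :: complex assume "z \<in> ball 0 1"
  then have "0 < Re (1 - cis (2 * \<beta>) * z\<^sup>2)" "0 < Re (1 - cis (- 2 * \<beta>) * z\<^sup>2)"
    by (auto intro!: Re_one_minus_pos simp del: minus_complex.sel)
  then show "z \<in> sc_dom \<beta>" unfolding sc_dom_def by (auto simp del: minus_complex.sel simp: complex_nonpos_Reals_iff)
qed

text \<open>Both radicands lie in the right half-plane, so their roots have arguments in (-pi/4,
  pi/4), that is |Im| < Re. The product is again in the right half-plane, which inversion preserves.
  The positive real part is what makes the primitive injective.\<close>

lemma Re_sc_integrand_pos:
  assumes "cmod z < 1" shows "0 < Re (sc_integrand \<beta> z)"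
proof -
  have csq: "\<bar>Im (csqrt a)\<bar> < Re (csqrt a)" if "0 < Re a" for a
  proof -
    have *: "\<bar>Im r\<bar> < Re r" if "r\<^sup>2 = a" "0 \<le> Re r" for r
    proof -
      have "0 < Re (r\<^sup>2)" using \<open>0 < Re a\<close> that by simp
      then have "(Im r)\<^sup>2 < (Re r)\<^sup>2" by (simp add: power2_eq_square)
      then show ?thesis using that by (metis abs_of_nonneg not_le abs_le_square_iff)
    qed
    have "0 \<le> Re (csqrt a)" using csqrt_principal[of a] by argo
    then show ?thesis by (rule *[OF power2_csqrt])
  qed
  define u where "u = csqrt (1 - cis (2 * \<beta>) * z\<^sup>2)"
  define v where "v = csqrt (1 - cis (- 2 * \<beta>) * z\<^sup>2)"
  have u: "\<bar>Im u\<bar> < Re u" unfolding u_def using assms by (intro csq Re_one_minus_pos) auto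
  have v: "\<bar>Im v\<bar> < Re v" unfolding v_def using assms by (intro csq Re_one_minus_pos) auto
  have "Im u * Im v \<le> \<bar>Im u\<bar> * \<bar>Im v\<bar>" by (metis abs_ge_self abs_mult)
  also have "\<dots> < Re u * Re v" using u v by (intro mult_strict_mono) auto
  finally have "0 < Re (u * v)" by simp
  moreover have "0 < Re (inverse w)" if "0 < Re w" for w
    using that by (auto intro!: divide_pos_pos add_pos_nonneg)
  ultimately have "0 < Re (inverse (u * v))" by blast
  then show ?thesis by (simp add: sc_integrand_def u_def v_def)
qed

lemma sc_product:
  "(1 - cis (2 * \<beta>) * w) * (1 - cis (- 2 * \<beta>) * w) = 1 - of_real (2 * cos (2 * \<beta>)) * w + w\<^sup>2"
proof -
  have 1: "cis (2 * \<beta>) * cis (- 2 * \<beta>) = 1" by (simp add: cis_mult)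
  have 2: "cis (2 * \<beta>) + cis (- 2 * \<beta>) = of_real (2 * cos (2 * \<beta>))" by (simp add: complex_eq_iff)
  have "(1 - cis (2 * \<beta>) * w) * (1 - cis (- 2 * \<beta>) * w)
      = 1 - (cis (2 * \<beta>) + cis (- 2 * \<beta>)) * w + (cis (2 * \<beta>) * cis (- 2 * \<beta>)) * w\<^sup>2"
    by (simp add: algebra_simps power2_eq_square)
  then show ?thesis by (simp only: 1 2 mult_1)
qed

text \<open>The radicands differ by 2 sin (2 \<beta>) |z|^2 in modulus, so away from 0 at least one
  of them is bounded below, while the other is at least 1 - |z|^2. Only one inverse square root can
  thus become large, which leaves a singularity that is integrable along radii.\<close>

lemma cmod_sc_integrand_le:
  assumes \<beta>: "0 < \<beta>" "\<beta> < pi/2" and z: "cmod z < 1"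
  shows "cmod (sc_integrand \<beta> z) \<le> 2 / sqrt (sin (2 * \<beta>)) / sqrt (1 - cmod z)"
proof -
  define \<kappa> where "\<kappa> = sin (2 * \<beta>)"
  define n where "n = cmod z"
  define a where "a = 1 - cis (2 * \<beta>) * z\<^sup>2"
  define b where "b = 1 - cis (- 2 * \<beta>) * z\<^sup>2"
  have \<kappa>: "0 < \<kappa>" "\<kappa> \<le> 1" using \<beta> by (auto simp: \<kappa>_def intro!: sin_gt_zero)
  have n: "0 \<le> n" "n < 1" using z by (auto simp: n_def)
  have n2: "n\<^sup>2 \<le> n" using n by (simp add: power2_eq_square mult_left_le)
  have la: "1 - n\<^sup>2 \<le> cmod a" and lb: "1 - n\<^sup>2 \<le> cmod b"
    using norm_triangle_ineq2[of 1 "cis (2 * \<beta>) * z\<^sup>2"] norm_triangle_ineq2[of 1 "cis (- 2 * \<beta>) * z\<^sup>2"]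
    by (auto simp: a_def b_def n_def norm_mult norm_power)
  have "b - a = z\<^sup>2 * (cis (2 * \<beta>) - cis (- 2 * \<beta>))" by (simp add: a_def b_def algebra_simps)
  also have "cis (2 * \<beta>) - cis (- 2 * \<beta>) = \<i> * of_real (2 * \<kappa>)" by (simp add: complex_eq_iff \<kappa>_def)
  finally have "cmod (b - a) = n\<^sup>2 * (2 * \<kappa>)" using \<kappa> by (simp add: norm_mult norm_power n_def)
  then have ab: "n\<^sup>2 * (2 * \<kappa>) \<le> cmod a + cmod b" using norm_triangle_ineq4[of b a] by linarith
  have "(1 - n) * \<kappa> / 4 \<le> cmod a * cmod b"
  proof (cases "n\<^sup>2 \<ge> 1/2")
    case True
    then have "1/2 * (2 * \<kappa>) \<le> n\<^sup>2 * (2 * \<kappa>)" using \<kappa> by (intro mult_right_mono) auto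
    then have "\<kappa> / 2 \<le> cmod a \<or> \<kappa> / 2 \<le> cmod b" using ab by linarith
    then have "(1 - n) * (\<kappa> / 2) \<le> cmod a * cmod b"
    proof
      assume "\<kappa> / 2 \<le> cmod a"
      then have "(1 - n) * (\<kappa> / 2) \<le> cmod b * cmod a" using lb n2 n \<kappa> by (intro mult_mono) auto
      then show ?thesis by (simp add: mult.commute)
    next
      assume "\<kappa> / 2 \<le> cmod b"
      then show ?thesis using la n2 n \<kappa> by (intro mult_mono) auto
    qed
    moreover have "(1 - n) * \<kappa> / 4 \<le> (1 - n) * (\<kappa> / 2)" using n \<kappa> by (simp add: field_simps)
    ultimately show ?thesis by linarith
  next
    case False
    then have "1/2 * (1/2) \<le> cmod a * cmod b" using la lb by (intro mult_mono) auto
    moreover have "(1 - n) * \<kappa> \<le> 1 * 1" using n \<kappa> by (intro mult_mono) auto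
    ultimately show ?thesis by linarith
  qed
  then have "sqrt ((1 - n) * \<kappa> / 4) \<le> sqrt (cmod a * cmod b)" by (rule real_sqrt_le_mono)
  then have le: "sqrt (1 - n) * sqrt \<kappa> / 2 \<le> sqrt (cmod a * cmod b)" by (simp add: real_sqrt_mult real_sqrt_divide)
  have pos: "0 < sqrt (1 - n) * sqrt \<kappa> / 2" using n \<kappa> by simp
  have "cmod (sc_integrand \<beta> z) = inverse (sqrt (cmod a * cmod b))"
    by (simp add: sc_integrand_def a_def b_def norm_inverse norm_mult real_sqrt_mult)
  also have "\<dots> \<le> inverse (sqrt (1 - n) * sqrt \<kappa> / 2)" using le pos by (rule le_imp_inverse_le)
  also have "\<dots> = 2 / sqrt \<kappa> / sqrt (1 - n)" using n \<kappa> by (simp add: field_simps)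
  finally show ?thesis by (simp add: \<kappa>_def n_def)
qed

text \<open>Integrating the bound M / sqrt (1 - t) along radii shows that passing from z to r z
  changes \<open>f\<close> by at most 2 M sqrt (1 - r), uniformly in z. On the smaller closed disk
  \<open>f\<close> is uniformly continuous by compactness.\<close>

lemma sc_primitive_uniformly_continuous:
  assumes \<beta>: "0 < \<beta>" "\<beta> < pi/2"
    and der: "\<And>z. cmod z < 1 \<Longrightarrow> (f has_field_derivative sc_integrand \<beta> z) (at z)"
  shows "uniformly_continuous_on (ball 0 1) f"
proof -
  define M where "M = 2 / sqrt (sin (2 * \<beta>))"
  have M: "0 < M" using \<beta> by (auto simp: M_def intro!: sin_gt_zero)
  have rad: "cmod (f z - f (of_real r * z)) \<le> 2 * M * sqrt (1 - r)" if z: "cmod z < 1" and r: "0 \<le> r" "r < 1" for z r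
  proof -
    have in1: "cmod (of_real t * z) < 1" "cmod (of_real t * z) \<le> t" if "r \<le> t" "t \<le> 1" for t
    proof -
      have "t * cmod z \<le> 1 * cmod z" "t * cmod z \<le> t * 1"
        using that r z mult_right_mono[of t 1 "cmod z"] mult_left_mono[of "cmod z" 1 t] by auto
      then show "cmod (of_real t * z) < 1" "cmod (of_real t * z) \<le> t" using that r z by (auto simp: norm_mult)
    qed
    have contf: "continuous_on (ball 0 1) f" using DERIV_isCont[OF der]
      by (intro continuous_at_imp_continuous_on) auto
    have "norm (f (of_real 1 * z) - f (of_real r * z)) \<le> (- 2 * M * sqrt (1 - 1)) - (- 2 * M * sqrt (1 - r))"
    proof (rule differentiable_bound_general[where f' = "\<lambda>t. z * sc_integrand \<beta> (of_real t * z)" and \<phi>' = "\<lambda>t. M / sqrt (1 - t)"])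
      show "continuous_on {r..1} (\<lambda>t. f (of_real t * z))"
        by (intro continuous_on_compose2[OF contf] continuous_intros) (use in1 in auto)
      show "continuous_on {r..1} (\<lambda>t. - 2 * M * sqrt (1 - t))" by (intro continuous_intros)
      fix t assume t: "r < t" "t < 1"
      have "((\<lambda>t. of_real t * z) has_vector_derivative z) (at t)"
        by (auto intro!: derivative_eq_intros)
      from field_vector_diff_chain_at[OF this der] in1(1)[of t] t
      show "((\<lambda>t. f (of_real t * z)) has_vector_derivative z * sc_integrand \<beta> (of_real t * z)) (at t)"
        by (simp add: o_def)
      show "((\<lambda>t. - 2 * M * sqrt (1 - t)) has_vector_derivative M / sqrt (1 - t)) (at t)"
        using t by (auto simp flip: has_real_derivative_iff_has_vector_derivative intro!: derivative_eq_intros simp: field_simps)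
      have "cmod (z * sc_integrand \<beta> (of_real t * z)) \<le> 1 * (M / sqrt (1 - cmod (of_real t * z)))"
        unfolding norm_mult[of z] M_def using cmod_sc_integrand_le[OF \<beta> in1(1)[of t]] t z by (intro mult_mono) auto
      also have "\<dots> \<le> M / sqrt (1 - t)"
        using in1[of t] t M by (simp del: norm_mult) (intro divide_left_mono, auto)
      finally show "cmod (z * sc_integrand \<beta> (of_real t * z)) \<le> M / sqrt (1 - t)" .
    qed (use r in auto)
    then show ?thesis by simp
  qed
  show ?thesis
    unfolding uniformly_continuous_on_def
  proof (intro allI impI)
    fix \<epsilon> :: real assume "\<epsilon> > 0"
    \<comment> \<open>Chosen so that 2 M sqrt \<delta> <= \<epsilon>/4, the price of one radial move
      to radius 1 - \<delta>.\<close>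
    define \<delta> where "\<delta> = min (1/2) ((\<epsilon> / (8 * M))\<^sup>2)"
    have \<delta>: "0 < \<delta>" "\<delta> < 1" "\<delta> \<le> (\<epsilon> / (8 * M))\<^sup>2" using \<open>\<epsilon> > 0\<close> M by (auto simp: \<delta>_def)
    have "sqrt \<delta> \<le> \<epsilon> / (8 * M)" using \<delta> \<open>\<epsilon> > 0\<close> M by (simp add: real_le_lsqrt)
    then have M\<delta>: "2 * M * sqrt \<delta> \<le> \<epsilon> / 4" using M by (simp add: field_simps)
    define r where "r = 1 - \<delta>"
    have r: "0 \<le> r" "r < 1" "1 - r = \<delta>" using \<delta> by (auto simp: r_def)
    have "continuous_on (cball 0 r) f"
    proof (intro continuous_at_imp_continuous_on ballI)
      fix x :: complex assume "x \<in> cball 0 r"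
      then have "cmod x < 1" using r by simp
      from DERIV_isCont[OF der[OF this]] show "isCont f x" .
    qed
    then have "uniformly_continuous_on (cball 0 r) f" by (intro compact_uniformly_continuous) auto
    moreover have "\<epsilon> / 4 > 0" using \<open>\<epsilon> > 0\<close> by simp
    ultimately have "\<exists>d>0. \<forall>x\<in>cball 0 r. \<forall>x'\<in>cball 0 r. dist x' x < d \<longrightarrow> dist (f x') (f x) < \<epsilon> / 4"
      unfolding uniformly_continuous_on_def by (elim allE[of _ "\<epsilon> / 4"] impE)
    then obtain d where d: "0 < d" "\<forall>x\<in>cball 0 r. \<forall>x'\<in>cball 0 r. dist x' x < d \<longrightarrow> dist (f x') (f x) < \<epsilon> / 4"
      by (elim exE conjE) (rule that)
    show "\<exists>d>0. \<forall>x\<in>ball 0 1. \<forall>x'\<in>ball 0 1. dist x' x < d \<longrightarrow> dist (f x') (f x) < \<epsilon>"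
    proof (intro exI[of _ d] conjI ballI impI d(1))
      fix x y :: complex assume xy: "x \<in> ball 0 1" "y \<in> ball 0 1" "dist y x < d"
      have cb: "of_real r * w \<in> cball 0 r" if "w \<in> ball 0 1" for w :: complex
      proof -
        have "r * cmod w \<le> r * 1" using that r by (intro mult_left_mono) auto
        then show ?thesis using r by (simp add: norm_mult)
      qed
      have "dist (of_real r * y) (of_real r * x) = r * dist y x"
        using r by (simp add: dist_norm norm_mult flip: right_diff_distrib)
      also have "\<dots> \<le> 1 * dist y x" using r by (intro mult_right_mono) auto
      finally have "dist (f (of_real r * y)) (f (of_real r * x)) < \<epsilon> / 4"
        using d(2)[rule_format, OF cb[OF xy(1)] cb[OF xy(2)]] xy by linarith
      moreover have "cmod (f x - f (of_real r * x)) \<le> \<epsilon> / 4" "cmod (f y - f (of_real r * y)) \<le> \<epsilon> / 4"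
        using rad[of x r] rad[of y r] xy r M\<delta> by auto
      moreover have "dist (f y) (f x) \<le> dist (f y) (f (of_real r * y)) + dist (f (of_real r * y)) (f (of_real r * x)) + dist (f (of_real r * x)) (f x)"
        using dist_triangle[of "f y" "f x" "f (of_real r * y)"] dist_triangle[of "f (of_real r * y)" "f x" "f (of_real r * x)"]
        by linarith
      then have "dist (f y) (f x) \<le> cmod (f y - f (of_real r * y)) + dist (f (of_real r * y)) (f (of_real r * x)) + cmod (f x - f (of_real r * x))"
        by (simp add: dist_norm norm_minus_commute)
      ultimately show "dist (f y) (f x) < \<epsilon>" using \<open>\<epsilon> > 0\<close> by linarith
    qed
  qed
qed

text \<open>The Noshiro-Warschawski argument up to the boundary: along the chord from z to w the
  real part of F / (w - z) has the positive derivative Re g. Strict convexity of the disk keeps the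
  open chord inside, even when both ends lie on the circle.\<close>

lemma inj_on_cball_if_Re_deriv_pos:
  assumes cont: "continuous_on (cball 0 1) F"
    and der: "\<And>z. cmod z < 1 \<Longrightarrow> (F has_field_derivative g z) (at z)"
    and pos: "\<And>z. cmod z < 1 \<Longrightarrow> 0 < Re (g z)"
  shows "inj_on F (cball 0 1)"
proof (rule inj_onI, rule ccontr)
  fix z w assume zw: "z \<in> cball 0 1" "w \<in> cball 0 1" "F z = F w" "z \<noteq> w"
  define h where "h t = Re (F (z + of_real t * (w - z)) / (w - z))" for t :: real
  have seg: "z + of_real t * (w - z) \<in> closed_segment z w" if "0 \<le> t" "t \<le> 1" for t
    using that by (auto simp: in_segment scaleR_conv_of_real algebra_simps intro!: exI[of _ t])
  have oseg: "cmod (z + of_real t * (w - z)) < 1" if "0 < t" "t < 1" for t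
  proof -
    have "z + of_real t * (w - z) \<in> open_segment z w"
      using that zw(4) by (auto simp: in_segment scaleR_conv_of_real algebra_simps intro!: exI[of _ t])
    from dist_decreases_open_segment[OF this, of 0] show ?thesis using zw by auto
  qed
  have "closed_segment z w \<subseteq> cball 0 1" using zw by (intro closed_segment_subset) auto
  then have "continuous_on {0..1} h"
    unfolding h_def by (intro continuous_intros continuous_on_compose2[OF cont]) (use seg zw(4) in auto)
  moreover have "\<exists>y. DERIV h t :> y \<and> 0 < y" if t: "0 < t" "t < 1" for t
  proof -
    have "((\<lambda>t. z + of_real t * (w - z)) has_vector_derivative (w - z)) (at t)"
      by (auto intro!: derivative_eq_intros)
    from field_vector_diff_chain_at[OF this der[OF oseg[OF t]]]
    have "((\<lambda>t. F (z + of_real t * (w - z))) has_vector_derivative (w - z) * g (z + of_real t * (w - z))) (at t)"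
      by (simp add: o_def)
    from has_vector_derivative_divide[OF this, of "w - z"]
    have "((\<lambda>t. F (z + of_real t * (w - z)) / (w - z)) has_vector_derivative g (z + of_real t * (w - z))) (at t)"
      using zw(4) by simp
    from bounded_linear.has_vector_derivative[OF bounded_linear_Re this]
    have "DERIV h t :> Re (g (z + of_real t * (w - z)))"
      by (simp add: h_def[abs_def] has_real_derivative_iff_has_vector_derivative)
    then show ?thesis using pos[OF oseg[OF t]] by blast
  qed
  ultimately have "h 0 < h 1" by (intro DERIV_pos_imp_increasing_open[of 0 1 h]) auto
  then show False using zw(3) by (simp add: h_def)
qed

text \<open>
  The square of the derivative of \<open>F (cis x)\<close> is real, so this derivative is either real or
  purely imaginary on each arc between two corners.
\<close>

lemma sc_sides:
  assumes cont: "continuous_on (cball 0 1) F"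
    and der: "\<And>z. z \<in> sc_dom \<beta> \<Longrightarrow> (f has_field_derivative sc_integrand \<beta> z) (at z)"
    and Ff: "\<And>z. cmod z \<le> 1 \<Longrightarrow> z \<in> sc_dom \<beta> \<Longrightarrow> F z = f z"
    and ab: "a < b" "\<phi> \<in> {a..b}"
  shows "(\<And>x. a < x \<Longrightarrow> x < b \<Longrightarrow> cos (2 * \<beta>) < cos (2 * x)) \<Longrightarrow> Re (F (cis \<phi>)) = Re (F (cis a))"
    and "(\<And>x. a < x \<Longrightarrow> x < b \<Longrightarrow> cos (2 * x) < cos (2 * \<beta>)) \<Longrightarrow> Im (F (cis \<phi>)) = Im (F (cis a))"
proof -
  define D where "D x = \<i> * cis x * sc_integrand \<beta> (cis x)" for x
  have k: "cis x \<in> sc_dom \<beta> \<and> (D x)\<^sup>2 = of_real (- 1 / (2 * cos (2 * x) - 2 * cos (2 * \<beta>)))"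
    if ne: "cos (2 * x) \<noteq> cos (2 * \<beta>)" for x
  proof -
    define w where "w = cis (2 * x)"
    have w: "(cis x)\<^sup>2 = w" by (simp add: w_def Complex.DeMoivre)
    define A where "A = 1 - cis (2 * \<beta>) * w"
    define B where "B = 1 - cis (- 2 * \<beta>) * w"
    have "w * cnj w = 1" by (simp add: w_def cis_cnj cis_mult)
    have 2: "w + cnj w = of_real (2 * cos (2 * x))" by (simp add: complex_eq_iff w_def)
    have "A * B = 1 - of_real (2 * cos (2 * \<beta>)) * w + w\<^sup>2" unfolding A_def B_def by (rule sc_product)
    also have "\<dots> = w * (w + cnj w - of_real (2 * cos (2 * \<beta>)))"
      using \<open>w * cnj w = 1\<close> by (simp add: algebra_simps power2_eq_square)
    finally have AB: "A * B = w * of_real (2 * cos (2 * x) - 2 * cos (2 * \<beta>))" unfolding 2 by simp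
    moreover have "w \<noteq> 0" by (simp add: w_def)
    ultimately have "A \<noteq> 0" "B \<noteq> 0" using ne by (auto simp del: of_real_diff of_real_mult)
    have nonpos: "1 - u \<notin> \<real>\<^sub>\<le>\<^sub>0" if "1 - u \<noteq> 0" "cmod u = 1" for u :: complex
    proof
      assume "1 - u \<in> \<real>\<^sub>\<le>\<^sub>0"
      then have "1 \<le> Re u" "Im u = 0" by (auto simp: complex_nonpos_Reals_iff)
      moreover have "Re u \<le> 1" using complex_Re_le_cmod[of u] that by simp
      ultimately show False using that by (auto simp: complex_eq_iff)
    qed
    have "cis x \<in> sc_dom \<beta>"
      unfolding sc_dom_def mem_Collect_eq w
      using nonpos[of "cis (2 * \<beta>) * w"] nonpos[of "cis (- 2 * \<beta>) * w"] \<open>A \<noteq> 0\<close> \<open>B \<noteq> 0\<close>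
      by (simp add: A_def B_def norm_mult w_def)
    moreover have "(D x)\<^sup>2 = - w * inverse (A * B)"
      by (simp add: D_def sc_integrand_def w power_mult_distrib power_inverse A_def B_def)
    then have "(D x)\<^sup>2 = of_real (- 1 / (2 * cos (2 * x) - 2 * cos (2 * \<beta>)))"
    proof -
      have "- w * inverse (w * of_real K) = of_real (- 1 / K)" if "K \<noteq> 0" for K :: real
        using \<open>w \<noteq> 0\<close> that by (simp add: divide_simps)
      moreover have "2 * cos (2 * x) - 2 * cos (2 * \<beta>) \<noteq> 0" using ne by simp
      ultimately show ?thesis using \<open>(D x)\<^sup>2 = - w * inverse (A * B)\<close> unfolding AB by (simp only:)
    qed
    ultimately show ?thesis by simp
  qed
  have contc: "continuous_on {a..b} (\<lambda>x. F (cis x))"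
    by (intro continuous_on_compose2[OF cont] continuous_intros) auto
  have derF: "((\<lambda>x. F (cis x)) has_vector_derivative D x) (at x)"
    if x: "x \<in> {a<..<b}" and ne: "\<And>x. x \<in> {a<..<b} \<Longrightarrow> cos (2 * x) \<noteq> cos (2 * \<beta>)" for x
  proof (rule has_vector_derivative_transform_within_open[of "\<lambda>x. f (cis x)" _ _ "{a<..<b}"])
    have "(cis has_vector_derivative (\<i> * cis x)) (at x)"
    proof -
      have "((\<lambda>x. \<i> * of_real x) has_vector_derivative \<i>) (at x)" by (auto intro!: derivative_eq_intros)
      from field_vector_diff_chain_at[OF this DERIV_exp] show ?thesis
        by (simp add: o_def cis_conv_exp[abs_def])
    qed
    from field_vector_diff_chain_at[OF this der] k[OF ne[OF x]]
    show "((\<lambda>x. f (cis x)) has_vector_derivative D x) (at x)" by (simp add: o_def D_def)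
    show "\<And>y. y \<in> {a<..<b} \<Longrightarrow> f (cis y) = F (cis y)" using k[OF ne] Ff by simp
  qed (use x in auto)
  show "Re (F (cis \<phi>)) = Re (F (cis a))" if pos: "\<And>x. a < x \<Longrightarrow> x < b \<Longrightarrow> cos (2 * \<beta>) < cos (2 * x)"
  proof (rule DERIV_isconst2[OF ab(1)])
    show "continuous_on {a..b} (\<lambda>x. Re (F (cis x)))" by (intro continuous_intros contc)
    fix x assume x: "a < x" "x < b"
    have ne: "\<And>x. x \<in> {a<..<b} \<Longrightarrow> cos (2 * x) \<noteq> cos (2 * \<beta>)" using pos by force
    have "(D x)\<^sup>2 = of_real (- 1 / (2 * cos (2 * x) - 2 * cos (2 * \<beta>)))" using k ne x by auto
    moreover have "- 1 / (2 * cos (2 * x) - 2 * cos (2 * \<beta>)) < 0" using pos[OF x] by simp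
    ultimately have "Re ((D x)\<^sup>2) < 0" "Im ((D x)\<^sup>2) = 0" by (simp_all only: Re_complex_of_real Im_complex_of_real)
    then have "Re (D x) * Re (D x) < Im (D x) * Im (D x)" "Re (D x) * Im (D x) = 0"
      by (auto simp: power2_eq_square)
    then have "Re (D x) = 0" by (metis mult_eq_0_iff mult_zero_left not_square_less_zero)
    moreover have "((\<lambda>x. Re (F (cis x))) has_vector_derivative Re (D x)) (at x)"
      using bounded_linear.has_vector_derivative[OF bounded_linear_Re derF[OF _ ne]] x by auto
    ultimately show "((\<lambda>x. Re (F (cis x))) has_real_derivative 0) (at x)"
      by (simp add: has_real_derivative_iff_has_vector_derivative)
  qed (use ab in auto)
  show "Im (F (cis \<phi>)) = Im (F (cis a))" if neg: "\<And>x. a < x \<Longrightarrow> x < b \<Longrightarrow> cos (2 * x) < cos (2 * \<beta>)"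
  proof (rule DERIV_isconst2[OF ab(1)])
    show "continuous_on {a..b} (\<lambda>x. Im (F (cis x)))" by (intro continuous_intros contc)
    fix x assume x: "a < x" "x < b"
    have ne: "\<And>x. x \<in> {a<..<b} \<Longrightarrow> cos (2 * x) \<noteq> cos (2 * \<beta>)" using neg by force
    have "(D x)\<^sup>2 = of_real (- 1 / (2 * cos (2 * x) - 2 * cos (2 * \<beta>)))" using k ne x by auto
    moreover have "0 < - 1 / (2 * cos (2 * x) - 2 * cos (2 * \<beta>))" using neg[OF x] by (simp add: divide_simps)
    ultimately have "0 < Re ((D x)\<^sup>2)" "Im ((D x)\<^sup>2) = 0" by (simp_all only: Re_complex_of_real Im_complex_of_real)
    then have "Im (D x) * Im (D x) < Re (D x) * Re (D x)" "Re (D x) * Im (D x) = 0"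
      by (auto simp: power2_eq_square)
    then have "Im (D x) = 0" by (metis mult_eq_0_iff mult_zero_left not_square_less_zero)
    moreover have "((\<lambda>x. Im (F (cis x))) has_vector_derivative Im (D x)) (at x)"
      using bounded_linear.has_vector_derivative[OF bounded_linear_Im derF[OF _ ne]] x by auto
    ultimately show "((\<lambda>x. Im (F (cis x))) has_real_derivative 0) (at x)"
      by (simp add: has_real_derivative_iff_has_vector_derivative)
  qed (use ab in auto)
qed

section \<open>The image of the circle is the boundary of a rectangle\<close>

lemma continuous_inj_between:
  fixes h :: "real \<Rightarrow> real"
  assumes "a < b" "continuous_on {a..b} h" "inj_on h {a..b}" "x \<in> {a..b}"
  shows "min (h a) (h b) \<le> h x \<and> h x \<le> max (h a) (h b)"
proof (cases "x = a \<or> x = b")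
  case False
  then have "a < x" "x < b" using assms(4) by auto
  from continuous_inj_imp_mono[OF this assms(2,3)] show ?thesis by auto
qed auto

lemma cos_double_gt:
  assumes "\<bar>x\<bar> < \<beta>" "\<beta> < pi/2" shows "cos (2 * \<beta>) < cos (2 * x)"
proof -
  have "cos (2 * \<beta>) < cos (2 * \<bar>x\<bar>)" using assms by (intro cos_monotone_0_pi) auto
  then show ?thesis by (cases "0 \<le> x") auto
qed

lemma cos_double_shift: "cos (2 * (x - pi)) = cos (2 * x)"
  by (simp add: right_diff_distrib cos_diff)

lemma cos_double_shift_half: "cos (2 * (x - pi/2)) = - cos (2 * x)"
  by (simp add: right_diff_distrib cos_diff)

lemma cos_double_compl: "cos (2 * (pi/2 - x)) = - cos (2 * x)"
  by (simp add: right_diff_distrib cos_diff)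

text \<open>On each of the four arcs one coordinate of F (cis x) is constant, so by injectivity the
  other one is injective, hence monotone between its values at the two corners. The circle is thus
  mapped into the boundary of the rectangle spanned by the corner values, and
  \<open>open_rectangle_image\<close> does the rest; the side lengths are never computed.\<close>

lemma disc_to_rectangle:
  assumes \<beta>: "0 < \<beta>" "\<beta> < pi/2"
  obtains F p q where "continuous_on (cball 0 1) F" "inj_on F (cball 0 1)" "F holomorphic_on ball 0 1"
    "F ` ball 0 1 = box p q" "F ` cball 0 1 = cbox p q" "Re p < Re q" "Im p < Im q"
    "F ` {cis \<beta>, - cis (- \<beta>), - cis \<beta>, cis (- \<beta>)} = {p, Complex (Re q) (Im p), q, Complex (Re p) (Im q)}"
proof -
  obtain f where der: "\<And>z. z \<in> sc_dom \<beta> \<Longrightarrow> (f has_field_derivative sc_integrand \<beta> z) (at z)"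
  proof -
    have "\<exists>f. \<forall>z\<in>sc_dom \<beta>. (f has_field_derivative sc_integrand \<beta> z) (at z)"
      using holomorphic_on_imp_differentiable_at[OF sc_integrand_holomorphic open_sc_dom]
      by (intro holomorphic_starlike_primitive[of _ _ "{}"] holomorphic_on_imp_continuous_on
          sc_integrand_holomorphic starlike_sc_dom open_sc_dom) auto
    then show ?thesis using that by blast
  qed
  have der1: "(f has_field_derivative sc_integrand \<beta> z) (at z)" if "cmod z < 1" for z
    using der[of z] ball_subset_sc_dom[of \<beta>] that by (auto simp: subset_iff)
  obtain F where F: "uniformly_continuous_on (closure (ball 0 1)) F" "\<And>z. z \<in> ball 0 1 \<Longrightarrow> f z = F z"
    using uniformly_continuous_on_extension_on_closure[OF sc_primitive_uniformly_continuous[OF \<beta> der1]] by metis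
  have cont: "continuous_on (cball 0 1) F" using F(1) by (simp add: uniformly_continuous_imp_continuous)
  \<comment> \<open>\<open>F\<close> extends the primitive from the open disk by uniform continuity,
    while \<open>f\<close> itself is defined beyond the open sides. Radial limits show that both
    agree there.\<close>
  have Ff: "F z = f z" if "cmod z \<le> 1" "z \<in> sc_dom \<beta>" for z
  proof -
    define X where "X n = of_real (1 - 1 / real (Suc n)) * z" for n
    have X: "X \<longlonglongrightarrow> z" unfolding X_def[abs_def] by (rule tendsto_scale_one)
    have Xb: "X n \<in> ball 0 1" for n
    proof -
      have "(1 - 1 / real (Suc n)) * cmod z \<le> (1 - 1 / real (Suc n)) * 1"
        using that by (intro mult_left_mono) auto
      also have "\<dots> < 1" by simp
      finally show ?thesis by (simp only: X_def mem_ball_0 norm_mult norm_of_real) simp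
    qed
    have "(\<lambda>n. F (X n)) \<longlonglongrightarrow> F z"
      using continuous_on_tendsto_compose[OF cont X] that Xb by (simp add: less_imp_le)
    moreover have "(\<lambda>n. F (X n)) = (\<lambda>n. f (X n))" using F(2)[OF Xb] by auto
    moreover have "(\<lambda>n. f (X n)) \<longlonglongrightarrow> f z"
      using isCont_tendsto_compose[OF DERIV_isCont[OF der[OF that(2)]] X] .
    ultimately show ?thesis using LIMSEQ_unique by simp
  qed
  have derF: "(F has_field_derivative sc_integrand \<beta> z) (at z)" if "cmod z < 1" for z
    using has_field_derivative_transform_within_open[OF der1[OF that] open_ball[of 0 1]] that F(2) by auto
  have holF: "F holomorphic_on ball 0 1"
    unfolding holomorphic_on_open[OF open_ball] using derF by (metis mem_ball_0)
  have inj: "inj_on F (cball 0 1)"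
    by (rule inj_on_cball_if_Re_deriv_pos[OF cont derF Re_sc_integrand_pos])
  define r where "r x = Re (F (cis x))" for x
  define i where "i x = Im (F (cis x))" for x
  have side_r: "r \<phi> = r a" if "a < b" "\<And>x. a < x \<Longrightarrow> x < b \<Longrightarrow> cos (2 * \<beta>) < cos (2 * x)" "\<phi> \<in> {a..b}" for a b \<phi>
    unfolding r_def by (rule sc_sides(1)[OF cont der Ff that(1,3,2)])
  have side_i: "i \<phi> = i a" if "a < b" "\<And>x. a < x \<Longrightarrow> x < b \<Longrightarrow> cos (2 * x) < cos (2 * \<beta>)" "\<phi> \<in> {a..b}" for a b \<phi>
    unfolding i_def by (rule sc_sides(2)[OF cont der Ff that(1,3,2)])
  have s1: "r x = r (-\<beta>)" if "x \<in> {-\<beta>..\<beta>}" for x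
    using \<beta> by (intro side_r[OF _ _ that]) (auto intro!: cos_double_gt)
  have s3: "r x = r (pi-\<beta>)" if "x \<in> {pi-\<beta>..pi+\<beta>}" for x
  proof (intro side_r[OF _ _ that])
    fix y assume "pi-\<beta> < y" "y < pi+\<beta>"
    then have "\<bar>y - pi\<bar> < \<beta>" by arith
    from cos_double_gt[OF this \<beta>(2)] show "cos (2 * \<beta>) < cos (2 * y)" unfolding cos_double_shift .
  qed (use \<beta> in auto)
  have s2: "i x = i \<beta>" if "x \<in> {\<beta>..pi-\<beta>}" for x
  proof (intro side_i[OF _ _ that])
    fix y assume "\<beta> < y" "y < pi-\<beta>"
    \<comment> \<open>This arc is centered at pi/2 and has half-width pi/2 - \<beta>. Shifting by
      pi/2 changes the sign of the cosine of the double angle, which reduces the claim to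
      \<open>cos_double_gt\<close>.\<close>
    then have "\<bar>y - pi/2\<bar> < pi/2 - \<beta>" by arith
    from cos_double_gt[OF this] \<beta> show "cos (2 * y) < cos (2 * \<beta>)"
      unfolding cos_double_shift_half cos_double_compl by simp
  qed (use \<beta> in auto)
  have s4: "i x = i (pi+\<beta>)" if "x \<in> {pi+\<beta>..2*pi-\<beta>}" for x
  proof (intro side_i[OF _ _ that])
    fix y assume "pi+\<beta> < y" "y < 2*pi-\<beta>"
    then have "\<bar>y - pi - pi/2\<bar> < pi/2 - \<beta>" by arith
    from cos_double_gt[OF this] \<beta> show "cos (2 * y) < cos (2 * \<beta>)"
      unfolding cos_double_shift_half cos_double_compl cos_double_shift by simp
  qed (use \<beta> in auto)
  have period: "r (2*pi-\<beta>) = r (-\<beta>)" "i (2*pi-\<beta>) = i (-\<beta>)"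
  proof -
    have "cis (2*pi-\<beta>) = cis (-\<beta>)" by (simp add: complex_eq_iff cos_diff sin_diff)
    then show "r (2*pi-\<beta>) = r (-\<beta>)" "i (2*pi-\<beta>) = i (-\<beta>)" by (simp_all add: r_def i_def)
  qed
  have contc: "continuous_on A (\<lambda>x. F (cis x))" for A
    by (intro continuous_on_compose2[OF cont] continuous_intros) auto
  have injc: "x = y" if "F (cis x) = F (cis y)" "\<bar>x - y\<bar> < 2 * pi" for x y
  proof -
    have "cis x = cis y" using inj that(1) by (auto dest: inj_onD)
    then have "exp (\<i> * of_real x) = exp (\<i> * of_real y)" by (simp only: cis_conv_exp)
    moreover have "\<bar>Im (\<i> * of_real x) - Im (\<i> * of_real y)\<bar> < 2 * pi" using that(2) by simp
    ultimately have "\<i> * complex_of_real x = \<i> * of_real y" by (rule exp_complex_eqI[rotated])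
    then show ?thesis by simp
  qed
  have bi: "min (i a) (i b) \<le> i x \<and> i x \<le> max (i a) (i b)"
    if ab: "a < b" "b < a + 2 * pi" "\<And>x. x \<in> {a..b} \<Longrightarrow> r x = r a" "x \<in> {a..b}" for a b x
  proof (rule continuous_inj_between[OF ab(1) _ _ ab(4)])
    show "continuous_on {a..b} i" unfolding i_def by (intro continuous_intros contc)
    show "inj_on i {a..b}"
    proof (rule inj_onI)
      fix x y assume xy: "x \<in> {a..b}" "y \<in> {a..b}" "i x = i y"
      then have "F (cis x) = F (cis y)" using ab(3)[of x] ab(3)[of y] by (auto simp: complex_eq_iff r_def i_def)
      then show "x = y" using injc xy ab by auto
    qed
  qed
  have br: "min (r a) (r b) \<le> r x \<and> r x \<le> max (r a) (r b)"
    if ab: "a < b" "b < a + 2 * pi" "\<And>x. x \<in> {a..b} \<Longrightarrow> i x = i a" "x \<in> {a..b}" for a b x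
  proof (rule continuous_inj_between[OF ab(1) _ _ ab(4)])
    show "continuous_on {a..b} r" unfolding r_def by (intro continuous_intros contc)
    show "inj_on r {a..b}"
    proof (rule inj_onI)
      fix x y assume xy: "x \<in> {a..b}" "y \<in> {a..b}" "r x = r y"
      then have "F (cis x) = F (cis y)" using ab(3)[of x] ab(3)[of y] by (auto simp: complex_eq_iff r_def i_def)
      then show "x = y" using injc xy ab by auto
    qed
  qed
  define A1 A3 B2 B4 where "A1 = r (-\<beta>)" and "A3 = r (pi-\<beta>)" and "B2 = i \<beta>" and "B4 = i (pi+\<beta>)"
  have corners: "r \<beta> = A1" "i \<beta> = B2" "r (pi-\<beta>) = A3" "i (pi-\<beta>) = B2" "r (pi+\<beta>) = A3" "i (pi+\<beta>) = B4"
     "r (-\<beta>) = A1" "i (-\<beta>) = B4"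
    using s1[of \<beta>] s2[of "pi-\<beta>"] s3[of "pi+\<beta>"] s4[of "2*pi-\<beta>"] period \<beta>
    by (auto simp: A1_def A3_def B2_def B4_def)
  have neA: "A1 \<noteq> A3"
  proof
    assume "A1 = A3"
    then have "F (cis \<beta>) = F (cis (pi-\<beta>))" using corners by (simp add: complex_eq_iff r_def i_def)
    from injc[OF this] show False using \<beta> by auto
  qed
  have neB: "B2 \<noteq> B4"
  proof
    assume "B2 = B4"
    then have "F (cis \<beta>) = F (cis (-\<beta>))" using corners by (simp add: complex_eq_iff r_def i_def)
    from injc[OF this] show False using \<beta> by auto
  qed
  \<comment> \<open>Minima and maxima, since it is left open which of the two vertical sides lies on
    the left and which horizontal one below.\<close>
  define p where "p = Complex (min A1 A3) (min B2 B4)"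
  define q where "q = Complex (max A1 A3) (max B2 B4)"
  have pq: "Re p < Re q" "Im p < Im q" using neA neB by (auto simp: p_def q_def)
  have bdry: "F ` sphere 0 1 \<subseteq> cbox p q - box p q"
  proof
    fix w assume "w \<in> F ` sphere 0 1"
    then obtain z where z: "cmod z = 1" "w = F z" by auto
    \<comment> \<open>The argument moved into the period from -\<beta> to 2 pi - \<beta>, which
      begins at a corner and is the union of the four arcs.\<close>
    define x where "x = (if Arg z < -\<beta> then Arg z + 2 * pi else Arg z)"
    have cisx: "cis x = z"
    proof -
      have "cis (Arg z) = z" using rcis_cmod_Arg[of z] z by (simp add: rcis_def)
      moreover have "cis (Arg z + 2 * pi) = cis (Arg z)" by (simp add: complex_eq_iff)
      ultimately show ?thesis by (simp add: x_def)
    qed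
    have xr: "-\<beta> \<le> x" "x \<le> 2*pi-\<beta>"
      using Arg_bounded[of z] \<beta> by (auto simp: x_def)
    have w: "Re w = r x" "Im w = i x" by (auto simp: r_def i_def cisx z)
    consider "x \<in> {-\<beta>..\<beta>}" | "x \<in> {\<beta>..pi-\<beta>}" | "x \<in> {pi-\<beta>..pi+\<beta>}" | "x \<in> {pi+\<beta>..2*pi-\<beta>}"
      using xr by force
    then show "w \<in> cbox p q - box p q"
    proof cases
      case 1
      then show ?thesis using s1[OF 1] bi[OF _ _ s1 1] \<beta> corners
        by (auto simp: in_cbox_complex_iff in_box_complex_iff p_def q_def w)
    next
      case 2
      then show ?thesis using s2[OF 2] br[OF _ _ s2 2] \<beta> corners
        by (auto simp: in_cbox_complex_iff in_box_complex_iff p_def q_def w)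
    next
      case 3
      then show ?thesis using s3[OF 3] bi[OF _ _ s3 3] \<beta> corners
        by (auto simp: in_cbox_complex_iff in_box_complex_iff p_def q_def w)
    next
      case 4
      then show ?thesis using s4[OF 4] br[OF _ _ s4 4] \<beta> corners period
        by (auto simp: in_cbox_complex_iff in_box_complex_iff p_def q_def w)
    qed
  qed
  have ne: "box p q \<noteq> {}" using pq by (auto simp: box_ne_empty Basis_complex_def)
  note img = open_rectangle_image[OF cont inj bdry ne]
  have e: "- cis (-\<beta>) = cis (pi - \<beta>)" "- cis \<beta> = cis (pi + \<beta>)" by (simp_all add: complex_eq_iff)
  have "F (cis \<beta>) = Complex A1 B2" "F (- cis (-\<beta>)) = Complex A3 B2" "F (- cis \<beta>) = Complex A3 B4" "F (cis (-\<beta>)) = Complex A1 B4"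
    unfolding e using corners by (simp_all add: complex_eq_iff r_def i_def)
  then have "F ` {cis \<beta>, - cis (- \<beta>), - cis \<beta>, cis (- \<beta>)} = {Complex A1 B2, Complex A3 B2, Complex A3 B4, Complex A1 B4}"
    by simp
  also have "\<dots> = {p, Complex (Re q) (Im p), q, Complex (Re p) (Im q)}"
    by (auto simp: p_def q_def min_def max_def)
  finally show ?thesis using that[OF cont inj holF img pq] by simp
qed

section \<open>Invariance under isometries\<close>

lemma Moebius_denominator_nonzero:
  assumes "cmod w < 1" "cmod z \<le> 1" shows "1 - cnj w * z \<noteq> 0"
proof
  assume "1 - cnj w * z = 0"
  then have "cmod (cnj w * z) = 1" by (metis eq_iff_diff_eq_0 norm_one)
  moreover have "cmod (cnj w * z) \<le> cmod w * 1" unfolding norm_mult using assms by (intro mult_mono) auto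
  ultimately show False using assms by simp
qed

lemma Moebius_norm_identity:
  "(cmod (1 - cnj w * z))\<^sup>2 - (cmod (z - w))\<^sup>2 = (1 - (cmod w)\<^sup>2) * (1 - (cmod z)\<^sup>2)"
  unfolding cmod_power2 by (simp add: algebra_simps power2_eq_square)

lemma cmod_Moebius:
  assumes w: "cmod w < 1" and z: "cmod z \<le> 1"
  shows "cmod (Moebius_function \<theta> w z) \<le> 1" "cmod (Moebius_function \<theta> w z) < 1 \<longleftrightarrow> cmod z < 1"
proof -
  define N where "N = cmod (z - w)"
  define D where "D = cmod (1 - cnj w * z)"
  have D: "0 < D" using Moebius_denominator_nonzero[OF assms] by (simp add: D_def)
  have eq: "cmod (Moebius_function \<theta> w z) = N / D"
    by (simp add: Moebius_function_def norm_divide norm_mult N_def D_def)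
  have id: "D\<^sup>2 - N\<^sup>2 = (1 - (cmod w)\<^sup>2) * (1 - (cmod z)\<^sup>2)"
    unfolding N_def D_def by (rule Moebius_norm_identity)
  have w2: "0 < 1 - (cmod w)\<^sup>2" using w by (simp add: abs_square_less_1)
  have N: "0 \<le> N" by (simp add: N_def)
  have "0 \<le> 1 - (cmod z)\<^sup>2" using z by (simp add: power_le_one)
  then have "N\<^sup>2 \<le> D\<^sup>2" using id w2 by (metis diff_ge_0_iff_ge mult_nonneg_nonneg less_imp_le)
  then have "N \<le> D" by (rule power2_le_imp_le) (use D in simp)
  then show "cmod (Moebius_function \<theta> w z) \<le> 1" using D by (simp add: eq)
  have "N < D \<longleftrightarrow> N\<^sup>2 < D\<^sup>2" using N D power_strict_mono[of N D 2] power2_less_imp_less[of N D] by auto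
  also have "\<dots> \<longleftrightarrow> 0 < (1 - (cmod w)\<^sup>2) * (1 - (cmod z)\<^sup>2)" unfolding id[symmetric] by auto
  also have "\<dots> \<longleftrightarrow> 0 < 1 - (cmod z)\<^sup>2"
    using w2 mult_pos_pos[OF w2, of "1 - (cmod z)\<^sup>2"] zero_less_mult_pos[OF _ w2, of "1 - (cmod z)\<^sup>2"] by blast
  also have "\<dots> \<longleftrightarrow> cmod z < 1" by (simp add: abs_square_less_1)
  finally show "cmod (Moebius_function \<theta> w z) < 1 \<longleftrightarrow> cmod z < 1" using D by (simp add: eq)
qed

lemma exp_eq_cis: "exp (\<i> * of_real \<theta>) = cis \<theta>"
  by (simp add: cis_conv_exp)

lemma Moebius_inverse:
  assumes w: "cmod w < 1" and z: "cmod z \<le> 1"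
  shows "Moebius_function (-\<theta>) (- cis \<theta> * w) (Moebius_function \<theta> w z) = z"
proof -
  define e where "e = cis \<theta>"
  have e: "e * cnj e = 1" "e \<noteq> 0" by (auto simp: e_def cis_cnj cis_mult)
  define D where "D = 1 - cnj w * z"
  have D: "D \<noteq> 0" using Moebius_denominator_nonzero[OF assms] by (simp add: D_def)
  have ww: "1 - w * cnj w \<noteq> 0"
  proof
    assume "1 - w * cnj w = 0"
    then have "cmod (w * cnj w) = 1" by (metis eq_iff_diff_eq_0 norm_one)
    then have "(cmod w)\<^sup>2 = 1" by (simp add: norm_mult power2_eq_square)
    then show False using w norm_ge_zero[of w] by (auto simp: power2_eq_1_iff)
  qed
  have num: "e * (z - w) / D + e * w = e * (z * (1 - w * cnj w)) / D"
    using D by (simp add: field_simps D_def)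
  have den: "1 + cnj e * cnj w * (e * (z - w) / D) = (1 - w * cnj w) / D"
  proof -
    have "1 + cnj e * cnj w * (e * (z - w) / D) = 1 + (e * cnj e) * (cnj w * (z - w) / D)" by (simp add: mult_ac)
    also have "\<dots> = (1 - w * cnj w) / D" unfolding e using D by (simp add: field_simps D_def)
    finally show ?thesis .
  qed
  have "Moebius_function (-\<theta>) (- cis \<theta> * w) (Moebius_function \<theta> w z)
      = cnj e * (e * (z - w) / D + e * w) / (1 + cnj e * cnj w * (e * (z - w) / D))"
    unfolding Moebius_function_def exp_eq_cis by (simp add: e_def D_def cis_cnj)
  also have "\<dots> = (e * cnj e) * (z * (1 - w * cnj w) / D) / ((1 - w * cnj w) / D)"
    unfolding num den by (simp add: mult_ac)
  also have "\<dots> = z" unfolding e using D ww by simp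
  finally show ?thesis .
qed

lemma Moebius_compose:
  assumes a: "cmod a < 1" and w: "cmod w < 1"
  obtains \<psi> v where "cmod v < 1"
    "\<And>z. cmod z \<le> 1 \<Longrightarrow> Moebius_function \<phi> a (Moebius_function \<theta> w z) = Moebius_function \<psi> v z"
proof -
  define e where "e = cis \<theta>"
  have e: "e * cnj e = 1" "e \<noteq> 0" "cmod e = 1" by (auto simp: e_def cis_cnj cis_mult)
  define P where "P = e + a * cnj w"
  have P: "P \<noteq> 0"
  proof
    assume "P = 0"
    then have "cmod (a * cnj w) = cmod e" unfolding P_def by (metis add_eq_0_iff norm_minus_cancel)
    then have "cmod a * cmod w = 1" using e by (simp add: norm_mult)
    moreover have "cmod a * cmod w \<le> cmod a * 1" using w by (intro mult_left_mono) auto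
    ultimately show False using a by simp
  qed
  \<comment> \<open>\<open>v\<close> is the point that the composition sends to 0, found by solving
    e (z - w) = a (1 - cnj w z). The remaining unimodular factor is \<mu>.\<close>
  define v where "v = (e * w + a) / P"
  define \<mu> where "\<mu> = cis \<phi> * cnj e * P / cnj P"
  have "cmod \<mu> = 1" using e P by (simp add: \<mu>_def norm_mult norm_divide)
  then obtain \<psi> where \<psi>: "\<mu> = cis \<psi>" by (metis rcis_cmod_Arg rcis_def mult_1 of_real_1)
  have v: "cmod v < 1"
  proof -
    have "(cmod P)\<^sup>2 - (cmod (e * w + a))\<^sup>2 = (1 - (cmod w)\<^sup>2) * (1 - (cmod a)\<^sup>2)"
    proof -
      have "cmod P = cmod (e * (1 + cnj w * (a * cnj e)))"
        by (rule arg_cong[where f=cmod]) (use e(1) in \<open>simp add: P_def algebra_simps\<close>)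
      also have "\<dots> = cmod (1 - cnj w * (- a * cnj e))" using e by (simp add: norm_mult)
      finally have 1: "cmod P = cmod (1 - cnj w * (- a * cnj e))" .
      have "cmod (e * w + a) = cmod (e * (w + a * cnj e))"
        by (rule arg_cong[where f=cmod]) (use e(1) in \<open>simp add: algebra_simps\<close>)
      also have "\<dots> = cmod (- a * cnj e - w)" using e
        by (metis (no_types, lifting) add.commute minus_add_distrib mult_1 mult_minus_left norm_minus_cancel norm_mult uminus_add_conv_diff)
      finally have 2: "cmod (e * w + a) = cmod (- a * cnj e - w)" .
      show ?thesis unfolding 1 2 Moebius_norm_identity using e by (simp add: norm_mult)
    qed
    moreover have "0 < (1 - (cmod w)\<^sup>2) * (1 - (cmod a)\<^sup>2)" using a w by (simp add: abs_square_less_1)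
    ultimately have "(cmod (e * w + a))\<^sup>2 < (cmod P)\<^sup>2" by simp
    then have "cmod (e * w + a) < cmod P" by (metis norm_ge_zero power2_less_imp_less)
    then show ?thesis using P by (simp add: v_def norm_divide)
  qed
  show ?thesis
  proof (rule that[OF v])
    fix z :: complex assume z: "cmod z \<le> 1"
    define D where "D = 1 - cnj w * z"
    have D: "D \<noteq> 0" using Moebius_denominator_nonzero[OF w z] by (simp add: D_def)
    have Pv: "P * v = e * w + a" using P by (simp add: v_def)
    then have cPv: "cnj P * cnj v = cnj e * cnj w + cnj a" by (metis complex_cnj_add complex_cnj_mult)
    have num: "e * (z - w) / D - a = P * (z - v) / D"
    proof -
      have "e * (z - w) - a * D = P * z - P * v" unfolding Pv by (simp add: P_def D_def algebra_simps)
      then show ?thesis using D by (simp add: field_simps)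
    qed
    have den: "1 - cnj a * (e * (z - w) / D) = e * cnj P * (1 - cnj v * z) / D"
    proof -
      have "e * cnj P * (1 - cnj v * z) = e * (cnj P - (cnj P * cnj v) * z)" by (simp add: algebra_simps)
      also have "\<dots> = (e * cnj e) * (1 - cnj w * z) + cnj a * e * (w - z)"
        unfolding cPv by (simp add: P_def algebra_simps)
      also have "\<dots> = D - cnj a * (e * (z - w))" unfolding e by (simp add: D_def algebra_simps)
      finally show ?thesis using D by (simp add: diff_divide_distrib)
    qed
    have e': "1 / e = cnj e" using e by (simp add: field_simps)
    have "Moebius_function \<phi> a (Moebius_function \<theta> w z) = cis \<phi> * (e * (z - w) / D - a) / (1 - cnj a * (e * (z - w) / D))"
      unfolding Moebius_function_def exp_eq_cis by (simp add: e_def D_def)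
    also have "\<dots> = cis \<phi> * (1 / e) * P / cnj P * (z - v) / (1 - cnj v * z)"
      unfolding num den using D P by (simp add: mult_ac)
    also have "\<dots> = Moebius_function \<psi> v z"
      unfolding Moebius_function_def exp_eq_cis e' \<psi>[symmetric] \<mu>_def ..
    finally show "Moebius_function \<phi> a (Moebius_function \<theta> w z) = Moebius_function \<psi> v z" .
  qed
qed

lemma Moebius_inverse':
  assumes w: "cmod w < 1" and z: "cmod z \<le> 1"
  shows "Moebius_function \<theta> w (Moebius_function (-\<theta>) (- cis \<theta> * w) z) = z"
proof -
  have "cmod (- cis \<theta> * w) < 1" using w by (simp add: norm_mult)
  from Moebius_inverse[OF this z, of "-\<theta>"] show ?thesis
    by (simp add: cis_mult flip: mult.assoc)
qed

lemma continuous_on_Moebius: "cmod w < 1 \<Longrightarrow> continuous_on (cball 0 1) (Moebius_function \<theta> w)"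
  unfolding Moebius_function_def[abs_def]
  by (intro continuous_intros) (use Moebius_denominator_nonzero in auto)

lemma inj_on_Moebius: "cmod w < 1 \<Longrightarrow> inj_on (Moebius_function \<theta> w) (cball 0 1)"
  using Moebius_inverse[of w] by (metis inj_onI mem_cball_0)

lemma Moebius_image_image:
  assumes "cmod w < 1" "S \<subseteq> cball 0 1"
  shows "Moebius_function (-\<theta>) (- cis \<theta> * w) ` Moebius_function \<theta> w ` S = S"
    and "Moebius_function \<theta> w ` Moebius_function (-\<theta>) (- cis \<theta> * w) ` S = S"
  using assms Moebius_inverse[of w _ \<theta>] Moebius_inverse'[of w _ \<theta>]
  by (force simp: image_image subset_iff)+

section \<open>Hyperbolic convexity and hulls under disk isometries\<close>

lemma hyp_convex_subset: "hyp_convex S \<Longrightarrow> S \<subseteq> cball 0 1"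
  by (simp add: hyp_convex_def)

lemma hyp_convexI:
  assumes "S \<subseteq> cball 0 1"
    and "\<And>\<theta> w s t u. cmod w < 1 \<Longrightarrow> -1 \<le> s \<Longrightarrow> s \<le> u \<Longrightarrow> u \<le> t \<Longrightarrow> t \<le> 1 \<Longrightarrow>
        Moebius_function \<theta> w (of_real s) \<in> S \<Longrightarrow> Moebius_function \<theta> w (of_real t) \<in> S \<Longrightarrow>
        Moebius_function \<theta> w (of_real u) \<in> S"
  shows "hyp_convex S"
  using assms unfolding hyp_convex_def by auto

lemma hyp_convexD:
  assumes "hyp_convex S" "cmod w < 1" "-1 \<le> s" "s \<le> u" "u \<le> t" "t \<le> 1"
    "Moebius_function \<theta> w (of_real s) \<in> S" "Moebius_function \<theta> w (of_real t) \<in> S"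
  shows "Moebius_function \<theta> w (of_real u) \<in> S"
  using assms unfolding hyp_convex_def by (meson atLeastAtMost_iff order_trans)

text \<open>Geodesics are given by Moebius parametrisations, so pulling one back along the inverse
  isometry is a composition of two Moebius maps, which \<open>Moebius_compose\<close> writes as a
  single one.\<close>

lemma hyp_convex_Moebius_image:
  assumes S: "hyp_convex S" and a: "cmod a < 1"
  shows "hyp_convex (Moebius_function \<phi> a ` S)"
  unfolding hyp_convex_def
proof (intro conjI allI impI ballI)
  show "Moebius_function \<phi> a ` S \<subseteq> cball 0 1"
    using cmod_Moebius(1)[OF a] hyp_convex_subset[OF S] by auto
  fix \<theta> w s t u
  assume w: "cmod w < 1" and st: "- 1 \<le> s" "s \<le> t" "t \<le> (1::real)"
    and in_s: "Moebius_function \<theta> w (of_real s) \<in> Moebius_function \<phi> a ` S"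
    and in_t: "Moebius_function \<theta> w (of_real t) \<in> Moebius_function \<phi> a ` S"
    and u: "u \<in> {s..t}"
  have b: "cmod (- cis \<phi> * a) < 1" using a by (simp add: norm_mult)
  obtain \<psi> v where v: "cmod v < 1" "\<And>z. cmod z \<le> 1 \<Longrightarrow>
      Moebius_function (-\<phi>) (- cis \<phi> * a) (Moebius_function \<theta> w z) = Moebius_function \<psi> v z"
    using Moebius_compose[OF b w] by metis
  have pull: "Moebius_function \<psi> v (of_real x) \<in> S"
    if x: "-1 \<le> x" "x \<le> 1" and im: "Moebius_function \<theta> w (of_real x) \<in> Moebius_function \<phi> a ` S" for x
  proof -
    obtain y where y: "y \<in> S" "Moebius_function \<theta> w (of_real x) = Moebius_function \<phi> a y" using im by auto
    have "cmod (of_real x) \<le> 1" using x by (simp add: abs_le_iff)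
    from v(2)[OF this] have "Moebius_function \<psi> v (of_real x) = y"
      unfolding y(2) using Moebius_inverse[OF a] hyp_convex_subset[OF S] y(1) by (metis mem_cball_0 subset_iff)
    then show ?thesis using y by simp
  qed
  have "Moebius_function \<psi> v (of_real u) \<in> S"
    using hyp_convexD[OF S v(1) _ _ _ _ pull[of s] pull[of t]] st u in_s in_t by auto
  moreover have "Moebius_function \<phi> a (Moebius_function \<psi> v (of_real u)) = Moebius_function \<theta> w (of_real u)"
  proof -
    have u1: "cmod (of_real u) \<le> 1" using st u by (simp add: abs_le_iff)
    show ?thesis unfolding v(2)[OF u1, symmetric]
      by (rule Moebius_inverse'[OF a]) (use cmod_Moebius(1)[OF w u1] in simp)
  qed
  ultimately show "Moebius_function \<theta> w (of_real u) \<in> Moebius_function \<phi> a ` S" by (metis imageI)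
qed

lemma hyp_convex_cball: "hyp_convex (cball 0 1)"
  unfolding hyp_convex_def
proof (intro conjI allI impI ballI)
  fix \<theta> w s t u
  assume "cmod w < 1" "- 1 \<le> s" "s \<le> t" "t \<le> (1::real)" "u \<in> {s..t}"
  then show "Moebius_function \<theta> w (of_real u) \<in> cball 0 1"
    using cmod_Moebius(1)[of w "of_real u" \<theta>] by (simp add: abs_le_iff)
qed auto

text \<open>The property passes to intersections of nonempty families; \<open>cball 0 1\<close> is
  the member that keeps the hull inside the closed disk.\<close>

lemma hyp_convex_hull:
  assumes "V \<subseteq> cball 0 1" shows "hyp_convex (hyp_convex hull V)"
proof (rule hyp_convexI)
  show "hyp_convex hull V \<subseteq> cball 0 1" using assms hyp_convex_cball by (rule hull_minimal)
  fix \<theta> w s t u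
  assume *: "cmod w < 1" "- 1 \<le> s" "s \<le> u" "u \<le> t" "t \<le> (1::real)"
    "Moebius_function \<theta> w (of_real s) \<in> hyp_convex hull V" "Moebius_function \<theta> w (of_real t) \<in> hyp_convex hull V"
  have "Moebius_function \<theta> w (of_real u) \<in> \<Inter>{T. hyp_convex T \<and> V \<subseteq> T}"
  proof (rule InterI)
    fix T assume "T \<in> {T. hyp_convex T \<and> V \<subseteq> T}"
    then have T: "hyp_convex T" "V \<subseteq> T" by auto
    then have "hyp_convex hull V \<subseteq> T" by (intro hull_minimal)
    then show "Moebius_function \<theta> w (of_real u) \<in> T"
      using * by (intro hyp_convexD[OF T(1) *(1-5)]) auto
  qed
  then show "Moebius_function \<theta> w (of_real u) \<in> hyp_convex hull V" by (simp add: hull_def)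
qed

lemma hyp_convex_hull_Moebius_image:
  assumes V: "V \<subseteq> cball 0 1" and a: "cmod a < 1"
  shows "hyp_convex hull (Moebius_function \<phi> a ` V) = Moebius_function \<phi> a ` (hyp_convex hull V)"
proof
  let ?A = "Moebius_function \<phi> a" and ?B = "Moebius_function (-\<phi>) (- cis \<phi> * a)"
  have b: "cmod (- cis \<phi> * a) < 1" using a by (simp add: norm_mult)
  have AV: "?A ` V \<subseteq> cball 0 1" using cmod_Moebius(1)[OF a] V by auto
  show "hyp_convex hull (?A ` V) \<subseteq> ?A ` (hyp_convex hull V)"
    by (intro hull_minimal hyp_convex_Moebius_image hyp_convex_hull V a image_mono hull_subset)
  have "hyp_convex hull V = hyp_convex hull (?B ` ?A ` V)" using Moebius_image_image(1)[OF a V] by simp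
  also have "\<dots> \<subseteq> ?B ` (hyp_convex hull (?A ` V))"
    by (intro hull_minimal hyp_convex_Moebius_image hyp_convex_hull AV b image_mono hull_subset)
  finally have "?A ` (hyp_convex hull V) \<subseteq> ?A ` ?B ` (hyp_convex hull (?A ` V))" by (rule image_mono)
  also have "\<dots> = hyp_convex hull (?A ` V)"
    by (intro Moebius_image_image(2) a hyp_convex_subset hyp_convex_hull AV)
  finally show "?A ` (hyp_convex hull V) \<subseteq> hyp_convex hull (?A ` V)" .
qed

lemma ideal_quad_Moebius_image:
  assumes V: "V \<subseteq> cball 0 1" and a: "cmod a < 1"
  shows "ideal_quad (Moebius_function \<phi> a ` V) = Moebius_function \<phi> a ` ideal_quad V"
proof -
  have "hyp_convex hull V \<subseteq> cball 0 1" using hyp_convex_subset hyp_convex_hull V by blast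
  then show ?thesis
    unfolding ideal_quad_def hyp_convex_hull_Moebius_image[OF V a]
    using cmod_Moebius(2)[OF a] by (auto simp: image_iff subset_iff)
qed

text \<open>By invariance of domain both the map and its inverse carry open subsets of the disk to
  open sets.\<close>

lemma interior_Moebius_image:
  assumes S: "S \<subseteq> ball 0 1" and a: "cmod a < 1"
  shows "interior (Moebius_function \<phi> a ` S) = Moebius_function \<phi> a ` interior S"
proof -
  have open_image: "open (Moebius_function \<phi> a ` U)" if "open U" "U \<subseteq> ball 0 1" "cmod a < 1" for U \<phi> a
  proof (rule invariance_of_domain[OF _ \<open>open U\<close>])
    have "U \<subseteq> cball 0 1" using that by auto
    then show "continuous_on U (Moebius_function \<phi> a)" "inj_on (Moebius_function \<phi> a) U"
      using continuous_on_Moebius[OF that(3)] inj_on_Moebius[OF that(3)]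
      by (auto intro: continuous_on_subset inj_on_subset)
  qed
  let ?A = "Moebius_function \<phi> a" and ?B = "Moebius_function (-\<phi>) (- cis \<phi> * a)"
  have b: "cmod (- cis \<phi> * a) < 1" using a by (simp add: norm_mult)
  have AS: "?A ` S \<subseteq> ball 0 1" using cmod_Moebius(2)[OF a] S by (auto simp: subset_iff)
  have iAS: "interior (?A ` S) \<subseteq> ball 0 1" using AS interior_subset by blast
  show ?thesis
  proof
    have "?B ` interior (?A ` S) \<subseteq> ?B ` ?A ` S" by (intro image_mono interior_subset)
    also have "\<dots> = S" using S by (intro Moebius_image_image(1) a) auto
    finally have "?B ` interior (?A ` S) \<subseteq> interior S"
      using open_image[OF open_interior iAS b] by (intro interior_maximal) auto
    then have "?A ` ?B ` interior (?A ` S) \<subseteq> ?A ` interior S" by (rule image_mono)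
    moreover have "interior (?A ` S) \<subseteq> cball 0 1" using iAS by auto
    ultimately show "interior (?A ` S) \<subseteq> ?A ` interior S" using Moebius_image_image(2)[OF a] by metis
    have "interior S \<subseteq> ball 0 1" using S interior_subset by blast
    from open_image[OF open_interior this a] show "?A ` interior S \<subseteq> interior (?A ` S)"
      by (intro interior_maximal image_mono interior_subset)
  qed
qed

lemma closure_Moebius_image:
  assumes S: "S \<subseteq> cball 0 1" and a: "cmod a < 1"
  shows "closure (Moebius_function \<phi> a ` S) = Moebius_function \<phi> a ` closure S"
proof -
  have cS: "closure S \<subseteq> cball 0 1" using S by (simp add: closure_minimal)
  have cont: "continuous_on (closure S) (Moebius_function \<phi> a)"
    using continuous_on_Moebius[OF a] cS by (rule continuous_on_subset)
  have "compact (closure S)" using cS by (meson bounded_cball bounded_subset closed_closure compact_eq_bounded_closed)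
  then have "closed (Moebius_function \<phi> a ` closure S)" using cont by (simp add: compact_continuous_image compact_imp_closed)
  then show ?thesis
    using image_closure_subset[OF cont closed_closure closure_subset]
    by (intro antisym closure_minimal image_mono closure_subset) auto
qed

section \<open>Invariance of the modulus and of the cross ratio\<close>

lemma conformal_onto_rectangle_Moebius_image:
  assumes V: "V \<subseteq> cball 0 1" and a: "cmod a < 1" and m: "conformal_onto_rectangle V m"
  shows "conformal_onto_rectangle (Moebius_function \<phi> a ` V) m"
proof -
  let ?A = "Moebius_function \<phi> a" and ?B = "Moebius_function (-\<phi>) (- cis \<phi> * a)"
  let ?I = "interior (ideal_quad V)"
  have b: "cmod (- cis \<phi> * a) < 1" using a by (simp add: norm_mult)
  obtain f g where fg: "f holomorphic_on ?I" "inj_on f ?I" "f ` ?I = box 0 (Complex m 1)"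
     "homeomorphism (closure ?I) (cbox 0 (Complex m 1)) f g"
     "f ` V = {0, Complex m 0, Complex m 1, Complex 0 1}"
    using m unfolding conformal_onto_rectangle_def by blast
  have Q: "ideal_quad V \<subseteq> ball 0 1" by (simp add: ideal_quad_def)
  then have I: "?I \<subseteq> ball 0 1" "?I \<subseteq> cball 0 1" using interior_subset by (blast, force)
  have cI: "closure ?I \<subseteq> cball 0 1" using I by (simp add: closure_minimal)
  have eqI: "interior (ideal_quad (?A ` V)) = ?A ` ?I"
    using ideal_quad_Moebius_image[OF V a] interior_Moebius_image[OF Q a] by metis
  have eqC: "closure (?A ` ?I) = ?A ` closure ?I" using closure_Moebius_image[OF I(2) a] .
  have BA: "?B (?A z) = z" "?A (?B z) = z" if "z \<in> cball 0 1" for z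
    using that Moebius_inverse[OF a] Moebius_inverse'[OF a] by auto
  have fB: "(f \<circ> ?B) ` ?A ` S = f ` S" if "S \<subseteq> cball 0 1" for S
    using Moebius_image_image(1)[OF a that] by (metis image_comp)
  show ?thesis
    unfolding conformal_onto_rectangle_def eqI eqC
  proof (rule exI[of _ "f \<circ> ?B"], rule exI[of _ "?A \<circ> g"], intro conjI)
    show "f \<circ> ?B holomorphic_on ?A ` ?I"
    proof (rule holomorphic_on_compose_gen[OF _ fg(1)])
      have "?A ` ?I \<subseteq> ball 0 1" using cmod_Moebius(2)[OF a] I by (auto simp: subset_iff)
      then show "?B holomorphic_on ?A ` ?I" using Moebius_function_holomorphic[OF b] holomorphic_on_subset by blast
      show "?B ` ?A ` ?I \<subseteq> ?I" using Moebius_image_image(1)[OF a I(2)] by simp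
    qed
    show "inj_on (f \<circ> ?B) (?A ` ?I)"
      using fg(2) BA(1) I(2) by (auto simp: inj_on_def subset_iff)
    show "(f \<circ> ?B) ` ?A ` ?I = box 0 (Complex m 1)" using fB[OF I(2)] fg(3) by simp
    show "(f \<circ> ?B) ` ?A ` V = {0, Complex m 0, Complex m 1, Complex 0 1}" using fB[OF V] fg(5) by simp
    have "?A ` closure ?I \<subseteq> cball 0 1" using cI cmod_Moebius(1)[OF a] by (auto simp: subset_iff)
    then have contB: "continuous_on (?A ` closure ?I) ?B"
      by (rule continuous_on_subset[OF continuous_on_Moebius[OF b]])
    have "homeomorphism (?A ` closure ?I) (closure ?I) ?B ?A"
      unfolding homeomorphism_def
      using Moebius_image_image(1)[OF a cI] BA cI continuous_on_subset[OF continuous_on_Moebius[OF a] cI] contB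
      by (auto simp: subset_iff)
    from homeomorphism_compose[OF this fg(4)]
    show "homeomorphism (?A ` closure ?I) (cbox 0 (Complex m 1)) (f \<circ> ?B) (?A \<circ> g)" .
  qed
qed

text \<open>The map and its inverse show that the two defining predicates agree for every m, so the
  two descriptions agree before existence or uniqueness is known.\<close>

lemma quad_modulus_Moebius_image:
  assumes V: "V \<subseteq> cball 0 1" and a: "cmod a < 1"
  shows "quad_modulus (Moebius_function \<phi> a ` V) = quad_modulus V"
proof -
  have b: "cmod (- cis \<phi> * a) < 1" using a by (simp add: norm_mult)
  have AV: "Moebius_function \<phi> a ` V \<subseteq> cball 0 1" using cmod_Moebius(1)[OF a] V by auto
  have "conformal_onto_rectangle (Moebius_function \<phi> a ` V) m \<longleftrightarrow> conformal_onto_rectangle V m" for m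
    using conformal_onto_rectangle_Moebius_image[OF V a, of m \<phi>]
      conformal_onto_rectangle_Moebius_image[OF AV b, of m "-\<phi>"] Moebius_image_image(1)[OF a V] by auto
  then show ?thesis unfolding quad_modulus_def by simp
qed

lemma cross_ratio_Moebius:
  assumes a: "cmod a < 1" and z: "cmod z1 \<le> 1" "cmod z2 \<le> 1" "cmod z3 \<le> 1" "cmod z4 \<le> 1"
  shows "cross_ratio (Moebius_function \<phi> a z1) (Moebius_function \<phi> a z2) (Moebius_function \<phi> a z3) (Moebius_function \<phi> a z4)
        = cross_ratio z1 z2 z3 z4"
proof -
  define e where "e = cis \<phi> * (1 - a * cnj a)"
  have "1 - a * cnj a \<noteq> 0" using Moebius_denominator_nonzero[OF a, of a] a by (simp add: mult.commute)
  then have e: "e \<noteq> 0" by (simp add: e_def)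
  \<comment> \<open>In the cross ratio each of the four points occurs once above and once below, so
    all the factors 1 - cnj a z cancel, and so do the factors \<open>e\<close>.\<close>
  have diff: "Moebius_function \<phi> a z - Moebius_function \<phi> a w = e * (z - w) / ((1 - cnj a * z) * (1 - cnj a * w))"
    if "cmod z \<le> 1" "cmod w \<le> 1" for z w
  proof -
    have "(z - a) * (1 - cnj a * w) - (w - a) * (1 - cnj a * z) = (1 - a * cnj a) * (z - w)"
      by (simp add: algebra_simps)
    then show ?thesis
      using Moebius_denominator_nonzero[OF a that(1)] Moebius_denominator_nonzero[OF a that(2)]
      unfolding Moebius_function_def exp_eq_cis
      by (simp add: divide_simps e_def mult.assoc flip: right_diff_distrib)
  qed
  show ?thesis
    unfolding cross_ratio_def using z e Moebius_denominator_nonzero[OF a] by (simp add: diff)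
qed

lemma quad_cross_ratio_Moebius_image:
  assumes V: "V \<subseteq> cball 0 1" and a: "cmod a < 1"
  shows "quad_cross_ratio (Moebius_function \<phi> a ` V) = quad_cross_ratio V"
proof -
  have sub: "\<exists>z1 z2 z3 z4. {z1, z2, z3, z4} = Moebius_function \<phi> a ` V \<and> cross_ratio z1 z2 z3 z4 = x"
    if ex: "\<exists>z1 z2 z3 z4. {z1, z2, z3, z4} = V \<and> cross_ratio z1 z2 z3 z4 = x"
      and V: "V \<subseteq> cball 0 1" and a: "cmod a < 1" for V \<phi> a x
  proof -
    obtain z1 z2 z3 z4 where z: "{z1, z2, z3, z4} = V" "cross_ratio z1 z2 z3 z4 = x" using ex by blast
    then have "cmod z1 \<le> 1" "cmod z2 \<le> 1" "cmod z3 \<le> 1" "cmod z4 \<le> 1" using V by (auto simp: subset_iff)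
    from cross_ratio_Moebius[OF a this, of \<phi>] z show ?thesis
      by (intro exI[of _ "Moebius_function \<phi> a z1"] exI[of _ "Moebius_function \<phi> a z2"]
          exI[of _ "Moebius_function \<phi> a z3"] exI[of _ "Moebius_function \<phi> a z4"]) auto
  qed
  have b: "cmod (- cis \<phi> * a) < 1" using a by (simp add: norm_mult)
  have AV: "Moebius_function \<phi> a ` V \<subseteq> cball 0 1" using cmod_Moebius(1)[OF a] V by auto
  have "(\<exists>z1 z2 z3 z4. {z1, z2, z3, z4} = Moebius_function \<phi> a ` V \<and> cross_ratio z1 z2 z3 z4 = x)
     \<longleftrightarrow> (\<exists>z1 z2 z3 z4. {z1, z2, z3, z4} = V \<and> cross_ratio z1 z2 z3 z4 = x)" for x
    using sub[OF _ V a, of x \<phi>] sub[OF _ AV b, of x "-\<phi>"] Moebius_image_image(1)[OF a V] by metis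
  then show ?thesis unfolding quad_cross_ratio_def by simp
qed

section \<open>The hull of the symmetric vertices\<close>

definition quad_verts :: "real \<Rightarrow> real \<Rightarrow> complex set" where
  "quad_verts c s = {Complex c s, Complex (-c) s, Complex (-c) (-s), Complex c (-s)}"

text \<open>
  The parameter \<open>u\<close> with \<open>2 u / (1 + u\<^sup>2) = k\<close>.
\<close>

definition half_klein :: "real \<Rightarrow> real" where
  "half_klein k = k / (1 + sqrt (1 - k\<^sup>2))"

lemma half_klein:
  assumes "\<bar>k\<bar> \<le> 1"
  shows "2 * half_klein k = k * (1 + (half_klein k)\<^sup>2)" "\<bar>half_klein k\<bar> \<le> 1"
    "\<bar>k\<bar> < 1 \<Longrightarrow> \<bar>half_klein k\<bar> < 1"
    "1 - (half_klein k)\<^sup>2 = sqrt (1 - k\<^sup>2) * (1 + (half_klein k)\<^sup>2)"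
proof -
  define r where "r = sqrt (1 - k\<^sup>2)"
  have k2: "k\<^sup>2 \<le> 1" using assms by (simp add: abs_square_le_1)
  have r: "0 \<le> r" "r\<^sup>2 = 1 - k\<^sup>2" using k2 by (auto simp: r_def)
  have h: "half_klein k = k / (1 + r)" by (simp add: half_klein_def r_def)
  have r1: "1 + r \<noteq> 0" using r by simp
  have "(1 + r)\<^sup>2 + k\<^sup>2 = 2 * (1 + r)" using r(2) by (simp add: power2_eq_square algebra_simps)
  then have s: "1 + (half_klein k)\<^sup>2 = 2 / (1 + r)"
  proof -
    assume eq: "(1 + r)\<^sup>2 + k\<^sup>2 = 2 * (1 + r)"
    have "1 + (half_klein k)\<^sup>2 = ((1 + r)\<^sup>2 + k\<^sup>2) / (1 + r)\<^sup>2"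
      using r1 by (simp add: h power_divide add_divide_distrib)
    also have "\<dots> = 2 / (1 + r)"
    proof -
      have "2 * R / R\<^sup>2 = 2 / R" if "R \<noteq> 0" for R :: real using that by (simp add: power2_eq_square)
      then show ?thesis unfolding eq using r1 by blast
    qed
    finally show ?thesis .
  qed
  then show "2 * half_klein k = k * (1 + (half_klein k)\<^sup>2)" by (simp add: h)
  have "1 - (half_klein k)\<^sup>2 = 2 - 2 / (1 + r)" using s by linarith
  also have "\<dots> = r * (2 / (1 + r))" using r1 by (simp add: field_simps)
  finally show "1 - (half_klein k)\<^sup>2 = sqrt (1 - k\<^sup>2) * (1 + (half_klein k)\<^sup>2)" unfolding s r_def[symmetric] .
  have "\<bar>half_klein k\<bar> = \<bar>k\<bar> / (1 + r)" using r by (simp add: h)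
  also have "\<dots> \<le> \<bar>k\<bar> / 1" using r by (intro divide_left_mono) auto
  finally show "\<bar>half_klein k\<bar> \<le> 1" "\<bar>k\<bar> < 1 \<Longrightarrow> \<bar>half_klein k\<bar> < 1" using assms by auto
qed

text \<open>Derived from the inverse function a |-> 2 a / (1 + a^2) instead of the explicit formula:
  after clearing denominators its increments carry the factor (a - b) (1 - a b).\<close>

lemma half_klein_mono:
  assumes "-1 \<le> x" "x \<le> y" "y \<le> 1"
  shows "half_klein x \<le> half_klein y"
proof (rule ccontr)
  define a where "a = half_klein x"
  define b where "b = half_klein y"
  assume "\<not> ?thesis"
  then have ab: "b < a" by (simp add: a_def b_def)
  have a: "2 * a = x * (1 + a\<^sup>2)" "\<bar>a\<bar> \<le> 1" unfolding a_def using assms by (auto intro!: half_klein)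
  have b: "2 * b = y * (1 + b\<^sup>2)" "\<bar>b\<bar> \<le> 1" unfolding b_def using assms by (auto intro!: half_klein)
  have "x * ((1 + a\<^sup>2) * (1 + b\<^sup>2)) \<le> y * ((1 + a\<^sup>2) * (1 + b\<^sup>2))" using assms by (intro mult_right_mono) auto
  then have "(x * (1 + a\<^sup>2)) * (1 + b\<^sup>2) \<le> (y * (1 + b\<^sup>2)) * (1 + a\<^sup>2)" by (simp add: mult_ac)
  then have "2 * a * (1 + b\<^sup>2) \<le> 2 * b * (1 + a\<^sup>2)" unfolding a(1)[symmetric] b(1)[symmetric] .
  then have "(a - b) * (1 - a * b) \<le> 0" by (simp add: algebra_simps power2_eq_square)
  then have "1 - a * b \<le> 0" using ab by (simp add: mult_le_0_iff)
  moreover have "a * b \<le> \<bar>a\<bar> * \<bar>b\<bar>" by (metis abs_ge_self abs_mult)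
  moreover have "\<bar>a\<bar> * \<bar>b\<bar> \<le> 1 * 1" using a b by (intro mult_mono) auto
  ultimately have "\<bar>a\<bar> * \<bar>b\<bar> = 1" "a * b = 1" by linarith+
  then have "1 \<le> \<bar>a\<bar>" using mult_left_mono[OF b(2) abs_ge_zero[of a]] by linarith
  then have "\<bar>a\<bar> = 1" using a(2) by linarith
  then have "a = 1 \<or> a = -1" by linarith
  then show False using \<open>a * b = 1\<close> ab by auto
qed

text \<open>Divided by 1 + u^2 the expression is affine in 2 u / (1 + u^2), which increases on
  [-1, 1]. Nonnegativity at the left end carries over when \<alpha> >= 0, and at the right end
  otherwise.\<close>

lemma quadratic_nonneg_between:
  fixes \<alpha> \<beta> :: real
  assumes "-1 \<le> x" "x \<le> u" "u \<le> y" "y \<le> 1"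
    and "0 \<le> \<beta> * (1 + x\<^sup>2) + 2 * \<alpha> * x" "0 \<le> \<beta> * (1 + y\<^sup>2) + 2 * \<alpha> * y"
  shows "0 \<le> \<beta> * (1 + u\<^sup>2) + 2 * \<alpha> * u"
proof -
  have prod: "a * b \<le> 1" if "\<bar>a\<bar> \<le> 1" "\<bar>b\<bar> \<le> 1" for a b :: real
  proof -
    have "a * b \<le> \<bar>a\<bar> * \<bar>b\<bar>" by (metis abs_ge_self abs_mult)
    also have "\<dots> \<le> 1 * 1" using that by (intro mult_mono) auto
    finally show ?thesis by simp
  qed
  show ?thesis
  proof (cases "0 \<le> \<alpha>")
    case True
    have "0 \<le> (u - x) * (1 - u * x)" using assms prod[of u x] by (intro mult_nonneg_nonneg) auto
    then have "0 \<le> 2 * \<alpha> * ((u - x) * (1 - u * x))" using True by simp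
    moreover have "(1 + x\<^sup>2) * (\<beta> * (1 + u\<^sup>2) + 2 * \<alpha> * u)
        = (1 + u\<^sup>2) * (\<beta> * (1 + x\<^sup>2) + 2 * \<alpha> * x) + 2 * \<alpha> * ((u - x) * (1 - u * x))"
      by (simp add: algebra_simps power2_eq_square)
    moreover have "0 \<le> (1 + u\<^sup>2) * (\<beta> * (1 + x\<^sup>2) + 2 * \<alpha> * x)" using assms(5) by (intro mult_nonneg_nonneg) auto
    ultimately have "0 \<le> (1 + x\<^sup>2) * (\<beta> * (1 + u\<^sup>2) + 2 * \<alpha> * u)" by linarith
    moreover have "0 < 1 + x\<^sup>2" by (simp add: add_pos_nonneg)
    ultimately show ?thesis by (simp add: zero_le_mult_iff)
  next
    case False
    have "0 \<le> (y - u) * (1 - u * y)" using assms prod[of u y] by (intro mult_nonneg_nonneg) auto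
    then have "0 \<le> (- 2 * \<alpha>) * ((y - u) * (1 - u * y))" using False by (intro mult_nonneg_nonneg[of "- 2 * \<alpha>"]) auto
    moreover have "(1 + y\<^sup>2) * (\<beta> * (1 + u\<^sup>2) + 2 * \<alpha> * u)
        = (1 + u\<^sup>2) * (\<beta> * (1 + y\<^sup>2) + 2 * \<alpha> * y) + (- 2 * \<alpha>) * ((y - u) * (1 - u * y))"
      by (simp add: algebra_simps power2_eq_square)
    moreover have "0 \<le> (1 + u\<^sup>2) * (\<beta> * (1 + y\<^sup>2) + 2 * \<alpha> * y)" using assms(6) by (intro mult_nonneg_nonneg) auto
    ultimately have "0 \<le> (1 + y\<^sup>2) * (\<beta> * (1 + u\<^sup>2) + 2 * \<alpha> * u)" by linarith
    moreover have "0 < 1 + y\<^sup>2" by (simp add: add_pos_nonneg)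
    ultimately show ?thesis by (simp add: zero_le_mult_iff)
  qed
qed

text \<open>
  In the Klein model \<open>z \<mapsto> 2 z / (1 + |z|\<^sup>2)\<close> a half-plane is cut out by an affine inequality, which
  along a geodesic becomes an affine inequality in the Klein parameter \<open>2 u / (1 + u\<^sup>2)\<close>.
\<close>

lemma Moebius_klein:
  assumes w: "cmod w < 1" and u: "-1 \<le> u" "u \<le> 1"
    and z_def: "z = Moebius_function \<theta> w (of_real u)"
  shows "(cmod (1 - cnj w * of_real u))\<^sup>2 * (1 + (cmod z)\<^sup>2) = (1 + (cmod w)\<^sup>2) * (1 + u\<^sup>2) - 4 * u * Re w"
    and "of_real ((cmod (1 - cnj w * of_real u))\<^sup>2) * z = cis \<theta> * (of_real u * (1 + w\<^sup>2) - w * of_real (1 + u\<^sup>2))"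
proof -
  define D where "D = 1 - cnj w * of_real u"
  have D: "D \<noteq> 0" unfolding D_def by (rule Moebius_denominator_nonzero[OF w]) (use u in \<open>simp add: abs_le_iff\<close>)
  have z: "z = cis \<theta> * (of_real u - w) / D" unfolding z_def Moebius_function_def exp_eq_cis D_def ..
  have "(cmod z)\<^sup>2 = (cmod (of_real u - w))\<^sup>2 / (cmod D)\<^sup>2" by (simp add: z norm_mult norm_divide power_divide)
  then have "(cmod D)\<^sup>2 * (1 + (cmod z)\<^sup>2) = (cmod D)\<^sup>2 + (cmod (of_real u - w))\<^sup>2"
    using D by (simp add: field_simps)
  also have "\<dots> = (1 + (cmod w)\<^sup>2) * (1 + u\<^sup>2) - 4 * u * Re w"
    unfolding cmod_power2 by (simp add: D_def algebra_simps power2_eq_square)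
  finally show "(cmod (1 - cnj w * of_real u))\<^sup>2 * (1 + (cmod z)\<^sup>2) = (1 + (cmod w)\<^sup>2) * (1 + u\<^sup>2) - 4 * u * Re w"
    by (simp add: D_def)
  have "of_real ((cmod D)\<^sup>2) * z = D * cnj D * z" by (simp only: complex_norm_square)
  also have "\<dots> = cis \<theta> * ((of_real u - w) * cnj D)" using D by (simp add: z)
  also have "(of_real u - w) * cnj D = of_real u * (1 + w\<^sup>2) - w * of_real (1 + u\<^sup>2)"
    by (simp add: D_def algebra_simps power2_eq_square)
  finally show "of_real ((cmod (1 - cnj w * of_real u))\<^sup>2) * z = cis \<theta> * (of_real u * (1 + w\<^sup>2) - w * of_real (1 + u\<^sup>2))"
    by (simp add: D_def)
qed

text \<open>The set is the closed disk intersected with four Klein half-planes. \<open>half\<close>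
  treats a half-plane with arbitrary linear form v and level k: multiplied by the positive number |1
  - cnj w t|^2, its inequality along the geodesic becomes the polynomial of
  \<open>quadratic_nonneg_between\<close>.\<close>

lemma hyp_convex_quad_cl: "hyp_convex (quad_cl c s)"
proof (rule hyp_convexI)
  show "quad_cl c s \<subseteq> cball 0 1" by (auto simp: quad_cl_def)
  fix \<theta> w and x y u :: real
  assume w: "cmod w < 1" and xuy: "-1 \<le> x" "x \<le> u" "u \<le> y" "y \<le> 1"
    and inx: "Moebius_function \<theta> w (of_real x) \<in> quad_cl c s" and iny: "Moebius_function \<theta> w (of_real y) \<in> quad_cl c s"
  have half: "Re (v * Moebius_function \<theta> w (of_real u)) \<le> (1 + (cmod (Moebius_function \<theta> w (of_real u)))\<^sup>2) * k"
    if vx: "Re (v * Moebius_function \<theta> w (of_real x)) \<le> (1 + (cmod (Moebius_function \<theta> w (of_real x)))\<^sup>2) * k"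
      and vy: "Re (v * Moebius_function \<theta> w (of_real y)) \<le> (1 + (cmod (Moebius_function \<theta> w (of_real y)))\<^sup>2) * k"
    for v k
  proof -
    define A where "A = Re (v * cis \<theta> * (1 + w\<^sup>2))"
    define B where "B = Re (v * cis \<theta> * w)"
    define \<beta> where "\<beta> = (1 + (cmod w)\<^sup>2) * k + B"
    define \<alpha> where "\<alpha> = - 2 * Re w * k - A / 2"
    have eq: "(cmod (1 - cnj w * of_real t))\<^sup>2 * ((1 + (cmod (Moebius_function \<theta> w (of_real t)))\<^sup>2) * k
          - Re (v * Moebius_function \<theta> w (of_real t))) = \<beta> * (1 + t\<^sup>2) + 2 * \<alpha> * t"
      and pos: "0 < (cmod (1 - cnj w * of_real t))\<^sup>2" if t: "-1 \<le> t" "t \<le> 1" for t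
    proof -
      define z where "z = Moebius_function \<theta> w (of_real t)"
      define d where "d = (cmod (1 - cnj w * of_real t))\<^sup>2"
      note kl = Moebius_klein[OF w t z_def, folded d_def]
      have "d * Re (v * z) = Re (v * (of_real d * z))" by (simp add: algebra_simps)
      also have "\<dots> = A * t - B * (1 + t\<^sup>2)"
      proof -
        have "v * (of_real d * z) = of_real t * (v * cis \<theta> * (1 + w\<^sup>2)) - of_real (1 + t\<^sup>2) * (v * cis \<theta> * w)"
          unfolding kl(2) by (simp add: algebra_simps)
        then show ?thesis
          by (simp only: minus_complex.sel Re_complex_of_real Im_complex_of_real times_complex.sel(1)[of "of_real _"]
              A_def[symmetric] B_def[symmetric]) simp
      qed
      finally have "d * ((1 + (cmod z)\<^sup>2) * k - Re (v * z)) = (d * (1 + (cmod z)\<^sup>2)) * k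
          - (A * t - B * (1 + t\<^sup>2))" by (simp add: right_diff_distrib)
      also have "\<dots> = \<beta> * (1 + t\<^sup>2) + 2 * \<alpha> * t" unfolding kl(1) \<alpha>_def \<beta>_def by (simp add: algebra_simps)
      finally show "(cmod (1 - cnj w * of_real t))\<^sup>2 * ((1 + (cmod (Moebius_function \<theta> w (of_real t)))\<^sup>2) * k
          - Re (v * Moebius_function \<theta> w (of_real t))) = \<beta> * (1 + t\<^sup>2) + 2 * \<alpha> * t" by (simp add: z_def d_def)
      have "1 - cnj w * of_real t \<noteq> 0"
        by (rule Moebius_denominator_nonzero[OF w]) (use t in \<open>simp add: abs_le_iff\<close>)
      then show "0 < (cmod (1 - cnj w * of_real t))\<^sup>2" by simp
    qed
    have "0 \<le> \<beta> * (1 + x\<^sup>2) + 2 * \<alpha> * x" unfolding eq[of x, OF xuy(1) order_trans[OF xuy(2) order_trans[OF xuy(3,4)]], symmetric]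
      using vx by (intro mult_nonneg_nonneg) auto
    moreover have "0 \<le> \<beta> * (1 + y\<^sup>2) + 2 * \<alpha> * y" unfolding eq[of y, OF order_trans[OF xuy(1) order_trans[OF xuy(2,3)]] xuy(4), symmetric]
      using vy by (intro mult_nonneg_nonneg) auto
    ultimately have "0 \<le> \<beta> * (1 + u\<^sup>2) + 2 * \<alpha> * u" using quadratic_nonneg_between[OF xuy] by blast
    then have "0 \<le> (cmod (1 - cnj w * of_real u))\<^sup>2 * ((1 + (cmod (Moebius_function \<theta> w (of_real u)))\<^sup>2) * k
          - Re (v * Moebius_function \<theta> w (of_real u)))" using eq[of u] xuy by simp
    then show ?thesis using pos[of u] xuy by (simp add: zero_le_mult_iff)
  qed
  have abs: "2 * \<bar>Re z\<bar> \<le> k \<longleftrightarrow> Re (2 * z) \<le> k \<and> Re (- 2 * z) \<le> k"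
    "2 * \<bar>Im z\<bar> \<le> k \<longleftrightarrow> Re (- 2 * \<i> * z) \<le> k \<and> Re (2 * \<i> * z) \<le> k" for z k by auto
  have "cmod (Moebius_function \<theta> w (of_real u)) \<le> 1"
    by (rule cmod_Moebius(1)[OF w]) (use xuy in \<open>simp add: abs_le_iff\<close>)
  then show "Moebius_function \<theta> w (of_real u) \<in> quad_cl c s"
    using inx iny unfolding quad_cl_def mem_Collect_eq abs by (intro conjI half) auto
qed

text \<open>The moduli are compared first: r |-> 2 r / (1 + r^2) is injective on [0, 1], because the
  other solution r r' = 1 forces r = r' = 1.\<close>

lemma klein_inj:
  assumes "cmod z \<le> 1" "cmod z' \<le> 1"
    and eq: "of_real (1 + (cmod z')\<^sup>2) * z = of_real (1 + (cmod z)\<^sup>2) * z'"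
  shows "z = z'"
proof -
  define r where "r = cmod z"
  define r' where "r' = cmod z'"
  have r: "0 \<le> r" "r \<le> 1" "0 \<le> r'" "r' \<le> 1" using assms by (auto simp: r_def r'_def)
  have "cmod (of_real (1 + r'\<^sup>2) * z) = cmod (of_real (1 + r\<^sup>2) * z')" using eq by (simp add: r_def r'_def)
  then have "(1 + r'\<^sup>2) * r = (1 + r\<^sup>2) * r'"
    unfolding norm_mult norm_of_real r_def[symmetric] r'_def[symmetric] by (simp add: abs_of_nonneg)
  then have "(r - r') * (1 - r * r') = 0" by (simp add: algebra_simps power2_eq_square)
  moreover have "r = r'" if "r * r' = 1"
  proof -
    have "r * r' \<le> r * 1" "r * r' \<le> 1 * r'"
      using r mult_left_mono[of r' 1 r] mult_right_mono[of r 1 r'] by auto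
    then show ?thesis using that r by linarith
  qed
  ultimately have "r = r'" by auto
  then have "of_real (1 + r\<^sup>2) * z = of_real (1 + r\<^sup>2) * z'" using eq by (simp add: r_def r'_def)
  moreover have "1 + r\<^sup>2 \<noteq> 0" by (metis add_pos_nonneg less_irrefl zero_le_power2 zero_less_one)
  ultimately show ?thesis by (metis mult_left_cancel of_real_eq_0_iff)
qed

text \<open>x and y are Klein coordinates. They serve to recognise one point when it is reached
  along different chords.\<close>

lemma mem_if_klein_eq:
  assumes "z \<in> S" "cmod z \<le> 1" "cmod z' \<le> 1"
    "2 * Re z = (1 + (cmod z)\<^sup>2) * x" "2 * Im z = (1 + (cmod z)\<^sup>2) * y"
    "2 * Re z' = (1 + (cmod z')\<^sup>2) * x" "2 * Im z' = (1 + (cmod z')\<^sup>2) * y"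
  shows "z' \<in> S"
proof -
  have "of_real 2 * (of_real (1 + (cmod z')\<^sup>2) * z) = of_real 2 * (of_real (1 + (cmod z)\<^sup>2) * z')"
  proof (rule complex_eqI)
    have "(1 + (cmod z')\<^sup>2) * (2 * Re z) = (1 + (cmod z)\<^sup>2) * (2 * Re z')"
      "(1 + (cmod z')\<^sup>2) * (2 * Im z) = (1 + (cmod z)\<^sup>2) * (2 * Im z')"
      unfolding assms(4-7) by (simp_all add: mult_ac)
    then show "Re (of_real 2 * (of_real (1 + (cmod z')\<^sup>2) * z)) = Re (of_real 2 * (of_real (1 + (cmod z)\<^sup>2) * z'))"
      "Im (of_real 2 * (of_real (1 + (cmod z')\<^sup>2) * z)) = Im (of_real 2 * (of_real (1 + (cmod z)\<^sup>2) * z'))"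
      by (simp_all only: Re_complex_of_real Im_complex_of_real times_complex.sel) (simp_all add: mult_ac)
  qed
  then have "of_real (1 + (cmod z')\<^sup>2) * z = of_real (1 + (cmod z)\<^sup>2) * z'"
    by (metis mult_left_cancel of_real_eq_0_iff zero_neq_numeral)
  then show ?thesis using klein_inj[OF assms(2,3)] assms(1) by simp
qed

text \<open>The geodesic that is the horizontal Klein chord at height y: the real diameter
  translated along the imaginary axis. The parameter k in [-1, 1] is affine in the Klein model, the
  point being (k sqrt (1 - y^2), y). \<open>vchord\<close> is the vertical analogue, with an
  additional quarter turn.\<close>

definition hchord :: "real \<Rightarrow> real \<Rightarrow> complex" where
  "hchord y k = Moebius_function 0 (- \<i> * of_real (half_klein y)) (of_real (half_klein k))"

definition vchord :: "real \<Rightarrow> real \<Rightarrow> complex" where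
  "vchord x k = Moebius_function (pi/2) (\<i> * of_real (half_klein x)) (of_real (half_klein k))"

lemma chord_klein:
  assumes y: "\<bar>y\<bar> < 1" and k: "\<bar>k\<bar> \<le> 1"
  shows "cmod (hchord y k) \<le> 1" "2 * Re (hchord y k) = (1 + (cmod (hchord y k))\<^sup>2) * (k * sqrt (1 - y\<^sup>2))"
      "2 * Im (hchord y k) = (1 + (cmod (hchord y k))\<^sup>2) * y"
    and "cmod (vchord y k) \<le> 1" "2 * Re (vchord y k) = (1 + (cmod (vchord y k))\<^sup>2) * y"
      "2 * Im (vchord y k) = (1 + (cmod (vchord y k))\<^sup>2) * (k * sqrt (1 - y\<^sup>2))"
proof -
  define b where "b = half_klein y"
  define t where "t = half_klein k"
  have b: "\<bar>b\<bar> < 1" "2 * b = y * (1 + b\<^sup>2)" "1 - b\<^sup>2 = sqrt (1 - y\<^sup>2) * (1 + b\<^sup>2)"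
    unfolding b_def using y by (auto intro!: half_klein)
  have t: "\<bar>t\<bar> \<le> 1" "2 * t = k * (1 + t\<^sup>2)" unfolding t_def using k by (auto intro!: half_klein)
  have t1: "-1 \<le> t" "t \<le> 1" "cmod (of_real t) \<le> 1" using t by (auto simp: abs_le_iff)
  have wh: "cmod (- \<i> * of_real b) < 1" and wv: "cmod (\<i> * of_real b) < 1" using b by (simp_all add: norm_mult)
  have h: "hchord y k = Moebius_function 0 (- \<i> * of_real b) (of_real t)"
    and v: "vchord y k = Moebius_function (pi/2) (\<i> * of_real b) (of_real t)"
    by (simp_all add: hchord_def vchord_def b_def t_def)
  show "cmod (hchord y k) \<le> 1" "cmod (vchord y k) \<le> 1"
    unfolding h v using cmod_Moebius(1)[OF wh t1(3)] cmod_Moebius(1)[OF wv t1(3)] by auto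
  define d where "d = (cmod (1 - cnj (- \<i> * of_real b) * of_real t))\<^sup>2"
  define d' where "d' = (cmod (1 - cnj (\<i> * of_real b) * of_real t))\<^sup>2"
  have pos: "d \<noteq> 0" "d' \<noteq> 0"
    unfolding d_def d'_def using Moebius_denominator_nonzero[OF wh t1(3)] Moebius_denominator_nonzero[OF wv t1(3)] by auto
  note kh = Moebius_klein[OF wh t1(1,2) h, folded d_def]
  note kv = Moebius_klein[OF wv t1(1,2) v, folded d'_def]
  have nh: "d * (1 + (cmod (hchord y k))\<^sup>2) = (1 + b\<^sup>2) * (1 + t\<^sup>2)"
    and nv: "d' * (1 + (cmod (vchord y k))\<^sup>2) = (1 + b\<^sup>2) * (1 + t\<^sup>2)"
    using kh(1) kv(1) by (simp_all add: norm_mult)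
  have "d * Re (hchord y k) = Re (of_real d * hchord y k)" "d * Im (hchord y k) = Im (of_real d * hchord y k)" by simp_all
  then have ch: "d * Re (hchord y k) = t * (1 - b\<^sup>2)" "d * Im (hchord y k) = b * (1 + t\<^sup>2)"
    unfolding kh(2) by (simp_all add: power2_eq_square algebra_simps)
  have "d' * Re (vchord y k) = Re (of_real d' * vchord y k)" "d' * Im (vchord y k) = Im (of_real d' * vchord y k)" by simp_all
  then have cv: "d' * Re (vchord y k) = b * (1 + t\<^sup>2)" "d' * Im (vchord y k) = t * (1 - b\<^sup>2)"
    unfolding kv(2) by (simp_all add: power2_eq_square algebra_simps)
  have e1: "2 * (b * (1 + t\<^sup>2)) = ((1 + b\<^sup>2) * (1 + t\<^sup>2)) * y"
  proof -
    have "2 * (b * (1 + t\<^sup>2)) = (2 * b) * (1 + t\<^sup>2)" by simp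
    also have "\<dots> = ((1 + b\<^sup>2) * (1 + t\<^sup>2)) * y" unfolding b(2) by (simp add: mult_ac)
    finally show ?thesis .
  qed
  have e2: "2 * (t * (1 - b\<^sup>2)) = ((1 + b\<^sup>2) * (1 + t\<^sup>2)) * (k * sqrt (1 - y\<^sup>2))"
  proof -
    have "2 * (t * (1 - b\<^sup>2)) = (2 * t) * (1 - b\<^sup>2)" by simp
    also have "\<dots> = ((1 + b\<^sup>2) * (1 + t\<^sup>2)) * (k * sqrt (1 - y\<^sup>2))" unfolding b(3) t(2) by (simp add: mult_ac)
    finally show ?thesis .
  qed
  have "d * (2 * Re (hchord y k)) = d * ((1 + (cmod (hchord y k))\<^sup>2) * (k * sqrt (1 - y\<^sup>2)))"
    using e2 nh ch(1) by (metis mult.assoc mult.left_commute)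
  then show "2 * Re (hchord y k) = (1 + (cmod (hchord y k))\<^sup>2) * (k * sqrt (1 - y\<^sup>2))" using pos by simp
  have "d * (2 * Im (hchord y k)) = d * ((1 + (cmod (hchord y k))\<^sup>2) * y)"
    using e1 nh ch(2) by (metis mult.assoc mult.left_commute)
  then show "2 * Im (hchord y k) = (1 + (cmod (hchord y k))\<^sup>2) * y" using pos by simp
  have "d' * (2 * Re (vchord y k)) = d' * ((1 + (cmod (vchord y k))\<^sup>2) * y)"
    using e1 nv cv(1) by (metis mult.assoc mult.left_commute)
  then show "2 * Re (vchord y k) = (1 + (cmod (vchord y k))\<^sup>2) * y" using pos by simp
  have "d' * (2 * Im (vchord y k)) = d' * ((1 + (cmod (vchord y k))\<^sup>2) * (k * sqrt (1 - y\<^sup>2)))"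
    using e2 nv cv(2) by (metis mult.assoc mult.left_commute)
  then show "2 * Im (vchord y k) = (1 + (cmod (vchord y k))\<^sup>2) * (k * sqrt (1 - y\<^sup>2))" using pos by simp
qed

lemma chord_mem:
  assumes S: "hyp_convex S" and y: "\<bar>y\<bar> < 1" and k: "-1 \<le> k1" "k1 \<le> k" "k \<le> k2" "k2 \<le> 1"
  shows "hchord y k1 \<in> S \<Longrightarrow> hchord y k2 \<in> S \<Longrightarrow> hchord y k \<in> S"
    and "vchord y k1 \<in> S \<Longrightarrow> vchord y k2 \<in> S \<Longrightarrow> vchord y k \<in> S"
proof -
  have b: "\<bar>half_klein y\<bar> < 1" using y by (intro half_klein) auto
  have w: "cmod (- \<i> * of_real (half_klein y)) < 1" "cmod (\<i> * of_real (half_klein y)) < 1" using b by (simp_all add: norm_mult)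
  have m: "half_klein k1 \<le> half_klein k" "half_klein k \<le> half_klein k2" using k by (auto intro!: half_klein_mono)
  have "\<bar>half_klein k1\<bar> \<le> 1" "\<bar>half_klein k2\<bar> \<le> 1" using k by (auto intro!: half_klein)
  then have l: "-1 \<le> half_klein k1" "half_klein k2 \<le> 1" by auto
  show "hchord y k1 \<in> S \<Longrightarrow> hchord y k2 \<in> S \<Longrightarrow> hchord y k \<in> S"
    unfolding hchord_def by (rule hyp_convexD[OF S w(1) l(1) m l(2)])
  show "vchord y k1 \<in> S \<Longrightarrow> vchord y k2 \<in> S \<Longrightarrow> vchord y k \<in> S"
    unfolding vchord_def by (rule hyp_convexD[OF S w(2) l(1) m l(2)])
qed

text \<open>Two rounds of chords fill the Klein rectangle: the horizontal chords between vertices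
  give the sides y = s and y = -s, and the vertical chord at abscissa x joins a point of one to a
  point of the other.\<close>

lemma quad_dom_subset_hyp_convex:
  assumes cs: "0 < c" "0 < s" "c\<^sup>2 + s\<^sup>2 = 1" and S: "hyp_convex S" and V: "quad_verts c s \<subseteq> S"
  shows "quad_dom c s \<subseteq> S"
proof
  fix z assume "z \<in> quad_dom c s"
  then have z: "cmod z < 1" "2 * \<bar>Re z\<bar> < (1 + (cmod z)\<^sup>2) * c" "2 * \<bar>Im z\<bar> < (1 + (cmod z)\<^sup>2) * s"
    by (auto simp: quad_dom_def)
  define n where "n = 1 + (cmod z)\<^sup>2"
  have n: "0 < n" by (simp add: n_def add_pos_nonneg)
  define x where "x = 2 * Re z / n"
  define y where "y = 2 * Im z / n"
  have zx: "2 * Re z = n * x" "2 * Im z = n * y" using n by (auto simp: x_def y_def)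
  have xy: "\<bar>x\<bar> < c" "\<bar>y\<bar> < s" using z n by (auto simp: x_def y_def n_def[symmetric] divide_less_eq mult.commute)
  have c2: "1 - s\<^sup>2 = c\<^sup>2" "1 - c\<^sup>2 = s\<^sup>2" using cs by auto
  have s1: "s < 1" "c < 1" using cs c2
    by (metis abs_of_pos abs_square_less_1 add.commute less_add_same_cancel1 zero_less_power)+
  have sq: "sqrt (1 - s\<^sup>2) = c" unfolding c2(1) using cs by simp
  \<comment> \<open>The horizontal chord at height s or -s has half-length sqrt (1 - s^2) = c, so
    its ideal endpoints are vertices.\<close>
  have vert: "hchord (\<tau> * s) \<sigma> \<in> S" if "\<sigma> = 1 \<or> \<sigma> = -1" "\<tau> = 1 \<or> \<tau> = -1" for \<sigma> \<tau>
  proof (rule mem_if_klein_eq[of "Complex (\<sigma> * c) (\<tau> * s)" S _ "\<sigma> * c" "\<tau> * s"])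
    have ss: "\<bar>\<tau> * s\<bar> < 1" "\<bar>\<sigma>\<bar> \<le> 1" "(\<tau> * s)\<^sup>2 = s\<^sup>2" "(\<sigma> * c)\<^sup>2 = c\<^sup>2"
      using that cs s1 by (auto simp: abs_mult power_mult_distrib)
    show "Complex (\<sigma> * c) (\<tau> * s) \<in> S" using that V by (auto simp: quad_verts_def)
    have "(cmod (Complex (\<sigma> * c) (\<tau> * s)))\<^sup>2 = 1" using ss cs by (simp add: cmod_power2)
    moreover from this have "cmod (Complex (\<sigma> * c) (\<tau> * s)) = 1" by (metis norm_ge_zero power2_eq_1_iff neg_0_le_iff_le not_one_le_zero)
    ultimately show "cmod (Complex (\<sigma> * c) (\<tau> * s)) \<le> 1"
      "2 * Re (Complex (\<sigma> * c) (\<tau> * s)) = (1 + (cmod (Complex (\<sigma> * c) (\<tau> * s)))\<^sup>2) * (\<sigma> * c)"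
      "2 * Im (Complex (\<sigma> * c) (\<tau> * s)) = (1 + (cmod (Complex (\<sigma> * c) (\<tau> * s)))\<^sup>2) * (\<tau> * s)" by simp_all
    note ck = chord_klein[OF ss(1,2)]
    show "cmod (hchord (\<tau> * s) \<sigma>) \<le> 1" "2 * Im (hchord (\<tau> * s) \<sigma>) = (1 + (cmod (hchord (\<tau> * s) \<sigma>))\<^sup>2) * (\<tau> * s)"
      by (rule ck)+
    show "2 * Re (hchord (\<tau> * s) \<sigma>) = (1 + (cmod (hchord (\<tau> * s) \<sigma>))\<^sup>2) * (\<sigma> * c)"
      using ck(2) unfolding ss(3) sq .
  qed
  \<comment> \<open>The half-length of the vertical chord at abscissa x. It exceeds s as |x| < c, so
    this chord meets the horizontal sides at the parameters s / q and - s / q.\<close>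
  define q where "q = sqrt (1 - x\<^sup>2)"
  have x2: "x\<^sup>2 < c\<^sup>2" using power_strict_mono[OF xy(1), of 2] by simp
  have "sqrt (s\<^sup>2) < q" unfolding q_def using x2 c2 by (intro real_sqrt_less_mono) linarith
  then have q: "s < q" using cs by simp
  have x1: "\<bar>x\<bar> < 1" using xy s1 by simp
  have mid: "vchord x (\<tau> * (s / q)) \<in> S" if \<tau>: "\<tau> = 1 \<or> \<tau> = -1" for \<tau>
  proof -
    have ss: "\<bar>\<tau> * s\<bar> < 1" "(\<tau> * s)\<^sup>2 = s\<^sup>2" using \<tau> cs s1 by (auto simp: abs_mult power_mult_distrib)
    have xc: "\<bar>x / c\<bar> \<le> 1" using xy cs by simp
    have "-1 \<le> x / c" "x / c \<le> 1" using abs_le_D1[OF xc] abs_le_D2[OF xc] by linarith+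
    then have hm: "hchord (\<tau> * s) (x / c) \<in> S"
      using chord_mem(1)[OF S ss(1), of "-1" "x / c" 1] vert[of "-1" \<tau>] vert[of 1 \<tau>] \<tau> by auto
    have k: "\<bar>\<tau> * (s / q)\<bar> \<le> 1" using \<tau> q cs by (auto simp: abs_mult)
    show ?thesis
    proof (rule mem_if_klein_eq[OF hm])
      note ck = chord_klein[OF ss(1) xc] and cv = chord_klein[OF x1 k]
      show "cmod (hchord (\<tau> * s) (x / c)) \<le> 1" "cmod (vchord x (\<tau> * (s / q))) \<le> 1" by (rule ck cv)+
      show "2 * Re (hchord (\<tau> * s) (x / c)) = (1 + (cmod (hchord (\<tau> * s) (x / c)))\<^sup>2) * x"
        using ck(2) cs unfolding ss(2) sq by simp
      show "2 * Im (hchord (\<tau> * s) (x / c)) = (1 + (cmod (hchord (\<tau> * s) (x / c)))\<^sup>2) * (\<tau> * s)" by (rule ck)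
      show "2 * Re (vchord x (\<tau> * (s / q))) = (1 + (cmod (vchord x (\<tau> * (s / q))))\<^sup>2) * x" by (rule cv)
      show "2 * Im (vchord x (\<tau> * (s / q))) = (1 + (cmod (vchord x (\<tau> * (s / q))))\<^sup>2) * (\<tau> * s)"
        using cv(6) q cs unfolding q_def[symmetric] by simp
    qed
  qed
  have yq: "- (s / q) \<le> y / q" "y / q \<le> s / q" "s / q \<le> 1" "-1 \<le> - (s / q)" "\<bar>y / q\<bar> \<le> 1"
    using xy(2) q cs by (auto simp: divide_simps abs_less_iff)
  have vm: "vchord x (y / q) \<in> S"
    using chord_mem(2)[OF S x1 yq(4,1,2,3)] mid[of 1] mid[of "-1"] by simp
  show "z \<in> S"
  proof (rule mem_if_klein_eq[OF vm])
    note cv = chord_klein[OF x1 yq(5)]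
    show "cmod (vchord x (y / q)) \<le> 1" "2 * Re (vchord x (y / q)) = (1 + (cmod (vchord x (y / q)))\<^sup>2) * x" by (rule cv)+
    show "2 * Im (vchord x (y / q)) = (1 + (cmod (vchord x (y / q)))\<^sup>2) * y"
      using cv(6) q cs unfolding q_def[symmetric] by simp
  qed (use z zx in \<open>auto simp: n_def\<close>)
qed

text \<open>An interior point z of the hull stays in the hull after multiplication by some t > 1,
  and scaling back by 1 / t lands in the open domain. The exact shape of the hull at its frontier is
  thereby irrelevant.\<close>

lemma interior_ideal_quad:
  assumes cs: "0 < c" "0 < s" "c\<^sup>2 + s\<^sup>2 = 1"
  shows "interior (ideal_quad (quad_verts c s)) = quad_dom c s"
proof
  have V: "quad_verts c s \<subseteq> quad_cl c s"
  proof
    fix v assume "v \<in> quad_verts c s"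
    then have v: "\<bar>Re v\<bar> = c" "\<bar>Im v\<bar> = s" using cs by (auto simp: quad_verts_def)
    have "(cmod v)\<^sup>2 = \<bar>Re v\<bar>\<^sup>2 + \<bar>Im v\<bar>\<^sup>2" by (simp add: cmod_power2)
    then have "(cmod v)\<^sup>2 = 1" unfolding v using cs by simp
    moreover from this have "cmod v \<le> 1" using norm_ge_zero[of v] by (auto simp: power2_eq_1_iff)
    ultimately show "v \<in> quad_cl c s" using v by (simp add: quad_cl_def)
  qed
  have hull: "hyp_convex hull (quad_verts c s) \<subseteq> quad_cl c s"
    using V hyp_convex_quad_cl by (rule hull_minimal)
  have "quad_verts c s \<subseteq> cball 0 1" using V by (auto simp: quad_cl_def)
  from quad_dom_subset_hyp_convex[OF cs hyp_convex_hull[OF this] hull_subset]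
  have "quad_dom c s \<subseteq> ideal_quad (quad_verts c s)" by (auto simp: ideal_quad_def quad_dom_def)
  then show "quad_dom c s \<subseteq> interior (ideal_quad (quad_verts c s))"
    using open_quad_dom by (rule interior_maximal)
  show "interior (ideal_quad (quad_verts c s)) \<subseteq> quad_dom c s"
  proof
    fix z assume z: "z \<in> interior (ideal_quad (quad_verts c s))"
    have "open ((\<lambda>t::real. of_real t * z) -` interior (ideal_quad (quad_verts c s)))"
      by (intro continuous_open_vimage continuous_intros) auto
    moreover have "1 \<in> (\<lambda>t::real. of_real t * z) -` interior (ideal_quad (quad_verts c s))" using z by simp
    ultimately obtain e where e: "0 < e" "ball 1 e \<subseteq> (\<lambda>t::real. of_real t * z) -` interior (ideal_quad (quad_verts c s))"
      by (rule openE)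
    define t where "t = 1 + e / 2"
    have t: "1 < t" "t \<in> ball 1 e" using e(1) by (auto simp: t_def dist_real_def)
    have "of_real t * z \<in> interior (ideal_quad (quad_verts c s))" using subsetD[OF e(2) t(2)] by simp
    then have "of_real t * z \<in> ideal_quad (quad_verts c s)" using interior_subset by blast
    then have "of_real t * z \<in> quad_cl c s" using hull by (auto simp: ideal_quad_def)
    from scale_quad_cl[OF cs(1,2) this, of "1 / t"] t show "z \<in> quad_dom c s" by simp
  qed
qed

section \<open>The normal form\<close>

definition isom_image :: "complex set \<Rightarrow> complex set \<Rightarrow> bool" where
  "isom_image V W \<longleftrightarrow> (\<exists>\<theta> w. cmod w < 1 \<and> W = Moebius_function \<theta> w ` V)"

lemma Moebius_rotation: "Moebius_function \<theta> 0 z = cis \<theta> * z"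
  by (simp add: Moebius_function_def exp_eq_cis)

lemma isom_image_rotation:
  assumes "cmod r = 1" shows "isom_image V ((*) r ` V)"
proof -
  obtain \<theta> where "r = cis \<theta>" using assms by (metis rcis_cmod_Arg rcis_def mult_1 of_real_1)
  then have "(*) r = Moebius_function \<theta> 0" by (auto simp: Moebius_rotation)
  then show ?thesis unfolding isom_image_def by (metis norm_zero zero_less_one)
qed

lemma isom_image_trans:
  assumes "isom_image U V" "isom_image V W" "U \<subseteq> cball 0 1" shows "isom_image U W"
proof -
  obtain \<theta> w where w: "cmod w < 1" "V = Moebius_function \<theta> w ` U" using assms(1) unfolding isom_image_def by blast
  obtain \<phi> a where a: "cmod a < 1" "W = Moebius_function \<phi> a ` V" using assms(2) unfolding isom_image_def by blast
  obtain \<psi> v where v: "cmod v < 1"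
    "\<And>z. cmod z \<le> 1 \<Longrightarrow> Moebius_function \<phi> a (Moebius_function \<theta> w z) = Moebius_function \<psi> v z"
    using Moebius_compose[OF a(1) w(1)] by metis
  have "W = Moebius_function \<psi> v ` U"
    unfolding a(2) w(2) image_image using v(2) assms(3) by (intro image_cong refl) auto
  then show ?thesis using v(1) unfolding isom_image_def by blast
qed

lemma isom_image_ideal_vertices:
  assumes "isom_image V W" "ideal_vertices V" shows "ideal_vertices W"
proof -
  obtain \<theta> w where w: "cmod w < 1" "W = Moebius_function \<theta> w ` V" using assms(1) unfolding isom_image_def by blast
  have V: "V \<subseteq> sphere 0 1" "card V = 4" using assms(2) by (auto simp: ideal_vertices_def)
  then have cb: "V \<subseteq> cball 0 1" by auto
  have "W \<subseteq> sphere 0 1"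
  proof
    fix z assume "z \<in> W"
    then obtain v where v: "v \<in> V" "z = Moebius_function \<theta> w v" using w by auto
    then have "cmod v = 1" using V by auto
    then show "z \<in> sphere 0 1" using cmod_Moebius[OF w(1), of v \<theta>] v(2) by auto
  qed
  moreover have "card W = 4"
    unfolding w(2) using V(2) inj_on_subset[OF inj_on_Moebius[OF w(1)] cb] by (simp add: card_image)
  ultimately show ?thesis by (simp add: ideal_vertices_def)
qed

text \<open>
  The translation along the real diameter with parameter \<open>half_klein k\<close> acts on the real parts of
  points of the circle as \<open>x \<mapsto> (x - k) / (1 - k x)\<close>.
\<close>

lemma Re_translation:
  assumes z: "cmod z = 1" and c: "\<bar>c\<bar> < 1" and k: "2 * c = k * (1 + c\<^sup>2)"
  shows "Re (Moebius_function 0 (of_real c) z) = (Re z - k) / (1 - k * Re z)"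
proof -
  define D where "D = 1 - of_real c * z"
  have D: "D \<noteq> 0" unfolding D_def using Moebius_denominator_nonzero[of "of_real c" z] z c by simp
  have z2: "Re z * Re z + Im z * Im z = 1" using z cmod_power2[of z] by (simp add: power2_eq_square)
  have D2: "(cmod D)\<^sup>2 = (1 + c\<^sup>2) * (1 - k * Re z)"
  proof -
    have "(cmod D)\<^sup>2 = 1 - 2 * c * Re z + c * c * (Re z * Re z + Im z * Im z)"
      unfolding cmod_power2 D_def by (simp add: power2_eq_square algebra_simps)
    also have "\<dots> = (1 + c\<^sup>2) * (1 - k * Re z)" unfolding z2 k by (simp add: power2_eq_square algebra_simps)
    finally show ?thesis .
  qed
  have num: "Re ((z - of_real c) * cnj D) = (1 + c\<^sup>2) * (Re z - k)"
  proof -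
    have "Re ((z - of_real c) * cnj D) = Re z - 2 * c - c * (Re z * Re z + Im z * Im z) + c + c * c * Re z"
      unfolding D_def by (simp add: algebra_simps)
    also have "\<dots> = (1 + c\<^sup>2) * (Re z - k)" unfolding z2 k by (simp add: power2_eq_square algebra_simps)
    finally show ?thesis .
  qed
  have "Moebius_function 0 (of_real c) z = (z - of_real c) / D" by (simp add: Moebius_function_def D_def)
  also have "\<dots> = ((z - of_real c) * cnj D) / of_real ((cmod D)\<^sup>2)"
    unfolding complex_norm_square using D by simp
  finally have "Re (Moebius_function 0 (of_real c) z) = Re ((z - of_real c) * cnj D) / (cmod D)\<^sup>2"
    by (simp only: Re_divide_of_real)
  also have "\<dots> = (Re z - k) / (1 - k * Re z)"
    unfolding num D2 by (rule mult_divide_mult_cancel_left) (metis add_pos_nonneg less_irrefl zero_le_power2 zero_less_one)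
  finally show ?thesis .
qed

text \<open>With real parts x and y, the requirement (x - k) / (1 - k x) = - (y - k) / (1 - k y)
  amounts to 2 k / (1 + k^2) = (x + y) / (1 + x y) = \<sigma>. Hence k is
  \<open>half_klein \<sigma>\<close>; the translation with this action on real parts has parameter
  \<open>half_klein k\<close>, which is why \<open>half_klein\<close> is applied twice.\<close>

lemma translation_balances:
  assumes z: "cmod z = 1" "z \<noteq> 1" "z \<noteq> -1" and w: "cmod w = 1" "w \<noteq> 1" "w \<noteq> -1"
  obtains c where "\<bar>c\<bar> < 1" "Re (Moebius_function 0 (of_real c) w) = - Re (Moebius_function 0 (of_real c) z)"
proof -
  have lt: "\<bar>Re v\<bar> < 1" if "cmod v = 1" "v \<noteq> 1" "v \<noteq> -1" for v
  proof -
    have v2: "(Re v)\<^sup>2 + (Im v)\<^sup>2 = 1" using that cmod_power2[of v] by simp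
    have "Im v \<noteq> 0"
    proof
      assume "Im v = 0"
      then have "(Re v)\<^sup>2 = 1" using v2 by simp
      then show False using that \<open>Im v = 0\<close> by (auto simp: power2_eq_1_iff complex_eq_iff)
    qed
    then have "(Re v)\<^sup>2 < 1" using v2 by (metis less_add_same_cancel1 zero_less_power2)
    then show ?thesis by (simp add: abs_square_less_1)
  qed
  define x where "x = Re z"
  define y where "y = Re w"
  have xy: "\<bar>x\<bar> < 1" "\<bar>y\<bar> < 1" using lt z w by (auto simp: x_def y_def)
  have prod: "\<bar>a * b\<bar> < 1" if "\<bar>a\<bar> < 1" "\<bar>b\<bar> \<le> 1" for a b :: real
  proof -
    have "\<bar>a\<bar> * \<bar>b\<bar> \<le> \<bar>a\<bar> * 1" using that by (intro mult_left_mono) auto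
    then show ?thesis using that by (simp add: abs_mult)
  qed
  have pos: "0 < 1 + x * y" using prod[OF xy(1), of y] xy by (simp add: abs_less_iff)
  define \<sigma> where "\<sigma> = (x + y) / (1 + x * y)"
  have "0 < (1 - x) * (1 - y)" "0 < (1 + x) * (1 + y)" using xy by (auto simp: abs_less_iff intro!: mult_pos_pos)
  then have "x + y < 1 + x * y" "- (x + y) < 1 + x * y" by (simp_all add: algebra_simps)
  then have \<sigma>: "\<bar>\<sigma>\<bar> < 1" using pos by (simp add: \<sigma>_def abs_less_iff)
  define k where "k = half_klein \<sigma>"
  have k: "2 * k = \<sigma> * (1 + k\<^sup>2)" "\<bar>k\<bar> < 1" unfolding k_def using \<sigma> by (auto intro!: half_klein)
  define c where "c = half_klein k"
  have c: "2 * c = k * (1 + c\<^sup>2)" "\<bar>c\<bar> < 1" unfolding c_def using k by (auto intro!: half_klein)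
  have kx: "1 - k * x \<noteq> 0" "1 - k * y \<noteq> 0"
    using prod[OF k(2), of x] prod[OF k(2), of y] xy by (auto simp: abs_less_iff)
  have "2 * k * (1 + x * y) = (x + y) * (1 + k\<^sup>2)" unfolding k(1) using pos by (simp add: \<sigma>_def)
  then have "(y - k) * (1 - k * x) = - ((x - k) * (1 - k * y))" by (simp add: algebra_simps power2_eq_square)
  then have "(y - k) / (1 - k * y) = - (x - k) / (1 - k * x)"
    by (subst frac_eq_eq[OF kx(2,1)]) (simp only: mult_minus_left)
  then show ?thesis
    using that[OF c(2)] Re_translation[OF z(1) c(2,1)] Re_translation[OF w(1) c(2,1)]
    by (simp only: x_def y_def minus_divide_left)
qed

lemma cmod_Moebius_eq_1: "cmod w < 1 \<Longrightarrow> cmod z = 1 \<Longrightarrow> cmod (Moebius_function \<theta> w z) = 1"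
  using cmod_Moebius[of w z \<theta>] by force

lemma unit_eq_Re_opposite:
  assumes "cmod p = 1" "cmod q = 1" "Re q = - Re p"
  shows "q = - p \<or> q = - cnj p"
proof -
  have "(Re p)\<^sup>2 + (Im p)\<^sup>2 = 1" "(Re q)\<^sup>2 + (Im q)\<^sup>2 = 1"
    using assms(1,2) cmod_power2[of p] cmod_power2[of q] by simp_all
  then have "(Im q)\<^sup>2 = (Im p)\<^sup>2" using assms(3) by simp
  then have "Im q = Im p \<or> Im q = - Im p" by (simp add: power2_eq_iff)
  then show ?thesis using assms(3) by (auto simp: complex_eq_iff)
qed

text \<open>Dividing by a square root r of - z1 z2 makes the pair symmetric about the imaginary
  axis, as a and - cnj a, with the sign \<sigma> ensuring Re a > 0. The translation along that axis
  with t the tangent of half the argument of a moves a to 1, and then, by symmetry, - cnj a to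
  -1.\<close>

lemma isom_to_diameter:
  assumes "cmod z1 = 1" "cmod z2 = 1" "z1 \<noteq> z2"
  obtains \<theta> w where "cmod w < 1" "Moebius_function \<theta> w z1 = 1" "Moebius_function \<theta> w z2 = -1"
proof -
  define r where "r = csqrt (- z1 * z2)"
  have r2: "r\<^sup>2 = - z1 * z2" by (simp add: r_def)
  have r1: "cmod r = 1" by (simp add: r_def norm_mult assms)
  have nz: "r \<noteq> 0" "z1 \<noteq> 0" "z2 \<noteq> 0" using r1 assms by auto
  have inv: "cnj v = inverse v" if "cmod v = 1" for v :: complex
    using that complex_norm_square[of v] by (simp add: inverse_unique)
  have opp: "z2 / r = - cnj (z1 / r)"
  proof -
    have "cnj (z1 / r) = r / z1" using inv[of "z1 / r"] assms r1 by (simp add: norm_divide)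
    moreover have "z2 / r = - (r / z1)" using r2 nz by (simp add: field_simps power2_eq_square)
    ultimately show ?thesis by simp
  qed
  define \<sigma> where "\<sigma> = (if Re (z1 / r) < 0 then -1 else 1 :: complex)"
  define a where "a = \<sigma> * z1 / r"
  have \<sigma>: "\<sigma> = 1 \<or> \<sigma> = -1" by (simp add: \<sigma>_def)
  have a1: "cmod a = 1" using \<sigma> by (auto simp: a_def norm_mult norm_divide assms r1)
  have b: "\<sigma> * z2 / r = - cnj a" using opp \<sigma> by (auto simp: a_def)
  have "Re (z1 / r) \<noteq> 0"
  proof
    assume "Re (z1 / r) = 0"
    moreover have "- cnj v = v" if "Re v = 0" for v using that by (simp add: complex_eq_iff)
    ultimately have "- cnj (z1 / r) = z1 / r" by blast
    then show False using opp nz assms by simp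
  qed
  then have Re_a: "0 < Re a" by (auto simp: a_def \<sigma>_def)
  have a2: "Re a * Re a + Im a * Im a = 1" using a1 cmod_power2[of a] by (simp add: power2_eq_square)
  define t where "t = Im a / (1 + Re a)"
  define w where "w = \<i> * of_real t"
  have "t\<^sup>2 < 1"
  proof -
    have "Im a * Im a < (1 + Re a) * (1 + Re a)" using a2 Re_a mult_pos_pos[OF Re_a Re_a] unfolding distrib_left distrib_right by linarith
    then show ?thesis using Re_a by (simp add: t_def power_divide power2_eq_square divide_less_eq)
  qed
  then have w: "cmod w < 1" by (simp add: w_def norm_mult abs_square_less_1)
  have key: "a * (1 - w) = 1 + w"
  proof -
    have tt: "t * (1 + Re a) = Im a" using Re_a by (simp add: t_def)
    have "Im a * Im a = (1 - Re a) * (1 + Re a)" using a2 by (simp add: algebra_simps)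
    then have "(t * Im a) * (1 + Re a) = (1 - Re a) * (1 + Re a)" using tt by (metis mult.assoc mult.commute)
    then have "t * Im a = 1 - Re a" using Re_a by simp
    then show ?thesis using tt by (simp add: complex_eq_iff w_def algebra_simps)
  qed
  have cw: "cnj w = - w" by (simp add: w_def)
  have Ma: "(a - w) / (1 - cnj w * a) = 1"
  proof -
    have "a - w = 1 - cnj w * a" using key unfolding cw by (simp add: algebra_simps)
    moreover have "1 - cnj w * a \<noteq> 0" using Moebius_denominator_nonzero[OF w] a1 by simp
    ultimately show ?thesis by simp
  qed
  have Mb: "(- cnj a - w) / (1 - cnj w * (- cnj a)) = -1"
  proof -
    have "cnj a * (1 + w) = 1 - w" using arg_cong[OF key, of cnj] by (simp add: cw)
    then have "- cnj a - w = - (1 - cnj w * (- cnj a))" unfolding cw by (simp add: algebra_simps)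
    moreover have "1 - cnj w * (- cnj a) \<noteq> 0" using Moebius_denominator_nonzero[OF w, of "- cnj a"] a1 by simp
    ultimately show ?thesis by (simp add: divide_eq_minus_1_iff)
  qed
  have "cmod (\<sigma> / r) = 1" using \<sigma> r1 by (auto simp: norm_divide)
  then obtain \<theta> where \<theta>: "\<sigma> / r = cis \<theta>" by (metis rcis_cmod_Arg rcis_def mult_1 of_real_1)
  have rot: "Moebius_function \<theta> 0 z1 = a" "Moebius_function \<theta> 0 z2 = - cnj a"
    using b by (simp_all add: Moebius_rotation flip: \<theta>) (simp add: a_def)
  obtain \<psi> v where v: "cmod v < 1"
    "\<And>z. cmod z \<le> 1 \<Longrightarrow> Moebius_function 0 w (Moebius_function \<theta> 0 z) = Moebius_function \<psi> v z"
    using Moebius_compose[OF w, of 0] by (metis norm_zero zero_less_one)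
  have "Moebius_function \<psi> v z1 = 1" "Moebius_function \<psi> v z2 = -1"
    using v(2)[of z1] v(2)[of z2] assms Ma Mb rot by (simp_all add: Moebius_function_simple)
  then show ?thesis using that[OF v(1)] by blast
qed

text \<open>Two vertices, picked without regard to the cyclic order, are moved to 1 and -1; a real
  translation fixes these and gives the others opposite real parts. If the first two separate the
  others, the outcome is a pair of diameters (q' = - p'); if not, it is a trapezoid symmetric about
  the imaginary axis (q' = - cnj p'), which a second balancing turns into a rectangle.\<close>

lemma normal_form:
  assumes V: "ideal_vertices V"
  obtains c s where "0 < c" "0 < s" "c\<^sup>2 + s\<^sup>2 = 1" "isom_image V (quad_verts c s)"
proof -
  have cb: "W \<subseteq> cball 0 1" if "ideal_vertices W" for W using that by (auto simp: ideal_vertices_def)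
  note result = that
  \<comment> \<open>The normal form up to signs of the coordinates. Four distinct points rule out
    that \<open>a\<close> is real or purely imaginary.\<close>
  have final: thesis if W: "isom_image V {a, cnj a, - a, - cnj a}" for a
  proof -
    have "ideal_vertices {a, cnj a, - a, - cnj a}" using isom_image_ideal_vertices[OF W V] .
    then have a1: "cmod a = 1" and card: "card {a, cnj a, - a, - cnj a} = 4" by (auto simp: ideal_vertices_def)
    have "a \<noteq> cnj a" "a \<noteq> - cnj a"
    proof -
      have two: "card {a, b, - a, - b} \<le> 2" if "b = a \<or> b = - a" for b
      proof -
        have "{a, b, - a, - b} = {a, - a}" using that by auto
        then show ?thesis by (simp add: card_insert_if)
      qed
      have "\<not> (cnj a = a \<or> cnj a = - a)" using two[of "cnj a"] card by force
      then show "a \<noteq> cnj a" "a \<noteq> - cnj a" by (auto simp: complex_eq_iff)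
    qed
    then have ne: "Re a \<noteq> 0" "Im a \<noteq> 0" by (auto simp: complex_eq_iff)
    have "(\<bar>Re a\<bar>)\<^sup>2 + (\<bar>Im a\<bar>)\<^sup>2 = 1" using a1 cmod_power2[of a] by simp
    moreover have "{a, cnj a, - a, - cnj a} = quad_verts \<bar>Re a\<bar> \<bar>Im a\<bar>"
      by (cases "0 \<le> Re a"; cases "0 \<le> Im a") (auto simp: quad_verts_def complex_eq_iff)
    ultimately show thesis using W ne result[of "\<bar>Re a\<bar>" "\<bar>Im a\<bar>"] by simp
  qed
  obtain z1 z2 z3 z4 where z: "V = {z1, z2, z3, z4}" "z1 \<noteq> z2"
    using V unfolding ideal_vertices_def by (auto simp: card_Suc_eq eval_nat_numeral)
  have zn: "cmod z1 = 1" "cmod z2 = 1" using V z by (auto simp: ideal_vertices_def)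
  obtain \<theta> w where w: "cmod w < 1" "Moebius_function \<theta> w z1 = 1" "Moebius_function \<theta> w z2 = -1"
    using isom_to_diameter[OF zn z(2)] .
  define p where "p = Moebius_function \<theta> w z3"
  define q where "q = Moebius_function \<theta> w z4"
  have I1: "isom_image V {1, -1, p, q}"
    unfolding isom_image_def using w z by (intro exI[of _ \<theta>] exI[of _ w]) (simp add: p_def q_def)
  have "ideal_vertices {1, -1, p, q}" using isom_image_ideal_vertices[OF I1 V] .
  then have p: "cmod p = 1" "cmod q = 1" and card1: "card {1, -1, p, q} = 4" by (auto simp: ideal_vertices_def)
  have pq: "p \<noteq> 1" "p \<noteq> -1" "q \<noteq> 1" "q \<noteq> -1" using card1 by (auto simp: card_insert_if split: if_splits)
  obtain c where c: "\<bar>c\<bar> < 1" "Re (Moebius_function 0 (of_real c) q) = - Re (Moebius_function 0 (of_real c) p)"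
    using translation_balances[OF p(1) pq(1,2) p(2) pq(3,4)] .
  have cc: "cmod (of_real c) < 1" using c by simp
  define p' where "p' = Moebius_function 0 (of_real c) p"
  define q' where "q' = Moebius_function 0 (of_real c) q"
  have p': "cmod p' = 1" "cmod q' = 1" using cmod_Moebius_eq_1[OF cc] p by (auto simp: p'_def q'_def)
  have "1 - complex_of_real c \<noteq> 0" "1 + complex_of_real c \<noteq> 0"
    using c(1) by (auto simp: complex_eq_iff)
  then have fix1: "Moebius_function 0 (of_real c) 1 = 1" "Moebius_function 0 (of_real c) (-1) = -1"
    by (simp_all add: Moebius_function_simple divide_eq_minus_1_iff add.commute)
  have "isom_image {1, -1, p, q} {1, -1, p', q'}"
    unfolding isom_image_def using cc fix1
    by (intro exI[of _ 0] exI[of _ "of_real c"]) (simp add: p'_def q'_def)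
  then have I2: "isom_image V {1, -1, p', q'}" using isom_image_trans[OF I1 _ cb[OF V]] by blast
  have "ideal_vertices {1, -1, p', q'}" using isom_image_ideal_vertices[OF I2 V] .
  consider "q' = - p'" | "q' = - cnj p'"
    using unit_eq_Re_opposite[OF p'] c(2) by (auto simp: p'_def q'_def)
  then show thesis
  proof cases
    case 1
    \<comment> \<open>The vertices are the ends of the diameters through 1 and p'. Rotation by a
      square root of cnj p' makes the two diameters conjugate, since then l p' = cnj l.\<close>
    define l where "l = csqrt (cnj p')"
    have l2: "l\<^sup>2 = cnj p'" by (simp add: l_def)
    have l1: "cmod l = 1" by (simp add: l_def p')
    have "l * p' = cnj l"
    proof -
      have "l * p' = l * cnj (l\<^sup>2)" by (simp add: l2)
      also have "\<dots> = (l * cnj l) * cnj l" by (simp add: power2_eq_square)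
      also have "l * cnj l = 1" using complex_norm_square[of l] l1 by simp
      finally show ?thesis by simp
    qed
    then have "(*) l ` {1, -1, p', q'} = {l, cnj l, - l, - cnj l}" unfolding 1 by auto
    then have "isom_image {1, -1, p', q'} {l, cnj l, - l, - cnj l}" using isom_image_rotation[OF l1] by metis
    then show thesis using final isom_image_trans[OF I2 _ cb[OF V]] by blast
  next
    case 2
    \<comment> \<open>A quarter turn makes the real axis the axis of symmetry. Real translations
      commute with conjugation, so balancing \<i> against r balances the conjugate points
      too.\<close>
    define r where "r = - \<i> * p'"
    have r1: "cmod r = 1" by (simp add: r_def norm_mult p')
    have "(*) (- \<i>) ` {1, -1, p', q'} = {\<i>, cnj \<i>, r, cnj r}" unfolding 2 by (auto simp: r_def)
    moreover have "isom_image {1, -1, p', q'} ((*) (- \<i>) ` {1, -1, p', q'})" by (rule isom_image_rotation) simp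
    ultimately have I3: "isom_image V {\<i>, cnj \<i>, r, cnj r}" using isom_image_trans[OF I2 _ cb[OF V]] by simp
    have "card {\<i>, cnj \<i>, r, cnj r} = 4" using isom_image_ideal_vertices[OF I3 V] by (simp add: ideal_vertices_def)
    then have r: "r \<noteq> 1" "r \<noteq> -1" by (auto simp: card_insert_if split: if_splits)
    have i1: "cmod \<i> = 1" "\<i> \<noteq> 1" "\<i> \<noteq> - 1" by (auto simp: complex_eq_iff)
    obtain k where k: "\<bar>k\<bar> < 1" "Re (Moebius_function 0 (of_real k) r) = - Re (Moebius_function 0 (of_real k) \<i>)"
      using translation_balances[OF i1 r1 r] .
    have kk: "cmod (of_real k) < 1" using k by simp
    define a where "a = Moebius_function 0 (of_real k) \<i>"
    define b where "b = Moebius_function 0 (of_real k) r"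
    have cnj: "Moebius_function 0 (of_real k) (cnj z) = cnj (Moebius_function 0 (of_real k) z)" for z
      by (simp add: Moebius_function_simple)
    have ab: "cmod a = 1" "cmod b = 1" using cmod_Moebius_eq_1[OF kk] i1 r1 by (auto simp: a_def b_def)
    have "b = - a \<or> b = - cnj a" using unit_eq_Re_opposite[OF ab] k(2) by (simp add: a_def b_def)
    then have "Moebius_function 0 (of_real k) ` {\<i>, cnj \<i>, r, cnj r} = {a, cnj a, - a, - cnj a}"
      using cnj by (auto simp: a_def b_def simp del: complex_cnj_i)
    then have "isom_image {\<i>, cnj \<i>, r, cnj r} {a, cnj a, - a, - cnj a}"
      unfolding isom_image_def using kk by (intro exI[of _ 0] exI[of _ "of_real k"]) simp
    then show thesis using final isom_image_trans[OF I3 _ cb[OF V]] by blast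
  qed
qed

lemma isom_image_invariants:
  assumes "isom_image V W" "V \<subseteq> cball 0 1"
  shows "quad_modulus W = quad_modulus V" "quad_cross_ratio W = quad_cross_ratio V"
    and "conformal_onto_rectangle V m \<Longrightarrow> conformal_onto_rectangle W m"
  using assms quad_modulus_Moebius_image quad_cross_ratio_Moebius_image conformal_onto_rectangle_Moebius_image
  unfolding isom_image_def by metis+

section \<open>Existence and uniqueness of the modulus\<close>

text \<open>A rectangle taller than wide is turned by a right angle, which is what secures m >= 1;
  the corners are matched as a set.\<close>

lemma affine_onto_standard_rectangle:
  assumes pq: "Re p < Re q" "Im p < Im q"
  obtains a b m where "a \<noteq> 0" "1 \<le> m" "(\<lambda>z. a * z + b) ` box p q = box 0 (Complex m 1)"
    "(\<lambda>z. a * z + b) ` cbox p q = cbox 0 (Complex m 1)"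
    "(\<lambda>z. a * z + b) ` {p, Complex (Re q) (Im p), q, Complex (Re p) (Im q)} = {0, Complex m 0, Complex m 1, Complex 0 1}"
proof -
  have image_eq: "(\<lambda>z. a * z + b) ` S = T" if "a \<noteq> 0" "\<And>z. z \<in> S \<longleftrightarrow> a * z + b \<in> T" for a b :: complex and S T
  proof
    show "T \<subseteq> (\<lambda>z. a * z + b) ` S"
    proof
      fix w assume "w \<in> T"
      moreover have "a * ((w - b) / a) + b = w" using that(1) by simp
      ultimately show "w \<in> (\<lambda>z. a * z + b) ` S" using that(2)[of "(w - b) / a"] by (metis imageI)
    qed
  qed (use that(2) in auto)
  define w where "w = Re q - Re p"
  define h where "h = Im q - Im p"
  have wh: "0 < w" "0 < h" using pq by (auto simp: w_def h_def)
  show thesis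
  proof (cases "h \<le> w")
    case True
    let ?a = "complex_of_real (1 / h)" and ?b = "- p / of_real h" and ?m = "w / h"
    have re: "Re (?a * z + ?b) = (Re z - Re p) / h" "Im (?a * z + ?b) = (Im z - Im p) / h" for z
      using wh by (simp_all add: diff_divide_distrib Re_divide_of_real Im_divide_of_real)
    show thesis
    proof (rule that)
      show a: "?a \<noteq> 0" "1 \<le> ?m" using wh True by auto
      show "(\<lambda>z. ?a * z + ?b) ` box p q = box 0 (Complex ?m 1)"
        by (rule image_eq[OF a(1)]) (use wh in \<open>simp only: in_box_complex_iff re; simp add: divide_simps w_def h_def\<close>)
      show "(\<lambda>z. ?a * z + ?b) ` cbox p q = cbox 0 (Complex ?m 1)"
        by (rule image_eq[OF a(1)]) (use wh in \<open>simp only: in_cbox_complex_iff re; simp add: divide_simps w_def h_def\<close>)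
      have "?a * p + ?b = 0" "?a * Complex (Re q) (Im p) + ?b = Complex ?m 0"
        "?a * q + ?b = Complex ?m 1" "?a * Complex (Re p) (Im q) + ?b = Complex 0 1"
        using wh by (simp_all only: complex_eq_iff re) (simp_all add: w_def h_def)
      then show "(\<lambda>z. ?a * z + ?b) ` {p, Complex (Re q) (Im p), q, Complex (Re p) (Im q)}
          = {0, Complex ?m 0, Complex ?m 1, Complex 0 1}" by simp
    qed
  next
    case False
    let ?a = "\<i> * complex_of_real (1 / w)" and ?b = "(of_real h - \<i> * p) / of_real w" and ?m = "h / w"
    have re: "Re (?a * z + ?b) = (Im q - Im z) / w" "Im (?a * z + ?b) = (Re z - Re p) / w" for z
      using wh by (simp_all add: diff_divide_distrib Re_divide_of_real Im_divide_of_real h_def add_divide_distrib)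
    show thesis
    proof (rule that)
      show a: "?a \<noteq> 0" "1 \<le> ?m" using wh False by auto
      show "(\<lambda>z. ?a * z + ?b) ` box p q = box 0 (Complex ?m 1)"
        by (rule image_eq[OF a(1)]) (use wh in \<open>simp only: in_box_complex_iff re; auto simp add: divide_simps w_def h_def\<close>)
      show "(\<lambda>z. ?a * z + ?b) ` cbox p q = cbox 0 (Complex ?m 1)"
        by (rule image_eq[OF a(1)]) (use wh in \<open>simp only: in_cbox_complex_iff re; auto simp add: divide_simps w_def h_def\<close>)
      have "?a * p + ?b = Complex ?m 0" "?a * Complex (Re q) (Im p) + ?b = Complex ?m 1"
        "?a * q + ?b = Complex 0 1" "?a * Complex (Re p) (Im q) + ?b = 0"
        using wh by (simp_all only: complex_eq_iff re) (simp_all add: w_def h_def)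
      then show "(\<lambda>z. ?a * z + ?b) ` {p, Complex (Re q) (Im p), q, Complex (Re p) (Im q)}
          = {0, Complex ?m 0, Complex ?m 1, Complex 0 1}" by (simp add: insert_commute)
    qed
  qed
qed

section \<open>Existence of the modulus for the symmetric quadrilateral\<close>

lemma quad_verts_frontier:
  assumes cs: "0 < c" "0 < s" "c\<^sup>2 + s\<^sup>2 = 1" and v: "v \<in> quad_verts c s"
  shows "cmod v = 1" "v \<in> quad_cl c s - quad_dom c s"
proof -
  have v: "\<bar>Re v\<bar> = c" "\<bar>Im v\<bar> = s" using cs v by (auto simp: quad_verts_def)
  have "(cmod v)\<^sup>2 = \<bar>Re v\<bar>\<^sup>2 + \<bar>Im v\<bar>\<^sup>2" by (simp add: cmod_power2)
  then have "(cmod v)\<^sup>2 = 1" unfolding v using cs by simp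
  then show "cmod v = 1" using norm_ge_zero[of v] by (auto simp: power2_eq_1_iff)
  then show "v \<in> quad_cl c s - quad_dom c s" using v by (simp add: quad_cl_def quad_dom_def)
qed

lemma card_quad_verts: "0 < c \<Longrightarrow> 0 < s \<Longrightarrow> card (quad_verts c s) = 4"
  by (simp add: quad_verts_def card_insert_if complex_eq_iff)

text \<open>The Riemann map sends the vertices to four uncontrolled points of the circle. Applying
  \<open>normal_form\<close> to these image points yields a second isometry that moves them to the
  prevertices \<open>cis \<beta>\<close>, \<open>cis (- \<beta>)\<close> and their negatives, with
  \<beta> = arccos c'.\<close>

lemma modulus_exists_quad_verts:
  assumes cs: "0 < c" "0 < s" "c\<^sup>2 + s\<^sup>2 = 1"
  obtains m where "1 \<le> m" "conformal_onto_rectangle (quad_verts c s) m"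
proof -
  let ?I = "quad_dom c s" and ?C = "quad_cl c s" and ?V = "quad_verts c s"
  obtain F G where F: "homeomorphism ?C (cball 0 1) F G" "F holomorphic_on ?I" "inj_on F ?I" "F ` ?I = ball 0 1"
    using quad_to_disc[OF cs] .
  have injF: "inj_on F ?C" using F(1) by (metis homeomorphism_def inj_on_inverseI)
  have FC: "F ` ?C = cball 0 1" and contF: "continuous_on ?C F" using F(1) by (auto simp: homeomorphism_def)
  have IC: "?I \<subseteq> ?C" by (rule quad_dom_subset_quad_cl)
  have VC: "?V \<subseteq> ?C" using quad_verts_frontier(2)[OF cs] by auto
  have FV: "F ` ?V \<subseteq> sphere 0 1"
  proof
    fix w assume "w \<in> F ` ?V"
    then obtain v where v: "v \<in> ?V" "w = F v" by auto
    have "F v \<in> F ` ?C" using v VC by blast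
    then have "w \<in> cball 0 1" unfolding FC v(2)[symmetric] .
    moreover have "w \<notin> ball 0 1"
    proof
      assume "w \<in> ball 0 1"
      then have "w \<in> F ` ?I" unfolding F(4) .
      then obtain u where "u \<in> ?I" "w = F u" by blast
      then have "v = u" using v injF VC IC by (auto dest: inj_onD)
      then show False using \<open>u \<in> ?I\<close> quad_verts_frontier(2)[OF cs v(1)] by simp
    qed
    ultimately show "w \<in> sphere 0 1" by auto
  qed
  have "ideal_vertices (F ` ?V)"
    using FV card_image[OF inj_on_subset[OF injF VC]] card_quad_verts[OF cs(1,2)] by (simp add: ideal_vertices_def)
  then obtain c' s' where cs': "0 < c'" "0 < s'" "c'\<^sup>2 + s'\<^sup>2 = 1" "isom_image (F ` ?V) (quad_verts c' s')"
    by (rule normal_form)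
  obtain \<theta> w where w: "cmod w < 1" "quad_verts c' s' = Moebius_function \<theta> w ` F ` ?V"
    using cs'(4) unfolding isom_image_def by blast
  let ?A = "Moebius_function \<theta> w"
  have A_cball: "?A ` cball 0 1 = cball 0 1"
  proof
    show "?A ` cball 0 1 \<subseteq> cball 0 1" using cmod_Moebius(1)[OF w(1)] by auto
    have b: "cmod (- cis \<theta> * w) < 1" using w(1) by (simp add: norm_mult)
    have "Moebius_function (-\<theta>) (- cis \<theta> * w) ` cball 0 1 \<subseteq> cball 0 1" using cmod_Moebius(1)[OF b] by auto
    from image_mono[OF this, of ?A] show "cball 0 1 \<subseteq> ?A ` cball 0 1"
      using Moebius_image_image(2)[OF w(1), of "cball 0 1" \<theta>] by simp
  qed
  have A_ball: "?A ` ball 0 1 = ball 0 1"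
  proof
    show "?A ` ball 0 1 \<subseteq> ball 0 1" using cmod_Moebius(2)[OF w(1)] by auto
    have b: "cmod (- cis \<theta> * w) < 1" using w(1) by (simp add: norm_mult)
    have "Moebius_function (-\<theta>) (- cis \<theta> * w) ` ball 0 1 \<subseteq> ball 0 1" using cmod_Moebius(2)[OF b] by auto
    from image_mono[OF this, of ?A] show "ball 0 1 \<subseteq> ?A ` ball 0 1"
      using Moebius_image_image(2)[OF w(1), of "ball 0 1" \<theta>] by auto
  qed
  have "c' < 1" using cs' by (metis abs_of_pos abs_square_less_1 less_add_same_cancel1 zero_less_power)
  define \<beta> where "\<beta> = arccos c'"
  have \<beta>: "cos \<beta> = c'" "0 < \<beta>" "\<beta> < pi/2"
    using cs'(1) \<open>c' < 1\<close> arccos_lt_bounded[of c'] arccos_less_arccos[of 0 c'] by (auto simp: \<beta>_def)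
  have "(sin \<beta>)\<^sup>2 = s'\<^sup>2" using sin_squared_eq[of \<beta>] cs'(3) \<beta>(1) by simp
  moreover have "0 < sin \<beta>" using \<beta> by (intro sin_gt_zero) auto
  ultimately have sin: "sin \<beta> = s'" using cs'(2) by (simp add: power2_eq_iff)
  have verts: "{cis \<beta>, - cis (- \<beta>), - cis \<beta>, cis (- \<beta>)} = quad_verts c' s'"
  proof -
    have "cis \<beta> = Complex c' s'" "- cis (- \<beta>) = Complex (- c') s'" "- cis \<beta> = Complex (- c') (- s')"
      "cis (- \<beta>) = Complex c' (- s')"
      by (simp_all add: complex_eq_iff \<beta>(1) sin)
    then show ?thesis unfolding quad_verts_def by simp
  qed
  obtain H p q where H: "continuous_on (cball 0 1) H" "inj_on H (cball 0 1)" "H holomorphic_on ball 0 1"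
    "H ` ball 0 1 = box p q" "H ` cball 0 1 = cbox p q" "Re p < Re q" "Im p < Im q"
    "H ` quad_verts c' s' = {p, Complex (Re q) (Im p), q, Complex (Re p) (Im q)}"
    using disc_to_rectangle[OF \<beta>(2,3)] unfolding verts by metis
  obtain a b m where T: "a \<noteq> 0" "1 \<le> m" "(\<lambda>z. a * z + b) ` box p q = box 0 (Complex m 1)"
    "(\<lambda>z. a * z + b) ` cbox p q = cbox 0 (Complex m 1)"
    "(\<lambda>z. a * z + b) ` {p, Complex (Re q) (Im p), q, Complex (Re p) (Im q)} = {0, Complex m 0, Complex m 1, Complex 0 1}"
    using affine_onto_standard_rectangle[OF H(6,7)] by metis
  define f where "f z = a * H (?A (F z)) + b" for z
  have img: "f ` S = (\<lambda>z. a * z + b) ` H ` ?A ` F ` S" for S by (auto simp: f_def image_image)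
  have f_V: "f ` ?V = {0, Complex m 0, Complex m 1, Complex 0 1}" unfolding img w(2)[symmetric] H(8) T(5) ..
  have f_I: "f ` ?I = box 0 (Complex m 1)" unfolding img F(4) A_ball H(4) T(3) ..
  have f_C: "f ` ?C = cbox 0 (Complex m 1)" unfolding img FC A_cball H(5) T(4) ..
  have contAF: "continuous_on ?C (\<lambda>z. ?A (F z))"
    by (rule continuous_on_compose2[OF continuous_on_Moebius[OF w(1)] contF]) (simp add: FC)
  have "continuous_on ?C (\<lambda>z. H (?A (F z)))"
    by (rule continuous_on_compose2[OF H(1) contAF]) (use FC A_cball in blast)
  then have cont_f: "continuous_on ?C f" unfolding f_def by (intro continuous_intros)
  have inj_f: "inj_on f ?C"
  proof (rule inj_onI)
    fix x y assume xy: "x \<in> ?C" "y \<in> ?C" "f x = f y"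
    then have "F x \<in> F ` ?C" "F y \<in> F ` ?C" by blast+
    then have Fc: "F x \<in> cball 0 1" "F y \<in> cball 0 1" unfolding FC .
    then have "?A (F x) \<in> cball 0 1" "?A (F y) \<in> cball 0 1" using A_cball by blast+
    moreover have "H (?A (F x)) = H (?A (F y))" using xy(3) T(1) by (simp add: f_def)
    ultimately have "?A (F x) = ?A (F y)" using H(2) by (auto dest: inj_onD)
    then have "F x = F y" by (rule inj_onD[OF inj_on_Moebius[OF w(1)] _ Fc])
    then show "x = y" using injF xy by (auto dest: inj_onD)
  qed
  have hol_f: "f holomorphic_on ?I"
  proof -
    have "?A \<circ> F holomorphic_on ?I"
      by (rule holomorphic_on_compose_gen[OF F(2) Moebius_function_holomorphic[OF w(1)]]) (simp add: F(4))
    then have "H \<circ> (?A \<circ> F) holomorphic_on ?I"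
      by (rule holomorphic_on_compose_gen[OF _ H(3)]) (simp add: F(4) A_ball flip: image_image)
    then show ?thesis unfolding f_def[abs_def] by (intro holomorphic_intros) (simp add: o_def)
  qed
  have "?C \<subseteq> cball 0 1" by (auto simp: quad_cl_def)
  then have "compact ?C" using closed_quad_cl by (meson bounded_cball bounded_subset compact_eq_bounded_closed)
  then obtain g where g: "homeomorphism ?C (cbox 0 (Complex m 1)) f g"
    using homeomorphism_compact[OF _ cont_f f_C inj_f] by metis
  have "conformal_onto_rectangle ?V m"
    unfolding conformal_onto_rectangle_def interior_ideal_quad[OF cs] closure_quad_dom[OF cs(1,2)]
    using hol_f inj_on_subset[OF inj_f IC] f_I g f_V by blast
  then show thesis using that T(2) by blast
qed

text \<open>The slices end on the frontier, where \<open>h\<close> is only continuous and its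
  increment is known. Shortening a slice at both ends costs at most \<delta> of the increment, and
  \<delta> then tends to 0 in the resulting inequality. The area is that of the rectangle,
  m.\<close>

lemma length_area_separation:
  fixes h :: "complex \<Rightarrow> complex"
  assumes "open U" and holo: "h holomorphic_on U" and inj: "inj_on h U" and sub: "h ` U \<subseteq> cbox 0 (Complex m 1)"
    and U: "\<And>z. z \<in> U \<Longrightarrow> a < Re z \<and> Re z < b \<and> c < Im z \<and> Im z < d"
    and "a < b" and "0 < L" and cont: "continuous_on K h"
    and slice: "\<And>x. a < x \<Longrightarrow> x < b \<Longrightarrow> \<exists>y1 y2. y1 < y2 \<and> (\<forall>y\<in>{y1<..<y2}. Complex x y \<in> U) \<and>
                   (\<forall>y\<in>{y1..y2}. Complex x y \<in> K) \<and> L \<le> cmod (h (Complex x y2) - h (Complex x y1))"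
  shows "(b - a) * L\<^sup>2 \<le> (d - c) * m"
proof -
  have bound: "(b - a) * (L - \<delta>)\<^sup>2 \<le> (d - c) * m" if \<delta>: "0 < \<delta>" "\<delta> < L" for \<delta>
  proof -
    have "(b - a) * (L - \<delta>)\<^sup>2 \<le> (d - c) * ((Re (Complex m 1) - Re 0) * (Im (Complex m 1) - Im 0))"
    proof (rule length_area[OF \<open>open U\<close> holo inj sub U \<open>a < b\<close>])
      fix x assume "a < x" "x < b"
      then obtain y1 y2 where y: "y1 < y2" "\<And>y. y \<in> {y1<..<y2} \<Longrightarrow> Complex x y \<in> U"
        "\<And>y. y \<in> {y1..y2} \<Longrightarrow> Complex x y \<in> K" "L \<le> cmod (h (Complex x y2) - h (Complex x y1))"
        using slice by meson
      have c1: "continuous_on {y1..y2} (\<lambda>y. h (Complex x y))"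
        by (rule continuous_on_compose2[OF cont]) (use y(3) in \<open>auto simp: Complex_eq intro!: continuous_intros\<close>)
      obtain d1 where d1: "d1 > 0" "\<And>y. y \<in> {y1..y2} \<Longrightarrow> dist y y1 < d1 \<Longrightarrow> dist (h (Complex x y)) (h (Complex x y1)) < \<delta>/2"
        using c1 y(1) \<delta>(1) unfolding continuous_on_iff by (metis atLeastAtMost_iff half_gt_zero less_imp_le order_refl)
      obtain d2 where d2: "d2 > 0" "\<And>y. y \<in> {y1..y2} \<Longrightarrow> dist y y2 < d2 \<Longrightarrow> dist (h (Complex x y)) (h (Complex x y2)) < \<delta>/2"
        using c1 y(1) \<delta>(1) unfolding continuous_on_iff by (metis atLeastAtMost_iff half_gt_zero less_imp_le order_refl)
      \<comment> \<open>The last bound keeps the shortened slice nonempty.\<close>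
      define e where "e = min (min (d1/2) (d2/2)) ((y2 - y1)/2)"
      have "e \<le> (y2 - y1)/2" unfolding e_def by (rule min.cobounded2)
      then have e2: "2 * e \<le> y2 - y1" by (simp add: field_simps)
      have "e \<le> min (d1/2) (d2/2)" unfolding e_def by (rule min.cobounded1)
      then have "e \<le> d1/2" "e \<le> d2/2" by auto
      moreover have "0 < e" using d1(1) d2(1) y(1) by (simp add: e_def)
      ultimately have e: "0 < e" "e < d1" "e < d2" "2 * e \<le> y2 - y1" using d1(1) d2(1) e2 by auto
      define u1 where "u1 = y1 + e"
      define u2 where "u2 = y2 - e"
      have u: "y1 < u1" "u1 \<le> u2" "u2 < y2" using e by (auto simp: u1_def u2_def)
      have "dist (h (Complex x u1)) (h (Complex x y1)) < \<delta>/2" using u e by (intro d1(2)) (auto simp: u1_def dist_real_def)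
      moreover have "dist (h (Complex x u2)) (h (Complex x y2)) < \<delta>/2" using u e by (intro d2(2)) (auto simp: u2_def dist_real_def)
      moreover have "dist (h (Complex x y2)) (h (Complex x y1)) \<le> dist (h (Complex x u2)) (h (Complex x y2))
          + dist (h (Complex x u2)) (h (Complex x u1)) + dist (h (Complex x u1)) (h (Complex x y1))"
        using dist_triangle[of "h (Complex x y2)" "h (Complex x y1)" "h (Complex x u2)"]
          dist_triangle[of "h (Complex x u2)" "h (Complex x y1)" "h (Complex x u1)"]
        by (simp add: dist_commute)
      ultimately have "L - \<delta> \<le> cmod (h (Complex x u2) - h (Complex x u1))" using y(4) by (simp add: dist_norm)
      then show "\<exists>y1 y2. y1 \<le> y2 \<and> (\<forall>y\<in>{y1..y2}. Complex x y \<in> U) \<and> L - \<delta> \<le> cmod (h (Complex x y2) - h (Complex x y1))"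
        using u y(2) by (intro exI[of _ u1] exI[of _ u2]) auto
    qed (use \<delta> in auto)
    then show ?thesis by simp
  qed
  have "((\<lambda>\<delta>. (b - a) * (L - \<delta>)\<^sup>2) \<longlongrightarrow> (b - a) * (L - 0)\<^sup>2) (at_right 0)"
    by (intro tendsto_intros)
  moreover have "eventually (\<lambda>\<delta>. (b - a) * (L - \<delta>)\<^sup>2 \<le> (d - c) * m) (at_right 0)"
    using eventually_at_right_real[OF \<open>0 < L\<close>] by eventually_elim (use bound in auto)
  ultimately have "(b - a) * (L - 0)\<^sup>2 \<le> (d - c) * m"
    by (intro tendsto_upperbound) auto
  then show ?thesis by simp
qed

text \<open>Precomposing with multiplication by -\<i> turns horizontal slices into vertical
  ones.\<close>

lemma length_area_separation_horizontal:
  fixes h :: "complex \<Rightarrow> complex"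
  assumes "open U" and holo: "h holomorphic_on U" and inj: "inj_on h U" and sub: "h ` U \<subseteq> cbox 0 (Complex m 1)"
    and U: "\<And>z. z \<in> U \<Longrightarrow> a < Re z \<and> Re z < b \<and> c < Im z \<and> Im z < d"
    and "c < d" and "0 < L" and cont: "continuous_on K h"
    and slice: "\<And>y. c < y \<Longrightarrow> y < d \<Longrightarrow> \<exists>x1 x2. x1 < x2 \<and> (\<forall>x\<in>{x1<..<x2}. Complex x y \<in> U) \<and>
                   (\<forall>x\<in>{x1..x2}. Complex x y \<in> K) \<and> L \<le> cmod (h (Complex x2 y) - h (Complex x1 y))"
  shows "(d - c) * L\<^sup>2 \<le> (b - a) * m"
proof -
  define \<rho> where "\<rho> z = - \<i> * z" for z
  have \<rho>: "\<rho> (Complex x y) = Complex y (- x)" for x y by (simp add: \<rho>_def complex_eq_iff)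
  have cont\<rho>: "continuous_on A \<rho>" for A unfolding \<rho>_def by (intro continuous_intros)
  have "(- c - (- d)) * L\<^sup>2 \<le> (b - a) * m"
  proof (rule length_area_separation[of "\<rho> -` U" "h \<circ> \<rho>" m "- d" "- c" a b L "\<rho> -` K"])
    show "open (\<rho> -` U)"
      using continuous_open_preimage[OF cont\<rho>[of UNIV] open_UNIV \<open>open U\<close>] by simp
    show "h \<circ> \<rho> holomorphic_on \<rho> -` U"
    proof (rule holomorphic_on_compose_gen[OF _ holo])
      show "\<rho> holomorphic_on \<rho> -` U" unfolding \<rho>_def by (intro holomorphic_intros)
    qed auto
    have "inj_on \<rho> (\<rho> -` U)" by (auto simp: \<rho>_def inj_on_def)
    moreover have "inj_on h (\<rho> ` \<rho> -` U)" using inj by (rule inj_on_subset) auto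
    ultimately show "inj_on (h \<circ> \<rho>) (\<rho> -` U)" by (rule comp_inj_on)
    show "(h \<circ> \<rho>) ` \<rho> -` U \<subseteq> cbox 0 (Complex m 1)"
    proof (rule image_subsetI)
      fix z assume "z \<in> \<rho> -` U"
      then have "h (\<rho> z) \<in> h ` U" by auto
      then show "(h \<circ> \<rho>) z \<in> cbox 0 (Complex m 1)" using sub by auto
    qed
    show "- d < Re z \<and> Re z < - c \<and> a < Im z \<and> Im z < b" if "z \<in> \<rho> -` U" for z
      using U[of "\<rho> z"] that by (auto simp: \<rho>_def)
    show "continuous_on (\<rho> -` K) (h \<circ> \<rho>)"
      by (rule continuous_on_compose[OF cont\<rho> continuous_on_subset[OF cont]]) auto
    fix x assume "- d < x" "x < - c"
    then obtain x1 x2 where x: "x1 < x2" "\<forall>t\<in>{x1<..<x2}. Complex t (- x) \<in> U"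
       "\<forall>t\<in>{x1..x2}. Complex t (- x) \<in> K" "L \<le> cmod (h (Complex x2 (- x)) - h (Complex x1 (- x)))"
      using slice[of "- x"] by auto
    then show "\<exists>y1 y2. y1 < y2 \<and> (\<forall>y\<in>{y1<..<y2}. Complex x y \<in> \<rho> -` U) \<and>
                   (\<forall>y\<in>{y1..y2}. Complex x y \<in> \<rho> -` K) \<and> L \<le> cmod ((h \<circ> \<rho>) (Complex x y2) - (h \<circ> \<rho>) (Complex x y1))"
      by (intro exI[of _ x1] exI[of _ x2]) (simp add: \<rho>)
  qed (use \<open>c < d\<close> \<open>0 < L\<close> in auto)
  then show ?thesis by simp
qed

text \<open>Without its corners the boundary of the rectangle falls into four sides that are open in
  it, so a connected path stays in one of them. The ends of the path, which may be corners, are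
  reached by continuity. Which side it is does not matter later, only the coordinate that is
  constant.\<close>

lemma path_in_one_side:
  fixes \<sigma> :: "real \<Rightarrow> complex"
  assumes "0 < m" and cont: "continuous_on {-1..1} \<sigma>"
    and bd: "\<And>t. t \<in> {-1<..<1} \<Longrightarrow> \<sigma> t \<in> cbox 0 (Complex m 1) - box 0 (Complex m 1) - {0, Complex m 0, Complex m 1, Complex 0 1}"
  shows "(\<forall>t\<in>{-1..1}. Re (\<sigma> t) = Re (\<sigma> 0)) \<or> (\<forall>t\<in>{-1..1}. Im (\<sigma> t) = Im (\<sigma> 0))"
proof -
  let ?J = "{-1<..<1::real}"
  have b: "0 \<le> Re (\<sigma> t)" "Re (\<sigma> t) \<le> m" "0 \<le> Im (\<sigma> t)" "Im (\<sigma> t) \<le> 1"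
     "Re (\<sigma> t) = 0 \<or> Re (\<sigma> t) = m \<or> Im (\<sigma> t) = 0 \<or> Im (\<sigma> t) = 1"
     "Re (\<sigma> t) = 0 \<or> Re (\<sigma> t) = m \<Longrightarrow> 0 < Im (\<sigma> t) \<and> Im (\<sigma> t) < 1"
    if "t \<in> ?J" for t
    using bd[OF that] by (force simp: in_box_complex_iff in_cbox_complex_iff complex_eq_iff)+
  have b7: "0 < Re (\<sigma> t) \<and> Re (\<sigma> t) < m" if "t \<in> ?J" "Im (\<sigma> t) = 0 \<or> Im (\<sigma> t) = 1" for t
  proof -
    have "\<not> (Re (\<sigma> t) = 0 \<or> Re (\<sigma> t) = m)" using b(6)[OF that(1)] that(2) by auto
    then show ?thesis using b(1,2)[OF that(1)] by linarith
  qed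
  have contJ: "continuous_on ?J \<sigma>" using cont by (rule continuous_on_subset) auto
  have conn: "connected ?J" by simp
  have all: "\<forall>t\<in>?J. Q t" if Q: "\<And>t. t \<in> ?J \<Longrightarrow> Q t \<longleftrightarrow> t \<in> A" "\<And>t. t \<in> ?J \<Longrightarrow> \<not> Q t \<longleftrightarrow> t \<in> B" "openin (top_of_set ?J) (?J \<inter> A)"
    "openin (top_of_set ?J) (?J \<inter> B)" "Q 0" for Q A B
  proof (rule ccontr)
    assume "\<not> ?thesis"
    then have "?J \<inter> B \<noteq> {}" using Q(2) by blast
    moreover have "0 \<in> ?J \<inter> A" using Q(1,5) by auto
    moreover have "?J \<subseteq> (?J \<inter> A) \<union> (?J \<inter> B)" using Q(1,2) by blast
    moreover have "(?J \<inter> A) \<inter> (?J \<inter> B) = {}" using Q(1,2) by blast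
    ultimately show False using conn Q(3,4) unfolding connected_openin by blast
  qed
  have preim: "openin (top_of_set ?J) (?J \<inter> \<sigma> -` S)" if "open S" for S
    using contJ that by (rule continuous_openin_preimage_gen)
  have openRe: "open {z. Re z < k}" "open {z. k < Re z}" "open {z. Im z < k}" "open {z. k < Im z}" for k
    by (rule open_halfspace_Re_lt open_halfspace_Re_gt open_halfspace_Im_lt open_halfspace_Im_gt)+
  have extend: "\<forall>t\<in>{-1..1}. F (\<sigma> t) = k" if "\<forall>t\<in>?J. F (\<sigma> t) = k" "continuous_on UNIV F" for F :: "complex \<Rightarrow> real" and k
  proof
    fix t :: real assume t: "t \<in> {-1..1}"
    have cl: "closure ?J = {-1..1}" by simp
    have "continuous_on (closure ?J) (\<lambda>t. F (\<sigma> t))"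
      unfolding cl by (rule continuous_on_compose2[OF that(2) cont]) auto
    from continuous_constant_on_closure[OF this, of k t] show "F (\<sigma> t) = k" using that(1) t cl by auto
  qed
  have contRI: "continuous_on UNIV Re" "continuous_on UNIV Im" by (intro continuous_intros)+
  have J0: "(0::real) \<in> ?J" by simp
  have openne: "open {z. F z \<noteq> k}" if "continuous_on UNIV F" for F :: "complex \<Rightarrow> real" and k
  proof -
    have "open (F -` (- {k}))" using continuous_open_preimage[OF that open_UNIV, of "- {k}"] by (simp add: open_Compl)
    moreover have "F -` (- {k}) = {z. F z \<noteq> k}" by auto
    ultimately show ?thesis by simp
  qed
  consider "Re (\<sigma> 0) = 0" | "Re (\<sigma> 0) = m" | "Im (\<sigma> 0) = 0" | "Im (\<sigma> 0) = 1"
    using b(5)[OF J0] by blast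
  then show ?thesis
  proof cases
    case 1
    \<comment> \<open>On the boundary minus the corners both Re z = 0 and its negation are open
      conditions, the former because no other side contains points with 0 < Im z < 1 and Re z <
      m.\<close>
    have "\<forall>t\<in>?J. Re (\<sigma> t) = 0"
    proof (rule all[where A = "\<sigma> -` ({z. 0 < Im z} \<inter> {z. Im z < 1} \<inter> {z. Re z < m})" and B = "\<sigma> -` {z. Re z \<noteq> 0}"])
      show "openin (top_of_set ?J) (?J \<inter> \<sigma> -` ({z. 0 < Im z} \<inter> {z. Im z < 1} \<inter> {z. Re z < m}))"
        by (intro preim open_Int openRe)
      show "openin (top_of_set ?J) (?J \<inter> \<sigma> -` {z. Re z \<noteq> 0})" by (intro preim openne contRI)
      fix t assume t: "t \<in> ?J"
      show "Re (\<sigma> t) = 0 \<longleftrightarrow> t \<in> \<sigma> -` ({z. 0 < Im z} \<inter> {z. Im z < 1} \<inter> {z. Re z < m})"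
        using b(5,6)[OF t] \<open>0 < m\<close> by auto
    qed (use 1 in auto)
    from extend[OF this contRI(1)] show ?thesis unfolding 1 by blast
  next
    case 2
    have "\<forall>t\<in>?J. Re (\<sigma> t) = m"
    proof (rule all[where A = "\<sigma> -` ({z. 0 < Im z} \<inter> {z. Im z < 1} \<inter> {z. 0 < Re z})" and B = "\<sigma> -` {z. Re z \<noteq> m}"])
      show "openin (top_of_set ?J) (?J \<inter> \<sigma> -` ({z. 0 < Im z} \<inter> {z. Im z < 1} \<inter> {z. 0 < Re z}))"
        by (intro preim open_Int openRe)
      show "openin (top_of_set ?J) (?J \<inter> \<sigma> -` {z. Re z \<noteq> m})" by (intro preim openne contRI)
      fix t assume t: "t \<in> ?J"
      show "Re (\<sigma> t) = m \<longleftrightarrow> t \<in> \<sigma> -` ({z. 0 < Im z} \<inter> {z. Im z < 1} \<inter> {z. 0 < Re z})"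
        using b(5,6)[OF t] \<open>0 < m\<close> by auto
    qed (use 2 in auto)
    from extend[OF this contRI(1)] show ?thesis unfolding 2 by blast
  next
    case 3
    have "\<forall>t\<in>?J. Im (\<sigma> t) = 0"
    proof (rule all[where A = "\<sigma> -` ({z. 0 < Re z} \<inter> {z. Re z < m} \<inter> {z. Im z < 1})" and B = "\<sigma> -` {z. Im z \<noteq> 0}"])
      show "openin (top_of_set ?J) (?J \<inter> \<sigma> -` ({z. 0 < Re z} \<inter> {z. Re z < m} \<inter> {z. Im z < 1}))"
        by (intro preim open_Int openRe)
      show "openin (top_of_set ?J) (?J \<inter> \<sigma> -` {z. Im z \<noteq> 0})" by (intro preim openne contRI)
      fix t assume t: "t \<in> ?J"
      show "Im (\<sigma> t) = 0 \<longleftrightarrow> t \<in> \<sigma> -` ({z. 0 < Re z} \<inter> {z. Re z < m} \<inter> {z. Im z < 1})"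
        using b(5)[OF t] b7[OF t] by auto
    qed (use 3 in auto)
    from extend[OF this contRI(2)] show ?thesis unfolding 3 by blast
  next
    case 4
    have "\<forall>t\<in>?J. Im (\<sigma> t) = 1"
    proof (rule all[where A = "\<sigma> -` ({z. 0 < Re z} \<inter> {z. Re z < m} \<inter> {z. 0 < Im z})" and B = "\<sigma> -` {z. Im z \<noteq> 1}"])
      show "openin (top_of_set ?J) (?J \<inter> \<sigma> -` ({z. 0 < Re z} \<inter> {z. Re z < m} \<inter> {z. 0 < Im z}))"
        by (intro preim open_Int openRe)
      show "openin (top_of_set ?J) (?J \<inter> \<sigma> -` {z. Im z \<noteq> 1})" by (intro preim openne contRI)
      fix t assume t: "t \<in> ?J"
      show "Im (\<sigma> t) = 1 \<longleftrightarrow> t \<in> \<sigma> -` ({z. 0 < Re z} \<inter> {z. Re z < m} \<inter> {z. 0 < Im z})"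
        using b(5)[OF t] b7[OF t] by auto
    qed (use 4 in auto)
    from extend[OF this contRI(2)] show ?thesis unfolding 4 by blast
  qed
qed

text \<open>Corner j has coordinates r_j and i_j; (x_k, y_k) is a point of the k-th side, known to
  share one constant coordinate with both ends of that side. If the first side is vertical,
  distinctness of the corners forces the sides to alternate in direction. Real coordinates are used
  so that the two axes can be exchanged.\<close>

lemma four_corners_opposite:
  fixes m n :: real
  assumes mn: "0 < m" "0 < n"
    and a: "(x1 = r1 \<and> r1 = r4) \<or> (y1 = i1 \<and> i1 = i4)" "(x2 = r1 \<and> r1 = r2) \<or> (y2 = i1 \<and> i1 = i2)"
      "(x3 = r2 \<and> r2 = r3) \<or> (y3 = i2 \<and> i2 = i3)" "(x4 = r4 \<and> r4 = r3) \<or> (y4 = i4 \<and> i4 = i3)"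
    and r: "r1 = 0 \<or> r1 = m" "r2 = 0 \<or> r2 = m"
    and i: "i1 = 0 \<or> i1 = n" "i2 = 0 \<or> i2 = n" "i3 = 0 \<or> i3 = n" "i4 = 0 \<or> i4 = n"
    and d: "\<not> (r1 = r2 \<and> i1 = i2)" "\<not> (r1 = r3 \<and> i1 = i3)" "\<not> (r1 = r4 \<and> i1 = i4)"
      "\<not> (r2 = r4 \<and> i2 = i4)" "\<not> (r3 = r4 \<and> i3 = i4)"
    and eq: "r1 = r4"
  shows "\<bar>x1 - x3\<bar> = m \<and> \<bar>y2 - y4\<bar> = n"
proof -
  have i14: "i1 \<noteq> i4" using d(3) eq by blast
  then have x1: "x1 = r1" using a(1) by blast
  have "r1 \<noteq> r2"
  proof
    assume "r1 = r2"
    then have "i1 \<noteq> i2" "i2 \<noteq> i4" using d(1,4) eq by auto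
    then show False using i(1,2,4) i14 by metis
  qed
  then have y2: "y2 = i1" "i1 = i2" using a(2) by auto
  have "r4 \<noteq> r3"
  proof
    assume "r4 = r3"
    then have "i1 \<noteq> i3" "i3 \<noteq> i4" using d(2,5) eq by auto
    then show False using i(1,3,4) i14 by metis
  qed
  then have y4: "y4 = i4" "i4 = i3" using a(4) by auto
  have x3: "x3 = r2" using a(3) y2 y4 i14 by auto
  have "\<bar>r1 - r2\<bar> = m" using r \<open>r1 \<noteq> r2\<close> mn by auto
  moreover have "\<bar>i1 - i4\<bar> = n" using i(1,4) i14 mn by auto
  ultimately show ?thesis using x1 x3 y2 y4 by simp
qed

text \<open>The paths are images of the right, top, left and bottom side, and v1, ..., v4 are the
  images of the corners, counterclockwise from the upper right one. Re v1 = Re v4 means that the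
  right side is mapped to a vertical side; only the resulting distances between opposite sides
  matter.\<close>

lemma opposite_sides:
  fixes \<sigma>1 \<sigma>2 \<sigma>3 \<sigma>4 :: "real \<Rightarrow> complex"
  assumes m: "0 < m"
    and cont: "\<And>\<sigma>. \<sigma> \<in> {\<sigma>1, \<sigma>2, \<sigma>3, \<sigma>4} \<Longrightarrow> continuous_on {-1..1} \<sigma>"
    and bd: "\<And>\<sigma> t. \<sigma> \<in> {\<sigma>1, \<sigma>2, \<sigma>3, \<sigma>4} \<Longrightarrow> t \<in> {-1<..<1} \<Longrightarrow>
        \<sigma> t \<in> cbox 0 (Complex m 1) - box 0 (Complex m 1) - {0, Complex m 0, Complex m 1, Complex 0 1}"
    and joins: "\<sigma>1 1 = v1" "\<sigma>1 (-1) = v4" "\<sigma>2 1 = v1" "\<sigma>2 (-1) = v2" "\<sigma>3 1 = v2" "\<sigma>3 (-1) = v3"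
        "\<sigma>4 1 = v4" "\<sigma>4 (-1) = v3"
    and corners: "{v1, v2, v3, v4} \<subseteq> {0, Complex m 0, Complex m 1, Complex 0 1}"
    and dist: "v1 \<noteq> v2" "v1 \<noteq> v3" "v1 \<noteq> v4" "v2 \<noteq> v3" "v2 \<noteq> v4" "v3 \<noteq> v4"
    and t: "t \<in> {-1..1}" "t' \<in> {-1..1}"
  shows "(Re v1 = Re v4 \<longrightarrow> \<bar>Re (\<sigma>1 t) - Re (\<sigma>3 t')\<bar> = m \<and> \<bar>Im (\<sigma>2 t) - Im (\<sigma>4 t')\<bar> = 1)"
    and "(Re v1 \<noteq> Re v4 \<longrightarrow> \<bar>Im (\<sigma>1 t) - Im (\<sigma>3 t')\<bar> = 1 \<and> \<bar>Re (\<sigma>2 t) - Re (\<sigma>4 t')\<bar> = m)"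
proof -
  have const: "(\<forall>x\<in>{-1..1}. Re (\<sigma> x) = Re (\<sigma> 1) \<and> Re (\<sigma> x) = Re (\<sigma> (-1)))
       \<or> (\<forall>x\<in>{-1..1}. Im (\<sigma> x) = Im (\<sigma> 1) \<and> Im (\<sigma> x) = Im (\<sigma> (-1)))"
    if "\<sigma> \<in> {\<sigma>1, \<sigma>2, \<sigma>3, \<sigma>4}" for \<sigma>
    using path_in_one_side[OF m cont[OF that] bd[OF that]]
  proof (rule disj_forward)
    assume h: "\<forall>t\<in>{-1..1}. Re (\<sigma> t) = Re (\<sigma> 0)"
    have e: "Re (\<sigma> 1) = Re (\<sigma> 0)" "Re (\<sigma> (-1)) = Re (\<sigma> 0)"
      by (rule bspec[OF h], simp)+
    show "\<forall>x\<in>{-1..1}. Re (\<sigma> x) = Re (\<sigma> 1) \<and> Re (\<sigma> x) = Re (\<sigma> (-1))"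
      unfolding e using h by blast
  next
    assume h: "\<forall>t\<in>{-1..1}. Im (\<sigma> t) = Im (\<sigma> 0)"
    have e: "Im (\<sigma> 1) = Im (\<sigma> 0)" "Im (\<sigma> (-1)) = Im (\<sigma> 0)"
      by (rule bspec[OF h], simp)+
    show "\<forall>x\<in>{-1..1}. Im (\<sigma> x) = Im (\<sigma> 1) \<and> Im (\<sigma> x) = Im (\<sigma> (-1))"
      unfolding e using h by blast
  qed
  have coord: "(Re v = 0 \<or> Re v = m) \<and> (Im v = 0 \<or> Im v = 1)" if "v \<in> {v1, v2, v3, v4}" for v
    using subsetD[OF corners that] by auto
  note cd = coord[of v1] coord[of v2] coord[of v3] coord[of v4]
  have s1: "(\<forall>x\<in>{-1..1}. Re (\<sigma>1 x) = Re v1 \<and> Re (\<sigma>1 x) = Re v4) \<or> (\<forall>x\<in>{-1..1}. Im (\<sigma>1 x) = Im v1 \<and> Im (\<sigma>1 x) = Im v4)"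
    using const[of \<sigma>1, unfolded joins] by blast
  have s2: "(\<forall>x\<in>{-1..1}. Re (\<sigma>2 x) = Re v1 \<and> Re (\<sigma>2 x) = Re v2) \<or> (\<forall>x\<in>{-1..1}. Im (\<sigma>2 x) = Im v1 \<and> Im (\<sigma>2 x) = Im v2)"
    using const[of \<sigma>2, unfolded joins] by blast
  have s3: "(\<forall>x\<in>{-1..1}. Re (\<sigma>3 x) = Re v2 \<and> Re (\<sigma>3 x) = Re v3) \<or> (\<forall>x\<in>{-1..1}. Im (\<sigma>3 x) = Im v2 \<and> Im (\<sigma>3 x) = Im v3)"
    using const[of \<sigma>3, unfolded joins] by blast
  have s4: "(\<forall>x\<in>{-1..1}. Re (\<sigma>4 x) = Re v4 \<and> Re (\<sigma>4 x) = Re v3) \<or> (\<forall>x\<in>{-1..1}. Im (\<sigma>4 x) = Im v4 \<and> Im (\<sigma>4 x) = Im v3)"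
    using const[of \<sigma>4, unfolded joins] by blast
  have ne: "\<not> (Re v = Re w \<and> Im v = Im w)" if "v \<noteq> w" for v w using that by (auto simp: complex_eq_iff)
  note d = ne[OF dist(1)] ne[OF dist(2)] ne[OF dist(3)] ne[OF dist(4)] ne[OF dist(5)] ne[OF dist(6)]
  have pick: "(Re (\<sigma> x) = Re v \<and> Re v = Re w) \<or> (Im (\<sigma> x) = Im v \<and> Im v = Im w)"
    if "(\<forall>x\<in>{-1..1}. Re (\<sigma> x) = Re v \<and> Re (\<sigma> x) = Re w) \<or> (\<forall>x\<in>{-1..1}. Im (\<sigma> x) = Im v \<and> Im (\<sigma> x) = Im w)"
      "x \<in> {-1..1}" for \<sigma> :: "real \<Rightarrow> complex" and v w x
    using that by metis
  note a = pick[OF s1 t(1)] pick[OF s2 t(1)] pick[OF s3 t(2)] pick[OF s4 t(2)]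
  have "\<bar>Re (\<sigma>1 t) - Re (\<sigma>3 t')\<bar> = m \<and> \<bar>Im (\<sigma>2 t) - Im (\<sigma>4 t')\<bar> = 1" if "Re v1 = Re v4"
    by (rule four_corners_opposite[OF m zero_less_one a _ _ _ _ _ _ d(1,2,3,5) _ that]) (use cd d(6) in \<open>simp_all\<close>)
  moreover have "\<bar>Im (\<sigma>1 t) - Im (\<sigma>3 t')\<bar> = 1 \<and> \<bar>Re (\<sigma>2 t) - Re (\<sigma>4 t')\<bar> = m" if "Im v1 = Im v4"
  proof -
    \<comment> \<open>The same lemma with Re and Im, and likewise m and 1, exchanged.\<close>
    note a' = a[unfolded disj_commute[of "_ \<and> Re _ = Re _"]]
    show ?thesis
      by (rule four_corners_opposite[OF zero_less_one m a' _ _ _ _ _ _ _ _ _ _ _ that]) (use cd d in \<open>auto\<close>)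
  qed
  moreover have "Im v1 = Im v4" if "Re v1 \<noteq> Re v4" using a(1) that by blast
  ultimately show "(Re v1 = Re v4 \<longrightarrow> \<bar>Re (\<sigma>1 t) - Re (\<sigma>3 t')\<bar> = m \<and> \<bar>Im (\<sigma>2 t) - Im (\<sigma>4 t')\<bar> = 1)"
    and "(Re v1 \<noteq> Re v4 \<longrightarrow> \<bar>Im (\<sigma>1 t) - Im (\<sigma>3 t')\<bar> = 1 \<and> \<bar>Re (\<sigma>2 t) - Re (\<sigma>4 t')\<bar> = m)"
    by blast+
qed

text \<open>The transition map h between the rectangles separates images of opposite sides by 1 or
  m2, and these distances enter the length-area inequality for vertical and for horizontal
  slices.\<close>

lemma modulus_unique:
  assumes V: "V \<subseteq> closure (interior (ideal_quad V))" "card V = 4"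
    and m1: "1 \<le> m1" "conformal_onto_rectangle V m1" and m2: "1 \<le> m2" "conformal_onto_rectangle V m2"
  shows "m1 = m2"
proof -
  let ?I = "interior (ideal_quad V)" and ?C = "closure (interior (ideal_quad V))"
  let ?B1 = "box 0 (Complex m1 1)" and ?B2 = "box 0 (Complex m2 1)"
  let ?K1 = "cbox 0 (Complex m1 1)" and ?K2 = "cbox 0 (Complex m2 1)"
  let ?V1 = "{0, Complex m1 0, Complex m1 1, Complex 0 1}" and ?V2 = "{0, Complex m2 0, Complex m2 1, Complex 0 1}"
  obtain f1 g1 where f1: "f1 holomorphic_on ?I" "inj_on f1 ?I" "f1 ` ?I = ?B1" "homeomorphism ?C ?K1 f1 g1" "f1 ` V = ?V1"
    using m1(2) unfolding conformal_onto_rectangle_def by blast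
  obtain f2 g2 where f2: "f2 holomorphic_on ?I" "inj_on f2 ?I" "f2 ` ?I = ?B2" "homeomorphism ?C ?K2 f2 g2" "f2 ` V = ?V2"
    using m2(2) unfolding conformal_onto_rectangle_def by blast
  define h where "h = f2 \<circ> g1"
  have hom: "homeomorphism ?K1 ?K2 h (f1 \<circ> g2)"
    unfolding h_def by (rule homeomorphism_compose[OF homeomorphism_symD[OF f1(4)] f2(4)])
  then have conth: "continuous_on ?K1 h" and hK: "h ` ?K1 = ?K2" and injh: "inj_on h ?K1"
    by (auto simp: homeomorphism_def) (metis hom homeomorphism_def inj_on_inverseI)
  have IC: "?I \<subseteq> ?C" by (rule closure_subset)
  have gf: "g1 (f1 z) = z" if "z \<in> ?C" for z using f1(4) that by (simp add: homeomorphism_def)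
  have gB: "g1 ` ?B1 = ?I"
  proof -
    have "g1 ` ?B1 = (\<lambda>z. g1 (f1 z)) ` ?I" unfolding f1(3)[symmetric] image_image ..
    also have "\<dots> = (\<lambda>z. z) ` ?I" using gf IC by (intro image_cong) auto
    finally show ?thesis by simp
  qed
  have hB: "h ` ?B1 = ?B2" unfolding h_def image_comp[symmetric] gB f2(3) ..
  have V1K: "?V1 \<subseteq> ?K1" using m1(1) by (auto simp: in_cbox_complex_iff)
  \<comment> \<open>\<open>g1\<close> is known only as a homeomorphism; on the open rectangle it
    coincides with the holomorphic inverse of \<open>f1\<close>.\<close>
  obtain g where g: "g holomorphic_on f1 ` ?I" "\<And>z. z \<in> ?I \<Longrightarrow> g (f1 z) = z"
    using holomorphic_has_inverse[OF f1(1) open_interior f1(2)] by metis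
  have "g w = g1 w" if "w \<in> ?B1" for w
  proof -
    have "w \<in> f1 ` ?I" unfolding f1(3) by (rule that)
    then obtain z where z: "z \<in> ?I" "w = f1 z" by (elim imageE)
    then show ?thesis using g(2)[OF z(1)] gf[of z] IC by auto
  qed
  then have "g1 holomorphic_on ?B1" using g(1) unfolding f1(3) by (metis holomorphic_transform)
  then have holh: "h holomorphic_on ?B1"
    unfolding h_def by (rule holomorphic_on_compose_gen[OF _ f2(1)]) (simp add: gB)
  have BK: "?B1 \<subseteq> ?K1" by (rule box_subset_cbox)
  have injhB: "inj_on h ?B1" using injh BK by (rule inj_on_subset)
  have subh: "h ` ?B1 \<subseteq> ?K2" unfolding hB by (rule box_subset_cbox)
  have hV: "h ` ?V1 = ?V2"
  proof -
    have "h ` ?V1 = (\<lambda>z. f2 (g1 (f1 z))) ` V" unfolding f1(5)[symmetric] h_def image_image o_def ..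
    also have "\<dots> = f2 ` V" using gf V by (intro image_cong) auto
    finally show ?thesis unfolding f2(5) .
  qed
  have frontier: "h z \<in> ?K2 - ?B2 - ?V2" if z: "z \<in> ?K1" "z \<notin> ?B1" "z \<notin> ?V1" for z
  proof -
    have "h z \<in> ?K2" using z(1) hK by blast
    moreover have "h z \<notin> h ` ?B1" using inj_on_image_mem_iff[OF injh z(1) BK] z(2) by simp
    moreover have "h z \<notin> h ` ?V1" using inj_on_image_mem_iff[OF injh z(1) V1K] z(3) by simp
    ultimately show ?thesis unfolding hB hV by blast
  qed
  have m10: "0 < m1" "0 < m2" using m1(1) m2(1) by auto
  define \<sigma>1 where "\<sigma>1 t = h (Complex m1 ((1 + t) / 2))" for t :: real
  define \<sigma>2 where "\<sigma>2 t = h (Complex (m1 * (1 + t) / 2) 1)" for t :: real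
  define \<sigma>3 where "\<sigma>3 t = h (Complex 0 ((1 + t) / 2))" for t :: real
  define \<sigma>4 where "\<sigma>4 t = h (Complex (m1 * (1 + t) / 2) 0)" for t :: real
  have mt: "0 \<le> m1 * (1 + t)" "m1 * (1 + t) \<le> 2 * m1" if "t \<in> {-1..1}" for t
    using that m10 mult_left_mono[of "1 + t" 2 m1] by auto
  have mt': "0 < m1 * (1 + t)" "m1 * (1 + t) < 2 * m1" if "t \<in> {-1<..<1}" for t
    using that m10 mult_strict_left_mono[of "1 + t" 2 m1] by auto
  have cont: "continuous_on {-1..1} \<sigma>" if "\<sigma> \<in> {\<sigma>1, \<sigma>2, \<sigma>3, \<sigma>4}" for \<sigma>
  proof -
    have "continuous_on {-1..1} \<sigma>1" unfolding \<sigma>1_def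
      by (rule continuous_on_compose2[OF conth]) (use m10 in \<open>auto simp: Complex_eq in_cbox_complex_iff intro!: continuous_intros\<close>)
    moreover have "continuous_on {-1..1} \<sigma>2" unfolding \<sigma>2_def
      by (rule continuous_on_compose2[OF conth]) (use m10 mt in \<open>auto simp: Complex_eq in_cbox_complex_iff intro!: continuous_intros\<close>)
    moreover have "continuous_on {-1..1} \<sigma>3" unfolding \<sigma>3_def
      by (rule continuous_on_compose2[OF conth]) (use m10 in \<open>auto simp: Complex_eq in_cbox_complex_iff intro!: continuous_intros\<close>)
    moreover have "continuous_on {-1..1} \<sigma>4" unfolding \<sigma>4_def
      by (rule continuous_on_compose2[OF conth]) (use m10 mt in \<open>auto simp: Complex_eq in_cbox_complex_iff intro!: continuous_intros\<close>)
    ultimately show ?thesis using that by blast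
  qed
  have bd: "\<sigma> t \<in> ?K2 - ?B2 - ?V2" if "\<sigma> \<in> {\<sigma>1, \<sigma>2, \<sigma>3, \<sigma>4}" "t \<in> {-1<..<1}" for \<sigma> t
  proof -
    have "\<sigma>1 t \<in> ?K2 - ?B2 - ?V2" unfolding \<sigma>1_def
      by (rule frontier) (use that(2) m10 in \<open>auto simp: in_cbox_complex_iff in_box_complex_iff complex_eq_iff\<close>)
    moreover have "\<sigma>2 t \<in> ?K2 - ?B2 - ?V2" unfolding \<sigma>2_def
      by (rule frontier) (use mt'[OF that(2)] m10 in \<open>auto simp: in_cbox_complex_iff in_box_complex_iff complex_eq_iff\<close>)
    moreover have "\<sigma>3 t \<in> ?K2 - ?B2 - ?V2" unfolding \<sigma>3_def
      by (rule frontier) (use that(2) m10 in \<open>auto simp: in_cbox_complex_iff in_box_complex_iff complex_eq_iff\<close>)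
    moreover have "\<sigma>4 t \<in> ?K2 - ?B2 - ?V2" unfolding \<sigma>4_def
      by (rule frontier) (use mt'[OF that(2)] m10 in \<open>auto simp: in_cbox_complex_iff in_box_complex_iff complex_eq_iff\<close>)
    ultimately show ?thesis using that(1) by blast
  qed
  let ?v1 = "h (Complex m1 1)" and ?v2 = "h (Complex 0 1)" and ?v3 = "h 0" and ?v4 = "h (Complex m1 0)"
  have joins: "\<sigma>1 1 = ?v1" "\<sigma>1 (-1) = ?v4" "\<sigma>2 1 = ?v1" "\<sigma>2 (-1) = ?v2" "\<sigma>3 1 = ?v2" "\<sigma>3 (-1) = ?v3"
        "\<sigma>4 1 = ?v4" "\<sigma>4 (-1) = ?v3"
    by (simp_all add: \<sigma>1_def \<sigma>2_def \<sigma>3_def \<sigma>4_def zero_complex.code)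
  have corners: "{?v1, ?v2, ?v3, ?v4} \<subseteq> ?V2" using hV by blast
  have inj_eq: "h z \<noteq> h w" if "z \<in> ?V1" "w \<in> ?V1" "z \<noteq> w" for z w
    using injh V1K that by (meson inj_onD subsetD)
  have dist: "?v1 \<noteq> ?v2" "?v1 \<noteq> ?v3" "?v1 \<noteq> ?v4" "?v2 \<noteq> ?v3" "?v2 \<noteq> ?v4" "?v3 \<noteq> ?v4"
    by (rule inj_eq; use m10 in \<open>simp add: complex_eq_iff\<close>)+
  have opp1: "Re ?v1 = Re ?v4 \<longrightarrow> \<bar>Re (\<sigma>1 t) - Re (\<sigma>3 t')\<bar> = m2 \<and> \<bar>Im (\<sigma>2 t) - Im (\<sigma>4 t')\<bar> = 1"
    and opp2: "Re ?v1 \<noteq> Re ?v4 \<longrightarrow> \<bar>Im (\<sigma>1 t) - Im (\<sigma>3 t')\<bar> = 1 \<and> \<bar>Re (\<sigma>2 t) - Re (\<sigma>4 t')\<bar> = m2"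
    if "t \<in> {-1..1}" "t' \<in> {-1..1}" for t t'
    by (rule opposite_sides[OF m10(2) _ _ joins corners dist that]; fact cont bd)+
  have ver: "\<bar>Im (h (Complex x 1)) - Im (h (Complex x 0))\<bar> = 1" if "Re ?v1 = Re ?v4" "0 < x" "x < m1" for x
    using opp1[of "2 * x / m1 - 1" "2 * x / m1 - 1"] that m10 by (simp add: \<sigma>2_def \<sigma>4_def divide_simps)
  have ver': "\<bar>Re (h (Complex x 1)) - Re (h (Complex x 0))\<bar> = m2" if "Re ?v1 \<noteq> Re ?v4" "0 < x" "x < m1" for x
    using opp2[of "2 * x / m1 - 1" "2 * x / m1 - 1"] that m10 by (simp add: \<sigma>2_def \<sigma>4_def divide_simps)
  have hor: "\<bar>Re (h (Complex m1 y)) - Re (h (Complex 0 y))\<bar> = m2" if "Re ?v1 = Re ?v4" "0 < y" "y < 1" for y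
    using opp1[of "2 * y - 1" "2 * y - 1"] that by (simp add: \<sigma>1_def \<sigma>3_def)
  have V: "(m1 - 0) * L\<^sup>2 \<le> (1 - 0) * m2"
    if "0 < L" "\<And>x. 0 < x \<Longrightarrow> x < m1 \<Longrightarrow> L \<le> cmod (h (Complex x 1) - h (Complex x 0))" for L
  proof (rule length_area_separation[OF open_box holh injhB subh _ m10(1) that(1) conth])
    fix x assume x: "0 < x" "x < m1"
    show "\<exists>y1 y2. y1 < y2 \<and> (\<forall>y\<in>{y1<..<y2}. Complex x y \<in> ?B1) \<and> (\<forall>y\<in>{y1..y2}. Complex x y \<in> ?K1) \<and>
        L \<le> cmod (h (Complex x y2) - h (Complex x y1))"
      by (rule exI[of _ 0], rule exI[of _ 1]) (use that(2)[OF x] x in \<open>auto simp: in_box_complex_iff in_cbox_complex_iff\<close>)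
  qed (auto simp: in_box_complex_iff)
  have H: "(1 - 0) * L\<^sup>2 \<le> (m1 - 0) * m2"
    if "0 < L" "\<And>y. 0 < y \<Longrightarrow> y < 1 \<Longrightarrow> L \<le> cmod (h (Complex m1 y) - h (Complex 0 y))" for L
  proof (rule length_area_separation_horizontal[OF open_box holh injhB subh _ zero_less_one that(1) conth])
    fix y :: real assume y: "0 < y" "y < 1"
    show "\<exists>x1 x2. x1 < x2 \<and> (\<forall>x\<in>{x1<..<x2}. Complex x y \<in> ?B1) \<and> (\<forall>x\<in>{x1..x2}. Complex x y \<in> ?K1) \<and>
        L \<le> cmod (h (Complex x2 y) - h (Complex x1 y))"
      by (rule exI[of _ 0], rule exI[of _ m1]) (use that(2)[OF y] y m10 in \<open>auto simp: in_box_complex_iff in_cbox_complex_iff\<close>)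
  qed (auto simp: in_box_complex_iff)
  have re: "\<bar>Re z - Re w\<bar> \<le> cmod (z - w)" "\<bar>Im z - Im w\<bar> \<le> cmod (z - w)" for z w
    using abs_Re_le_cmod[of "z - w"] abs_Im_le_cmod[of "z - w"] by auto
  show ?thesis
  proof (cases "Re ?v1 = Re ?v4")
    case True
    have "m1 \<le> m2" using V[of 1] ver[OF True] re(2) by (metis diff_zero mult_1 mult.right_neutral one_power2 zero_less_one)
    moreover have "m2\<^sup>2 \<le> m1 * m2" using H[of m2] hor[OF True] re(1) m10 by (metis diff_zero mult_1)
    then have "m2 \<le> m1" using m10 by (simp add: power2_eq_square)
    ultimately show ?thesis by simp
  next
    case False
    \<comment> \<open>With exchanged sides the vertical slices are stretched to m2, which gives m1
      m2 <= 1. As both moduli are at least 1, both equal 1.\<close>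
    have "m1 * m2\<^sup>2 \<le> m2" using V[of m2] ver'[OF False] re(1) m10 by (metis diff_zero mult_1)
    then have "m1 * m2 \<le> 1" using m10 by (simp add: power2_eq_square)
    moreover have "m1 * 1 \<le> m1 * m2" "1 * m2 \<le> m1 * m2" using m1(1) m2(1) by (auto intro!: mult_left_mono mult_right_mono)
    ultimately show ?thesis using m1(1) m2(1) by linarith
  qed
qed

section \<open>Estimates of the modulus\<close>

lemma continuous_on_half_klein: "continuous_on {-1..1} half_klein"
proof -
  have "1 + sqrt (1 - k\<^sup>2) \<noteq> 0" if "k \<in> {-1..1}" for k :: real
  proof -
    have "0 \<le> 1 - k\<^sup>2" using that by (simp add: abs_square_le_1 abs_le_iff)
    then have "0 \<le> sqrt (1 - k\<^sup>2)" by simp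
    then show ?thesis by linarith
  qed
  then show ?thesis unfolding half_klein_def by (intro continuous_intros) auto
qed

lemma continuous_on_chord:
  assumes "\<bar>y\<bar> < 1"
  shows "continuous_on {-1..1} (hchord y)" "continuous_on {-1..1} (vchord y)"
proof -
  have "\<bar>half_klein y\<bar> < 1" using assms by (intro half_klein) auto
  then have w: "cmod (- \<i> * of_real (half_klein y)) < 1" "cmod (\<i> * of_real (half_klein y)) < 1" by (simp_all add: norm_mult)
  have cb: "(\<lambda>k. complex_of_real (half_klein k)) ` {-1..1} \<subseteq> cball 0 1"
  proof (rule image_subsetI)
    fix k :: real assume "k \<in> {-1..1}"
    then have "\<bar>half_klein k\<bar> \<le> 1" by (intro half_klein(2)) (auto simp: abs_le_iff)
    then show "complex_of_real (half_klein k) \<in> cball 0 1" by simp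
  qed
  have cont: "continuous_on {-1..1} (\<lambda>k. complex_of_real (half_klein k))"
    by (intro continuous_intros continuous_on_half_klein)
  show "continuous_on {-1..1} (hchord y)" "continuous_on {-1..1} (vchord y)"
    unfolding hchord_def vchord_def
    using continuous_on_compose2[OF continuous_on_Moebius[OF w(1)] cont cb]
      continuous_on_compose2[OF continuous_on_Moebius[OF w(2)] cont cb] by auto
qed

lemma klein_eqI:
  assumes "cmod z \<le> 1" "cmod z' \<le> 1"
    "2 * Re z = (1 + (cmod z)\<^sup>2) * x" "2 * Im z = (1 + (cmod z)\<^sup>2) * y"
    "2 * Re z' = (1 + (cmod z')\<^sup>2) * x" "2 * Im z' = (1 + (cmod z')\<^sup>2) * y"
  shows "z' = z"
  using mem_if_klein_eq[of z "{z}" z' x y] assms by auto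

text \<open>This is tanh (z / 2), the inverse of the strip coordinate 2 artanh z; it maps the strip
  |Im z| < pi/2 to the disk.\<close>

definition strip_map :: "complex \<Rightarrow> complex" where
  "strip_map z = (exp z - 1) / (exp z + 1)"

text \<open>The Klein abscissa tanh (Re z) does not depend on Im z, so vertical segments of the
  strip become vertical Klein chords and the sides Re = c and Re = -c of the Klein rectangle become
  vertical segments. This makes the strip the right coordinate for the length-area estimate.\<close>

lemma strip_map:
  assumes y: "\<bar>Im z\<bar> \<le> pi/2"
  shows "exp z + 1 \<noteq> 0" "cmod (strip_map z) \<le> 1" "\<bar>Im z\<bar> < pi/2 \<Longrightarrow> cmod (strip_map z) < 1"
    "2 * Re (strip_map z) = (1 + (cmod (strip_map z))\<^sup>2) * tanh (Re z)"
    "2 * Im (strip_map z) = (1 + (cmod (strip_map z))\<^sup>2) * (sin (Im z) / cosh (Re z))"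
proof -
  define E where "E = exp (Re z)"
  define C where "C = cos (Im z)"
  define S where "S = sin (Im z)"
  have E: "0 < E" by (simp add: E_def)
  have C: "0 \<le> C" unfolding C_def using y by (intro cos_ge_zero) (auto simp: abs_le_iff)
  have C': "0 < C" if "\<bar>Im z\<bar> < pi/2" unfolding C_def using that by (intro cos_gt_zero_pi) (auto simp: abs_less_iff)
  have CS: "C\<^sup>2 + S\<^sup>2 = 1" by (simp add: C_def S_def)
  have ez: "exp z = Complex (E * C) (E * S)" by (simp add: complex_eq_iff Re_exp Im_exp E_def C_def S_def)
  define d where "d = (cmod (exp z + 1))\<^sup>2"
  have EE: "(E * C)\<^sup>2 + (E * S)\<^sup>2 = E\<^sup>2"
    using CS by (simp add: power_mult_distrib flip: distrib_left)
  have d: "d = E\<^sup>2 + 2 * E * C + 1" using EE unfolding d_def cmod_power2 ez by (simp add: power2_sum algebra_simps)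
  have n: "(cmod (exp z - 1))\<^sup>2 = E\<^sup>2 - 2 * E * C + 1" using EE unfolding cmod_power2 ez by (simp add: power2_diff algebra_simps)
  have EC: "0 \<le> E * C" using E C by simp
  have d0: "0 < d" unfolding d using EC by (intro add_nonneg_pos add_nonneg_nonneg) (auto simp: mult.assoc)
  then show nz: "exp z + 1 \<noteq> 0" by (auto simp: d_def)
  have norm: "(cmod (strip_map z))\<^sup>2 = (E\<^sup>2 - 2 * E * C + 1) / d"
    unfolding strip_map_def norm_divide power_divide n d_def ..
  have "(cmod (strip_map z))\<^sup>2 \<le> 1" unfolding norm using d0 EC by (simp add: d mult.commute)
  then show "cmod (strip_map z) \<le> 1" by (simp add: abs_square_le_1)
  show "cmod (strip_map z) < 1" if "\<bar>Im z\<bar> < pi/2"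
  proof -
    have "0 < E * C" using E C'[OF that] by simp
    then have "(cmod (strip_map z))\<^sup>2 < 1" unfolding norm using d0 by (simp add: d mult.commute)
    then show ?thesis by (simp add: abs_square_less_1)
  qed
  have N: "1 + (cmod (strip_map z))\<^sup>2 = 2 * (E\<^sup>2 + 1) / d"
    unfolding norm using d0 by (simp add: field_simps d)
  have q: "strip_map z = ((exp z - 1) * cnj (exp z + 1)) / of_real d"
  proof -
    have "a / w = a * cnj w / (w * cnj w)" if "w \<noteq> 0" for a w :: complex using that by simp
    from this[OF nz] show ?thesis unfolding strip_map_def d_def complex_norm_square .
  qed
  have re: "Re ((exp z - 1) * cnj (exp z + 1)) = E\<^sup>2 - 1" "Im ((exp z - 1) * cnj (exp z + 1)) = 2 * E * S"
    using EE by (simp_all add: ez algebra_simps power2_eq_square)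
  have r: "Re (strip_map z) = (E\<^sup>2 - 1) / d" "Im (strip_map z) = 2 * E * S / d"
    unfolding q Re_divide_of_real Im_divide_of_real re by simp_all
  have E2: "E\<^sup>2 + 1 \<noteq> 0" using E by (metis add_pos_pos less_irrefl zero_less_one zero_less_power)
  have ch: "cosh (Re z) = (E\<^sup>2 + 1) / (2 * E)" "sinh (Re z) = (E\<^sup>2 - 1) / (2 * E)"
    using E by (simp_all add: cosh_def sinh_def E_def exp_minus field_simps power2_eq_square)
  have "a / (2 * E) / (b / (2 * E)) = a / b" for a b using E by simp
  then have "tanh (Re z) = (E\<^sup>2 - 1) / (E\<^sup>2 + 1)" unfolding tanh_def ch .
  then show "2 * Re (strip_map z) = (1 + (cmod (strip_map z))\<^sup>2) * tanh (Re z)"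
    unfolding N r using d0 E2 by (simp add: field_simps)
  have "sin (Im z) / cosh (Re z) = S * (2 * E) / (E\<^sup>2 + 1)" unfolding ch S_def by simp
  then show "2 * Im (strip_map z) = (1 + (cmod (strip_map z))\<^sup>2) * (sin (Im z) / cosh (Re z))"
    unfolding N r using d0 E2 by (simp add: field_simps)
qed

lemma inj_strip_map:
  assumes "\<bar>Im z\<bar> < pi/2" "\<bar>Im w\<bar> < pi/2" "strip_map z = strip_map w" shows "z = w"
proof -
  have "exp z + 1 \<noteq> 0" "exp w + 1 \<noteq> 0" using strip_map(1) assms by auto
  then have "(exp z - 1) * (exp w + 1) = (exp w - 1) * (exp z + 1)"
    using assms(3) by (simp add: strip_map_def frac_eq_eq)
  then have "exp z = exp w" by (simp add: algebra_simps)
  moreover have "\<bar>Im z - Im w\<bar> < 2 * pi" using assms(1,2) by linarith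
  ultimately show ?thesis by (rule exp_complex_eqI[rotated])
qed

lemma tanh_artanh:
  fixes c :: real assumes "\<bar>c\<bar> < 1" shows "tanh (artanh c) = c"
proof -
  have c: "0 < 1 + c" "0 < 1 - c" using assms by (auto simp: abs_less_iff)
  have "exp (- (2 * artanh c)) = (1 - c) / (1 + c)"
    using c by (simp add: artanh_def exp_minus)
  then have "tanh (artanh c) = (1 - (1 - c) / (1 + c)) / (1 + (1 - c) / (1 + c))"
    by (simp add: tanh_real_altdef)
  also have "\<dots> = c" using c by (simp add: field_simps)
  finally show ?thesis .
qed

text \<open>
  The two cases distinguish which pair of opposite sides of the quadrilateral is mapped to the
  vertical sides of the rectangle.
\<close>

lemma modulus_estimates:
  assumes cs: "0 < c" "0 < s" "c\<^sup>2 + s\<^sup>2 = 1" and m: "1 \<le> m" "conformal_onto_rectangle (quad_verts c s) m"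
  shows "arcsin s * m \<le> artanh c \<or> (2 * artanh c * m \<le> pi \<and> arcsin s \<le> artanh c * m)"
proof -
  let ?I = "quad_dom c s" and ?C = "quad_cl c s" and ?V = "quad_verts c s"
  let ?B = "box 0 (Complex m 1)" and ?K = "cbox 0 (Complex m 1)"
  let ?W = "{0, Complex m 0, Complex m 1, Complex 0 1}"
  have m0: "0 < m" using m(1) by simp
  obtain f g where f: "f holomorphic_on ?I" "inj_on f ?I" "f ` ?I = ?B" "homeomorphism ?C ?K f g" "f ` ?V = ?W"
    using m(2) unfolding conformal_onto_rectangle_def interior_ideal_quad[OF cs] closure_quad_dom[OF cs(1,2)] by blast
  have contf: "continuous_on ?C f" and fC: "f ` ?C = ?K" using f(4) by (auto simp: homeomorphism_def)
  have injf: "inj_on f ?C" using f(4) by (metis homeomorphism_def inj_on_inverseI)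
  have IC: "?I \<subseteq> ?C" by (rule quad_dom_subset_quad_cl)
  have VC: "?V \<subseteq> ?C" using quad_verts_frontier(2)[OF cs] by auto
  have frontier: "f z \<in> ?K - ?B - ?W" if z: "z \<in> ?C" "z \<notin> ?I" "z \<notin> ?V" for z
  proof -
    have "f z \<in> ?K" using z(1) fC by blast
    moreover have "f z \<notin> f ` ?I" using inj_on_image_mem_iff[OF injf z(1) IC] z(2) by simp
    moreover have "f z \<notin> f ` ?V" using inj_on_image_mem_iff[OF injf z(1) VC] z(3) by simp
    ultimately show ?thesis unfolding f(3,5) by blast
  qed
  have c2: "1 - c\<^sup>2 = s\<^sup>2" "1 - s\<^sup>2 = c\<^sup>2" using cs(3) by auto
  have lt1: "c < 1" "s < 1" using cs c2
    by (metis abs_of_pos abs_square_less_1 add.commute less_add_same_cancel1 zero_less_power)+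
  have ac: "\<bar>\<sigma> * c\<bar> < 1" "\<bar>\<sigma> * s\<bar> < 1" "(\<sigma> * c)\<^sup>2 = c\<^sup>2" "(\<sigma> * s)\<^sup>2 = s\<^sup>2" if "\<sigma> = 1 \<or> \<sigma> = -1" for \<sigma>
    using that cs lt1 by auto
  have sq: "sqrt (1 - c\<^sup>2) = s" "sqrt (1 - s\<^sup>2) = c" unfolding c2 using cs by auto
  have vk: "cmod (vchord (\<sigma> * c) t) \<le> 1"
      "2 * Re (vchord (\<sigma> * c) t) = (1 + (cmod (vchord (\<sigma> * c) t))\<^sup>2) * (\<sigma> * c)"
      "2 * Im (vchord (\<sigma> * c) t) = (1 + (cmod (vchord (\<sigma> * c) t))\<^sup>2) * (t * s)"
    if "\<sigma> = 1 \<or> \<sigma> = -1" "\<bar>t\<bar> \<le> 1" for \<sigma> t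
    using chord_klein(4-6)[OF ac(1)[OF that(1)] that(2)] unfolding ac(3)[OF that(1)] sq .
  have hk: "cmod (hchord (\<sigma> * s) t) \<le> 1"
      "2 * Re (hchord (\<sigma> * s) t) = (1 + (cmod (hchord (\<sigma> * s) t))\<^sup>2) * (t * c)"
      "2 * Im (hchord (\<sigma> * s) t) = (1 + (cmod (hchord (\<sigma> * s) t))\<^sup>2) * (\<sigma> * s)"
    if "\<sigma> = 1 \<or> \<sigma> = -1" "\<bar>t\<bar> \<le> 1" for \<sigma> t
    using chord_klein(1-3)[OF ac(2)[OF that(1)] that(2)] unfolding ac(4)[OF that(1)] sq .
  \<comment> \<open>X and Y are Klein coordinates; membership in the closed quadrilateral, in the
    open one and among the vertices is read off from them.\<close>
  have kl_cl: "z \<in> ?C" if "cmod z \<le> 1" "2 * Re z = (1 + (cmod z)\<^sup>2) * X" "2 * Im z = (1 + (cmod z)\<^sup>2) * Y" "\<bar>X\<bar> \<le> c" "\<bar>Y\<bar> \<le> s" for z X Y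
  proof -
    have p: "0 < 1 + (cmod z)\<^sup>2" by (simp add: add_pos_nonneg)
    have "2 * \<bar>Re z\<bar> = \<bar>2 * Re z\<bar>" "2 * \<bar>Im z\<bar> = \<bar>2 * Im z\<bar>" by simp_all
    then have "2 * \<bar>Re z\<bar> = (1 + (cmod z)\<^sup>2) * \<bar>X\<bar>" "2 * \<bar>Im z\<bar> = (1 + (cmod z)\<^sup>2) * \<bar>Y\<bar>"
      unfolding that(2,3) abs_mult using p by simp_all
    then show ?thesis using that p by (simp add: quad_cl_def mult_left_mono)
  qed
  have kl_dom: "z \<in> ?I \<longleftrightarrow> cmod z < 1 \<and> \<bar>X\<bar> < c \<and> \<bar>Y\<bar> < s" if "2 * Re z = (1 + (cmod z)\<^sup>2) * X" "2 * Im z = (1 + (cmod z)\<^sup>2) * Y" for z X Y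
  proof -
    have p: "0 < 1 + (cmod z)\<^sup>2" by (simp add: add_pos_nonneg)
    have "2 * \<bar>Re z\<bar> = \<bar>2 * Re z\<bar>" "2 * \<bar>Im z\<bar> = \<bar>2 * Im z\<bar>" by simp_all
    then have "2 * \<bar>Re z\<bar> = (1 + (cmod z)\<^sup>2) * \<bar>X\<bar>" "2 * \<bar>Im z\<bar> = (1 + (cmod z)\<^sup>2) * \<bar>Y\<bar>"
      unfolding that(1,2) abs_mult using p by simp_all
    then show ?thesis unfolding quad_dom_def mem_Collect_eq using p by (simp only: mult_less_cancel_left_pos)
  qed
  have kl_vert: "\<bar>X\<bar> = c \<and> \<bar>Y\<bar> = s" if "z \<in> ?V" "2 * Re z = (1 + (cmod z)\<^sup>2) * X" "2 * Im z = (1 + (cmod z)\<^sup>2) * Y" for z X Y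
  proof -
    have "cmod z = 1" using quad_verts_frontier(1)[OF cs that(1)] .
    then have "X = Re z" "Y = Im z" using that(2,3) by auto
    then show ?thesis using that(1) cs by (auto simp: quad_verts_def)
  qed
  have vert_eq: "vchord (\<sigma> * c) \<tau> = Complex (\<sigma> * c) (\<tau> * s)" "hchord (\<tau> * s) \<sigma> = Complex (\<sigma> * c) (\<tau> * s)"
    if st: "\<sigma> = 1 \<or> \<sigma> = -1" "\<tau> = 1 \<or> \<tau> = -1" for \<sigma> \<tau>
  proof -
    have v: "Complex (\<sigma> * c) (\<tau> * s) \<in> ?V" using st by (auto simp: quad_verts_def)
    have n1: "cmod (Complex (\<sigma> * c) (\<tau> * s)) = 1" using quad_verts_frontier(1)[OF cs v] .
    have a: "\<bar>\<sigma>\<bar> \<le> 1" "\<bar>\<tau>\<bar> \<le> 1" using st by auto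
    have k: "2 * Re (Complex (\<sigma> * c) (\<tau> * s)) = (1 + (cmod (Complex (\<sigma> * c) (\<tau> * s)))\<^sup>2) * (\<sigma> * c)"
      "2 * Im (Complex (\<sigma> * c) (\<tau> * s)) = (1 + (cmod (Complex (\<sigma> * c) (\<tau> * s)))\<^sup>2) * (\<tau> * s)"
      unfolding n1 by simp_all
    show "vchord (\<sigma> * c) \<tau> = Complex (\<sigma> * c) (\<tau> * s)"
      by (rule klein_eqI[OF _ _ k vk(2,3)[OF st(1) a(2)]]) (use n1 vk(1)[OF st(1) a(2)] in simp_all)
    show "hchord (\<tau> * s) \<sigma> = Complex (\<sigma> * c) (\<tau> * s)"
      by (rule klein_eqI[OF _ _ k hk(2,3)[OF st(2) a(1)]]) (use n1 hk(1)[OF st(2) a(1)] in simp_all)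
  qed
  \<comment> \<open>Images of the right, top, left and bottom side, in the order expected by
    \<open>opposite_sides\<close>. By \<open>vert_eq\<close> neighboring chords share their
    endpoints, the vertices.\<close>
  define \<sigma>1 where "\<sigma>1 t = f (vchord (1 * c) t)" for t
  define \<sigma>2 where "\<sigma>2 t = f (hchord (1 * s) t)" for t
  define \<sigma>3 where "\<sigma>3 t = f (vchord (-1 * c) t)" for t
  define \<sigma>4 where "\<sigma>4 t = f (hchord (-1 * s) t)" for t
  have ts: "\<bar>t * c\<bar> \<le> c" "\<bar>t * s\<bar> \<le> s" if "\<bar>t\<bar> \<le> 1" for t
    using that cs by (auto simp: abs_mult mult_left_le_one_le)
  have vC: "vchord (\<sigma> * c) t \<in> ?C" and hC: "hchord (\<sigma> * s) t \<in> ?C" if "\<sigma> = 1 \<or> \<sigma> = -1" "\<bar>t\<bar> \<le> 1" for \<sigma> t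
    using kl_cl[OF vk[OF that]] kl_cl[OF hk[OF that]] ts[OF that(2)] that(1) cs by (auto simp: abs_mult)
  have one: "(1::real) = 1 \<or> (1::real) = -1" "(-1::real) = 1 \<or> (-1::real) = -1" by auto
  have abs1: "\<bar>t\<bar> \<le> 1" if "t \<in> {-1..1}" for t :: real using that by (auto simp: abs_le_iff)
  have contv: "continuous_on {-1..1} (\<lambda>t. f (vchord (\<sigma> * c) t))" and conth: "continuous_on {-1..1} (\<lambda>t. f (hchord (\<sigma> * s) t))"
    if "\<sigma> = 1 \<or> \<sigma> = -1" for \<sigma>
    using vC[OF that abs1] hC[OF that abs1]
    by (auto intro!: continuous_on_compose2[OF contf] continuous_on_chord ac[OF that])
  have frv: "f (vchord (\<sigma> * c) t) \<in> ?K - ?B - ?W" and frh: "f (hchord (\<sigma> * s) t) \<in> ?K - ?B - ?W"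
    if st: "\<sigma> = 1 \<or> \<sigma> = -1" "t \<in> {-1<..<1}" for \<sigma> t
  proof -
    have t: "\<bar>t\<bar> \<le> 1" "\<bar>t\<bar> < 1" using st(2) by (auto simp: abs_le_iff abs_less_iff)
    have "\<bar>t * c\<bar> < c" "\<bar>t * s\<bar> < s" using t cs by (auto simp: abs_mult)
    moreover have "\<bar>\<sigma> * c\<bar> = c" "\<bar>\<sigma> * s\<bar> = s" using st(1) cs by auto
    ultimately show "f (vchord (\<sigma> * c) t) \<in> ?K - ?B - ?W" "f (hchord (\<sigma> * s) t) \<in> ?K - ?B - ?W"
      using kl_dom[OF vk(2,3)[OF st(1) t(1)]] kl_vert[OF _ vk(2,3)[OF st(1) t(1)]]
        kl_dom[OF hk(2,3)[OF st(1) t(1)]] kl_vert[OF _ hk(2,3)[OF st(1) t(1)]] vC[OF st(1) t(1)] hC[OF st(1) t(1)]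
      by (intro frontier; force)+
  qed
  let ?v1 = "f (Complex (1 * c) (1 * s))" and ?v2 = "f (Complex (-1 * c) (1 * s))"
    and ?v3 = "f (Complex (-1 * c) (-1 * s))" and ?v4 = "f (Complex (1 * c) (-1 * s))"
  have joins: "\<sigma>1 1 = ?v1" "\<sigma>1 (-1) = ?v4" "\<sigma>2 1 = ?v1" "\<sigma>2 (-1) = ?v2" "\<sigma>3 1 = ?v2" "\<sigma>3 (-1) = ?v3"
        "\<sigma>4 1 = ?v4" "\<sigma>4 (-1) = ?v3"
    unfolding \<sigma>1_def \<sigma>2_def \<sigma>3_def \<sigma>4_def by (simp_all only: vert_eq[OF one(1) one(1)] vert_eq[OF one(1) one(2)] vert_eq[OF one(2) one(1)] vert_eq[OF one(2) one(2)])
  have inV: "Complex (1 * c) (1 * s) \<in> ?V" "Complex (-1 * c) (1 * s) \<in> ?V" "Complex (-1 * c) (-1 * s) \<in> ?V" "Complex (1 * c) (-1 * s) \<in> ?V"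
    by (auto simp: quad_verts_def)
  have corners: "{?v1, ?v2, ?v3, ?v4} \<subseteq> ?W" using f(5) inV by blast
  have inj_eq: "f z \<noteq> f w" if "z \<in> ?V" "w \<in> ?V" "z \<noteq> w" for z w
    using injf VC that by (meson inj_onD subsetD)
  have dist: "?v1 \<noteq> ?v2" "?v1 \<noteq> ?v3" "?v1 \<noteq> ?v4" "?v2 \<noteq> ?v3" "?v2 \<noteq> ?v4" "?v3 \<noteq> ?v4"
    by (rule inj_eq; use inV cs in \<open>simp add: complex_eq_iff\<close>)+
  have cont: "continuous_on {-1..1} \<sigma>" if "\<sigma> \<in> {\<sigma>1, \<sigma>2, \<sigma>3, \<sigma>4}" for \<sigma>
    using that contv[OF one(1)] contv[OF one(2)] conth[OF one(1)] conth[OF one(2)]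
    unfolding \<sigma>1_def[abs_def] \<sigma>2_def[abs_def] \<sigma>3_def[abs_def] \<sigma>4_def[abs_def] by blast
  have bd: "\<sigma> t \<in> ?K - ?B - ?W" if "\<sigma> \<in> {\<sigma>1, \<sigma>2, \<sigma>3, \<sigma>4}" "t \<in> {-1<..<1}" for \<sigma> t
    using that(1) frv[OF one(1) that(2)] frv[OF one(2) that(2)] frh[OF one(1) that(2)] frh[OF one(2) that(2)]
    unfolding \<sigma>1_def[symmetric] \<sigma>2_def[symmetric] \<sigma>3_def[symmetric] \<sigma>4_def[symmetric] by blast
  have opp1: "Re ?v1 = Re ?v4 \<longrightarrow> \<bar>Re (\<sigma>1 t) - Re (\<sigma>3 t')\<bar> = m \<and> \<bar>Im (\<sigma>2 t) - Im (\<sigma>4 t')\<bar> = 1"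
    and opp2: "Re ?v1 \<noteq> Re ?v4 \<longrightarrow> \<bar>Im (\<sigma>1 t) - Im (\<sigma>3 t')\<bar> = 1 \<and> \<bar>Re (\<sigma>2 t) - Re (\<sigma>4 t')\<bar> = m"
    if "t \<in> {-1..1}" "t' \<in> {-1..1}" for t t'
    by (rule opposite_sides[OF m0 _ _ joins corners dist that]; fact cont bd)+
  define e where "e = artanh c"
  have te: "tanh e = c" unfolding e_def using cs lt1 by (intro tanh_artanh) auto
  have e0: "0 < e"
  proof -
    have "tanh 0 < tanh e" using te cs by simp
    then show ?thesis by (simp only: tanh_real_less_iff)
  qed
  have tanh_lt: "\<bar>tanh x\<bar> < c \<longleftrightarrow> \<bar>x\<bar> < e" and tanh_le: "\<bar>tanh x\<bar> \<le> c \<longleftrightarrow> \<bar>x\<bar> \<le> e" for x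
    using tanh_real_less_iff[of "\<bar>x\<bar>" e] tanh_real_le_iff[of "\<bar>x\<bar>" e] unfolding tanh_real_abs te by auto
  define h where "h = f \<circ> strip_map"
  \<comment> \<open>\<open>U\<close> and \<open>K\<close> describe the open and the closed
    quadrilateral in strip coordinates: |tanh x| < c is |x| < e, and the Klein ordinate is sin y /
    cosh x.\<close>
  define U where "U = {z. \<bar>Re z\<bar> < e \<and> \<bar>Im z\<bar> < pi/2 \<and> \<bar>sin (Im z)\<bar> < s * cosh (Re z)}"
  define K where "K = {z. \<bar>Re z\<bar> \<le> e \<and> \<bar>Im z\<bar> \<le> pi/2 \<and> \<bar>sin (Im z)\<bar> \<le> s * cosh (Re z)}"
  have "U = {z. \<bar>Re z\<bar> < e} \<inter> {z. \<bar>Im z\<bar> < pi/2} \<inter> {z. \<bar>sin (Im z)\<bar> < s * cosh (Re z)}" by (auto simp: U_def)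
  then have "open U" by (auto intro!: open_Int open_Collect_less continuous_intros)
  have chp: "0 < cosh x" for x :: real by (rule cosh_real_pos)
  have SU: "strip_map z \<in> ?I" if "z \<in> U" for z
  proof -
    have z: "\<bar>Re z\<bar> < e" "\<bar>Im z\<bar> < pi/2" "\<bar>Im z\<bar> \<le> pi/2" "\<bar>sin (Im z)\<bar> < s * cosh (Re z)" using that by (auto simp: U_def)
    have "\<bar>sin (Im z) / cosh (Re z)\<bar> < s" using z(4) chp[of "Re z"] by (simp add: divide_less_eq)
    then show ?thesis using kl_dom[OF strip_map(4,5)[OF z(3)]] strip_map(3)[OF z(3,2)] z(1) tanh_lt by simp
  qed
  have SK: "strip_map z \<in> ?C" if "z \<in> K" for z
  proof -
    have z: "\<bar>Re z\<bar> \<le> e" "\<bar>Im z\<bar> \<le> pi/2" "\<bar>sin (Im z)\<bar> \<le> s * cosh (Re z)" using that by (auto simp: K_def)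
    have "\<bar>sin (Im z) / cosh (Re z)\<bar> \<le> s" using z(3) chp[of "Re z"] by (simp add: divide_le_eq)
    then show ?thesis using kl_cl[OF strip_map(2,4,5)[OF z(2)]] z(1) tanh_le by simp
  qed
  have contS: "continuous_on K strip_map"
    unfolding strip_map_def by (intro continuous_intros) (auto simp: K_def strip_map(1))
  have contH: "continuous_on K h" unfolding h_def
    by (rule continuous_on_compose[OF contS continuous_on_subset[OF contf]]) (use SK in auto)
  have holS: "strip_map holomorphic_on U"
    unfolding strip_map_def by (intro holomorphic_intros) (auto simp: U_def strip_map(1))
  have holH: "h holomorphic_on U" unfolding h_def
    by (rule holomorphic_on_compose_gen[OF holS f(1)]) (use SU in auto)
  have injH: "inj_on h U"
  proof (rule inj_onI)
    fix z w assume zw: "z \<in> U" "w \<in> U" "h z = h w"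
    then have eq: "strip_map z = strip_map w" using SU f(2) by (auto simp: h_def dest: inj_onD)
    have "\<bar>Im z\<bar> < pi/2" "\<bar>Im w\<bar> < pi/2" using zw by (auto simp: U_def)
    from inj_strip_map[OF this eq] show "z = w" .
  qed
  have subH: "h ` U \<subseteq> ?K"
  proof (rule image_subsetI)
    fix z assume "z \<in> U"
    then have "f (strip_map z) \<in> f ` ?I" using SU by blast
    then show "h z \<in> ?K" unfolding f(3) h_def using box_subset_cbox by auto
  qed
  \<comment> \<open>Where |Re z| = e the Klein abscissa is c or -c, so the point lies on a vertical
    side; its chord parameter t is the Klein ordinate divided by s. \<open>endN\<close> does the
    same for the horizontal sides.\<close>
  have endE: "\<exists>t\<in>{-1..1}. strip_map z = vchord (\<sigma> * c) t" if st: "\<sigma> = 1 \<or> \<sigma> = -1" and z: "z \<in> K" "Re z = \<sigma> * e" for \<sigma> z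
  proof -
    have zi: "\<bar>Im z\<bar> \<le> pi/2" "\<bar>sin (Im z)\<bar> \<le> s * cosh (Re z)" using z by (auto simp: K_def)
    define t where "t = sin (Im z) / cosh (Re z) / s"
    have "\<bar>t\<bar> \<le> 1" using zi(2) chp[of "Re z"] cs by (simp add: t_def abs_mult divide_le_eq mult.commute)
    have ts: "t * s = sin (Im z) / cosh (Re z)" using cs by (simp add: t_def)
    have "tanh (Re z) = \<sigma> * c" using st z(2) te by auto
    then have "strip_map z = vchord (\<sigma> * c) t"
      using klein_eqI[OF vk(1)[OF st \<open>\<bar>t\<bar> \<le> 1\<close>] strip_map(2)[OF zi(1)] vk(2,3)[OF st \<open>\<bar>t\<bar> \<le> 1\<close>]] strip_map(4,5)[OF zi(1)] ts by simp
    then show ?thesis using \<open>\<bar>t\<bar> \<le> 1\<close> by (auto simp: abs_le_iff intro!: bexI[of _ t])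
  qed
  have endN: "\<exists>t\<in>{-1..1}. strip_map z = hchord (\<sigma> * s) t" if st: "\<sigma> = 1 \<or> \<sigma> = -1" and z: "z \<in> K" "sin (Im z) = \<sigma> * s * cosh (Re z)" for \<sigma> z
  proof -
    have zi: "\<bar>Im z\<bar> \<le> pi/2" "\<bar>Re z\<bar> \<le> e" using z by (auto simp: K_def)
    define t where "t = tanh (Re z) / c"
    have "\<bar>t\<bar> \<le> 1" using zi(2) tanh_le[of "Re z"] cs by (simp add: t_def divide_le_eq)
    have ts: "t * c = tanh (Re z)" using cs by (simp add: t_def)
    have "sin (Im z) / cosh (Re z) = \<sigma> * s" unfolding z(2) using chp[of "Re z"] by simp
    then have "strip_map z = hchord (\<sigma> * s) t"
      using klein_eqI[OF hk(1)[OF st \<open>\<bar>t\<bar> \<le> 1\<close>] strip_map(2)[OF zi(1)] hk(2,3)[OF st \<open>\<bar>t\<bar> \<le> 1\<close>]] strip_map(4,5)[OF zi(1)] ts by simp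
    then show ?thesis using \<open>\<bar>t\<bar> \<le> 1\<close> by (auto simp: abs_le_iff intro!: bexI[of _ t])
  qed
  have re: "\<bar>Re z - Re w\<bar> \<le> cmod (z - w)" "\<bar>Im z - Im w\<bar> \<le> cmod (z - w)" for z w
    using abs_Re_le_cmod[of "z - w"] abs_Im_le_cmod[of "z - w"] by auto
  define y0 where "y0 = arcsin s"
  have y0: "0 < y0" "y0 < pi/2" "sin y0 = s"
    unfolding y0_def using cs lt1 arcsin_less_arcsin[of 0 s] arcsin_lt_bounded[of s] by auto
  have sin_lt: "\<bar>sin y\<bar> < sin \<alpha>" if "\<bar>y\<bar> < \<alpha>" "\<alpha> \<le> pi/2" for y \<alpha>
  proof -
    have "- (pi/2) \<le> y" "y < \<alpha>" "- (pi/2) \<le> - y" "- y < \<alpha>" using that by (auto simp: abs_less_iff)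
    then have "sin y < sin \<alpha>" "sin (- y) < sin \<alpha>" using that(2) by (blast intro: sin_monotone_2pi)+
    then show ?thesis by (simp add: abs_less_iff)
  qed
  have sin_le: "\<bar>sin y\<bar> \<le> sin \<alpha>" if "\<bar>y\<bar> \<le> \<alpha>" "\<alpha> \<le> pi/2" for y \<alpha>
  proof -
    have "- (pi/2) \<le> y" "y \<le> \<alpha>" "- (pi/2) \<le> - y" "- y \<le> \<alpha>" using that by (auto simp: abs_le_iff)
    then have "sin y \<le> sin \<alpha>" "sin (- y) \<le> sin \<alpha>" using that(2) by (blast intro: sin_monotone_2pi_le)+
    then show ?thesis by (simp add: abs_le_iff)
  qed
  have sch: "s \<le> s * cosh x" for x using cs cosh_real_ge_1[of x] by simp
  \<comment> \<open>For |y| > arcsin s the horizontal line at height y leaves \<open>U\<close> near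
    the imaginary axis and does not join the two vertical sides inside it. Below that height it
    does, since s <= s cosh x.\<close>
  define R where "R = {z. \<bar>Re z\<bar> < e \<and> \<bar>Im z\<bar> < y0}"
  have "R = {z. \<bar>Re z\<bar> < e} \<inter> {z. \<bar>Im z\<bar> < y0}" by (auto simp: R_def)
  then have "open R" by (auto intro!: open_Int open_Collect_less continuous_intros)
  have RU: "R \<subseteq> U"
  proof
    fix z assume "z \<in> R"
    then show "z \<in> U" using sin_lt[of "Im z" y0] y0 sch[of "Re z"] by (auto simp: R_def U_def)
  qed
  have horiz: "(y0 - (- y0)) * L\<^sup>2 \<le> (e - (- e)) * m"
    if "0 < L" and sep: "\<And>t t'. t \<in> {-1..1} \<Longrightarrow> t' \<in> {-1..1} \<Longrightarrow> L \<le> cmod (\<sigma>1 t - \<sigma>3 t')" for L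
  proof (rule length_area_separation_horizontal[OF \<open>open R\<close> holomorphic_on_subset[OF holH RU] inj_on_subset[OF injH RU] _ _ _ that(1) contH])
    show "h ` R \<subseteq> ?K" using subH RU by blast
    fix y assume y: "- y0 < y" "y < y0"
    have K: "Complex x y \<in> K" if "\<bar>x\<bar> \<le> e" for x
      using that y y0 sin_le[of y y0] sch[of x] by (auto simp: K_def abs_le_iff)
    obtain t where t: "t \<in> {-1..1}" "strip_map (Complex e y) = vchord (1 * c) t"
      using endE[OF one(1) K[of e]] e0 by auto
    obtain t' where t': "t' \<in> {-1..1}" "strip_map (Complex (- e) y) = vchord (-1 * c) t'"
      using endE[OF one(2) K[of "- e"]] e0 by auto
    have "L \<le> cmod (h (Complex e y) - h (Complex (- e) y))"
      using sep[OF t(1) t'(1)] by (simp only: h_def o_def t(2) t'(2) \<sigma>1_def \<sigma>3_def)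
    with K show "\<exists>x1 x2. x1 < x2 \<and> (\<forall>x\<in>{x1<..<x2}. Complex x y \<in> R) \<and>
                   (\<forall>x\<in>{x1..x2}. Complex x y \<in> K) \<and> L \<le> cmod (h (Complex x2 y) - h (Complex x1 y))"
      using e0 y by - (rule exI[of _ "- e"], rule exI[of _ e], auto simp: R_def abs_le_iff abs_less_iff)
  qed (use y0 in \<open>auto simp: R_def abs_less_iff\<close>)
  have vert: "(e - (- e)) * L\<^sup>2 \<le> (pi/2 - (- (pi/2))) * m"
    if "0 < L" and sep: "\<And>t t'. t \<in> {-1..1} \<Longrightarrow> t' \<in> {-1..1} \<Longrightarrow> L \<le> cmod (\<sigma>2 t - \<sigma>4 t')" for L
  proof (rule length_area_separation[OF \<open>open U\<close> holH injH subH _ _ that(1) contH])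
    fix x assume x: "- e < x" "x < e"
    then have xe: "\<bar>x\<bar> < e" by (simp add: abs_less_iff)
    \<comment> \<open>The slice at abscissa x has half-height arcsin (s cosh x). It is below pi/2
      because |tanh x| < c gives (cosh x)^2 < 1 / s^2.\<close>
    define a where "a = s * cosh x"
    have "\<bar>tanh x\<bar> < c" using xe tanh_lt by simp
    then have "\<bar>tanh x\<bar>\<^sup>2 < c\<^sup>2" by (intro power_strict_mono) auto
    then have "(sinh x)\<^sup>2 < c\<^sup>2 * (cosh x)\<^sup>2" using chp[of x] by (simp add: tanh_def power_divide divide_less_eq)
    then have "s\<^sup>2 * (cosh x)\<^sup>2 < 1" using cosh_square_eq[of x] unfolding c2(1)[symmetric] by (simp add: algebra_simps)
    then have "a\<^sup>2 < 1" by (simp add: a_def power_mult_distrib)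
    moreover have a0: "0 < a" using cs chp by (simp add: a_def)
    ultimately have a1: "a < 1" by (simp add: abs_square_less_1)
    define \<alpha> where "\<alpha> = arcsin a"
    have al: "0 < \<alpha>" "\<alpha> < pi/2" "sin \<alpha> = a"
      unfolding \<alpha>_def using a0 a1 arcsin_less_arcsin[of 0 a] arcsin_lt_bounded[of a] by auto
    have K: "Complex x y \<in> K" if "\<bar>y\<bar> \<le> \<alpha>" for y
      using that xe al sin_le[of y \<alpha>] by (auto simp: K_def a_def)
    have Ux: "Complex x y \<in> U" if "\<bar>y\<bar> < \<alpha>" for y
      using that xe al sin_lt[of y \<alpha>] by (auto simp: U_def a_def)
    obtain t where t: "t \<in> {-1..1}" "strip_map (Complex x \<alpha>) = hchord (1 * s) t"
      using endN[OF one(1) K[of \<alpha>]] al by (auto simp: a_def)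
    obtain t' where t': "t' \<in> {-1..1}" "strip_map (Complex x (- \<alpha>)) = hchord (-1 * s) t'"
      using endN[OF one(2) K[of "- \<alpha>"]] al by (auto simp: a_def)
    have "L \<le> cmod (h (Complex x \<alpha>) - h (Complex x (- \<alpha>)))"
      using sep[OF t(1) t'(1)] by (simp only: h_def o_def t(2) t'(2) \<sigma>2_def \<sigma>4_def)
    with K show "\<exists>y1 y2. y1 < y2 \<and> (\<forall>y\<in>{y1<..<y2}. Complex x y \<in> U) \<and>
                   (\<forall>y\<in>{y1..y2}. Complex x y \<in> K) \<and> L \<le> cmod (h (Complex x y2) - h (Complex x y1))"
      using al Ux by - (rule exI[of _ "- \<alpha>"], rule exI[of _ \<alpha>], auto simp: abs_le_iff abs_less_iff)
  qed (use e0 in \<open>auto simp: U_def abs_less_iff\<close>)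
  show ?thesis
  proof (cases "Re ?v1 = Re ?v4")
    case True
    have "m \<le> cmod (\<sigma>1 t - \<sigma>3 t')" if "t \<in> {-1..1}" "t' \<in> {-1..1}" for t t'
      using opp1[OF that] True re(1)[of "\<sigma>1 t" "\<sigma>3 t'"] by linarith
    then have "(2 * y0) * m\<^sup>2 \<le> (2 * e) * m" using horiz[OF m0] by simp
    then have "(y0 * m) * m \<le> e * m" by (simp add: power2_eq_square)
    then have "y0 * m \<le> e" using m0 by (rule mult_right_le_imp_le)
    then show ?thesis by (simp add: y0_def e_def)
  next
    case False
    \<comment> \<open>The left and right sides go to the horizontal sides of the rectangle, at
      distance 1, and the top and bottom to the vertical ones, at distance m. The former distance is
      used on \<open>R\<close>, the latter on \<open>U\<close>, whose height is at most pi.\<close>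
    have "1 \<le> cmod (\<sigma>1 t - \<sigma>3 t')" if "t \<in> {-1..1}" "t' \<in> {-1..1}" for t t'
      using opp2[OF that] False re(2)[of "\<sigma>1 t" "\<sigma>3 t'"] by linarith
    then have "(2 * y0) * 1\<^sup>2 \<le> (2 * e) * m" using horiz[OF zero_less_one] by simp
    then have 1: "y0 \<le> e * m" by simp
    have "m \<le> cmod (\<sigma>2 t - \<sigma>4 t')" if "t \<in> {-1..1}" "t' \<in> {-1..1}" for t t'
      using opp2[OF that] False re(1)[of "\<sigma>2 t" "\<sigma>4 t'"] by linarith
    then have "(2 * e) * m\<^sup>2 \<le> pi * m" using vert[OF m0] by simp
    then have "(2 * e * m) * m \<le> pi * m" by (simp add: power2_eq_square mult_ac)
    then have "2 * e * m \<le> pi" using m0 by (rule mult_right_le_imp_le)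
    then show ?thesis using 1 by (simp add: y0_def e_def)
  qed
qed

section \<open>The cross ratio\<close>

text \<open>The double transpositions preserve the cross ratio, so any chosen vertex may be put
  first and 6 of the 24 orderings remain.\<close>

lemma cross_ratio_Klein_four:
  "cross_ratio z2 z1 z4 z3 = cross_ratio z1 z2 z3 z4"
  "cross_ratio z3 z4 z1 z2 = cross_ratio z1 z2 z3 z4"
  "cross_ratio z4 z3 z2 z1 = cross_ratio z1 z2 z3 z4"
proof -
  have "(z2 - z1) * (z4 - z3) = (z1 - z2) * (z3 - z4)" "(z3 - z1) * (z4 - z2) = (z1 - z3) * (z2 - z4)"
    "(z2 - z4) * (z1 - z3) = (z1 - z3) * (z2 - z4)" "(z3 - z4) * (z1 - z2) = (z1 - z2) * (z3 - z4)"
    "(z4 - z3) * (z2 - z1) = (z1 - z2) * (z3 - z4)" "(z4 - z2) * (z3 - z1) = (z1 - z3) * (z2 - z4)"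
    by (simp_all add: algebra_simps)
  then show "cross_ratio z2 z1 z4 z3 = cross_ratio z1 z2 z3 z4"
    "cross_ratio z3 z4 z1 z2 = cross_ratio z1 z2 z3 z4"
    "cross_ratio z4 z3 z2 z1 = cross_ratio z1 z2 z3 z4"
    unfolding cross_ratio_def by simp_all
qed

text \<open>Up to sign every value is a quotient of two of the products -4, -4 c^2, -4 s^2, one for
  each partition of the vertices into pairs.\<close>

lemma cross_ratio_quad_verts:
  assumes cs: "0 < c" "0 < s" "c\<^sup>2 + s\<^sup>2 = 1"
  defines "A \<equiv> Complex c s" and "B \<equiv> Complex (-c) s" and "C \<equiv> Complex (-c) (-s)" and "D \<equiv> Complex c (-s)"
  shows "cross_ratio A B C D = of_real (1 / c\<^sup>2)" "cross_ratio A B D C = of_real (- s\<^sup>2 / c\<^sup>2)"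
    "cross_ratio A C B D = of_real (c\<^sup>2)" "cross_ratio A C D B = of_real (s\<^sup>2)"
    "cross_ratio A D B C = of_real (- c\<^sup>2 / s\<^sup>2)" "cross_ratio A D C B = of_real (1 / s\<^sup>2)"
proof -
  have d: "(A - C) * (B - D) = of_real (- 4)" "(A - B) * (C - D) = of_real (- 4 * c\<^sup>2)"
    "(A - D) * (B - C) = of_real (- 4 * s\<^sup>2)"
    using cs(3) by (simp_all add: A_def B_def C_def D_def complex_eq_iff power2_eq_square algebra_simps)
  have s: "(C - B) = - (B - C)" "(D - C) = - (C - D)" "(D - B) = - (B - D)" by simp_all
  show "cross_ratio A B C D = of_real (1 / c\<^sup>2)" "cross_ratio A B D C = of_real (- s\<^sup>2 / c\<^sup>2)"
    "cross_ratio A C B D = of_real (c\<^sup>2)" "cross_ratio A C D B = of_real (s\<^sup>2)"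
    "cross_ratio A D B C = of_real (- c\<^sup>2 / s\<^sup>2)" "cross_ratio A D C B = of_real (1 / s\<^sup>2)"
    unfolding cross_ratio_def s mult_minus_right d by (simp_all add: field_simps)
qed

lemma cross_ratio_orderings:
  assumes cs: "0 < c" "0 < s" "c\<^sup>2 + s\<^sup>2 = 1" and V: "{z1, z2, z3, z4} = quad_verts c s"
    and x: "cross_ratio z1 z2 z3 z4 = of_real x"
  shows "x \<in> {1 / c\<^sup>2, - s\<^sup>2 / c\<^sup>2, c\<^sup>2, s\<^sup>2, - c\<^sup>2 / s\<^sup>2, 1 / s\<^sup>2}"
proof -
  define A B C D where "A = Complex c s" and "B = Complex (-c) s" and "C = Complex (-c) (-s)" and "D = Complex c (-s)"
  have VA: "quad_verts c s = {A, B, C, D}" by (simp add: quad_verts_def A_def B_def C_def D_def)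
  note cr = cross_ratio_quad_verts[OF cs, folded A_def B_def C_def D_def]
  have first: "x \<in> {1 / c\<^sup>2, - s\<^sup>2 / c\<^sup>2, c\<^sup>2, s\<^sup>2, - c\<^sup>2 / s\<^sup>2, 1 / s\<^sup>2}"
    if "{A, w2, w3, w4} = quad_verts c s" and w: "cross_ratio A w2 w3 w4 = of_real x" for w2 w3 w4
  proof -
    have "card {A, w2, w3, w4} = 4" using that(1) card_quad_verts[OF cs(1,2)] by simp
    then have ne: "w2 \<noteq> A" "w3 \<noteq> A" "w4 \<noteq> A" "w2 \<noteq> w3" "w2 \<noteq> w4" "w3 \<noteq> w4"
      by (auto simp: card_insert_if split: if_splits)
    have "w2 \<in> {A, B, C, D}" "w3 \<in> {A, B, C, D}" "w4 \<in> {A, B, C, D}" using that(1) unfolding VA by blast+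
    then consider "w2 = B" "w3 = C" "w4 = D" | "w2 = B" "w3 = D" "w4 = C" | "w2 = C" "w3 = B" "w4 = D"
      | "w2 = C" "w3 = D" "w4 = B" | "w2 = D" "w3 = B" "w4 = C" | "w2 = D" "w3 = C" "w4 = B"
      using ne by blast
    then show ?thesis using w cr unfolding of_real_eq_iff by cases (auto simp del: of_real_divide of_real_power of_real_minus)
  qed
  have "A \<in> {z1, z2, z3, z4}" unfolding V VA by simp
  then consider "z1 = A" | "z2 = A" | "z3 = A" | "z4 = A" by blast
  then show ?thesis
  proof cases
    case 1 then show ?thesis using first[of z2 z3 z4] V x by simp
  next
    case 2
    have "{z2, z1, z4, z3} = {z1, z2, z3, z4}" by blast
    then show ?thesis using 2 first[of z1 z4 z3] V x cross_ratio_Klein_four(1)[of z2 z1 z4 z3] by simp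
  next
    case 3
    have "{z3, z4, z1, z2} = {z1, z2, z3, z4}" by blast
    then show ?thesis using 3 first[of z4 z1 z2] V x cross_ratio_Klein_four(2)[of z3 z4 z1 z2] by simp
  next
    case 4
    have "{z4, z3, z2, z1} = {z1, z2, z3, z4}" by blast
    then show ?thesis using 4 first[of z3 z2 z1] V x cross_ratio_Klein_four(3)[of z4 z3 z2 z1] by simp
  qed
qed

text \<open>Of the six values only 1 / c^2 and 1 / s^2 can reach 2. The latter does so only if s^2
  <= 1/2, which together with c <= s means c = s, and then the two coincide.\<close>

lemma quad_cross_ratio_quad_verts:
  assumes cs: "0 < c" "0 < s" "c\<^sup>2 + s\<^sup>2 = 1" and le: "c \<le> s"
  shows "quad_cross_ratio (quad_verts c s) = 1 / c\<^sup>2"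
proof -
  have sq: "c\<^sup>2 \<le> s\<^sup>2" "0 < c\<^sup>2" "0 < s\<^sup>2" using cs le by (auto intro: power_mono)
  then have h: "c\<^sup>2 \<le> 1/2" "1/2 \<le> s\<^sup>2" "s\<^sup>2 \<le> 1" using cs(3) by linarith+
  have c2: "2 \<le> 1 / c\<^sup>2" using h sq by (simp add: le_divide_eq)
  show ?thesis unfolding quad_cross_ratio_def
  proof (rule the_equality)
    show "1 / c\<^sup>2 \<ge> 2 \<and> (\<exists>z1 z2 z3 z4. {z1, z2, z3, z4} = quad_verts c s \<and> cross_ratio z1 z2 z3 z4 = of_real (1 / c\<^sup>2))"
      using c2 cross_ratio_quad_verts(1)[OF cs] unfolding quad_verts_def by blast
  next
    fix x :: real
    assume "x \<ge> 2 \<and> (\<exists>z1 z2 z3 z4. {z1, z2, z3, z4} = quad_verts c s \<and> cross_ratio z1 z2 z3 z4 = of_real x)"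
    then have x2: "2 \<le> x" and "x \<in> {1 / c\<^sup>2, - s\<^sup>2 / c\<^sup>2, c\<^sup>2, s\<^sup>2, - c\<^sup>2 / s\<^sup>2, 1 / s\<^sup>2}"
      using cross_ratio_orderings[OF cs] by blast+
    moreover have "- s\<^sup>2 / c\<^sup>2 \<le> 0" "- c\<^sup>2 / s\<^sup>2 \<le> 0" using sq by (simp_all add: divide_le_0_iff)
    ultimately have "x = 1 / c\<^sup>2 \<or> x = 1 / s\<^sup>2" using h by auto
    moreover have "c\<^sup>2 = s\<^sup>2" if "x = 1 / s\<^sup>2"
    proof -
      have "s\<^sup>2 \<le> 1/2" using x2 sq unfolding that by (simp add: le_divide_eq)
      then show ?thesis using h cs(3) by linarith
    qed
    ultimately show "x = 1 / c\<^sup>2" by auto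
  qed
qed

lemma quad_modulus_quad_verts:
  assumes cs: "0 < c" "0 < s" "c\<^sup>2 + s\<^sup>2 = 1"
  shows "1 \<le> quad_modulus (quad_verts c s)" "conformal_onto_rectangle (quad_verts c s) (quad_modulus (quad_verts c s))"
proof -
  have "quad_verts c s \<subseteq> quad_cl c s"
    using quad_verts_frontier(2)[OF cs] by blast
  then have V: "quad_verts c s \<subseteq> closure (interior (ideal_quad (quad_verts c s)))"
    unfolding interior_ideal_quad[OF cs] closure_quad_dom[OF cs(1,2)] .
  obtain m where m: "1 \<le> m" "conformal_onto_rectangle (quad_verts c s) m" using modulus_exists_quad_verts[OF cs] .
  have "quad_modulus (quad_verts c s) = m" unfolding quad_modulus_def
    by (rule the_equality) (use m modulus_unique[OF V card_quad_verts[OF cs(1,2)]] in blast)+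
  then show "1 \<le> quad_modulus (quad_verts c s)"
    "conformal_onto_rectangle (quad_verts c s) (quad_modulus (quad_verts c s))" using m by simp_all
qed

section \<open>Numerical bounds and conclusion\<close>

lemma artanh_bounds:
  fixes c :: real assumes "0 < c" "c < 1" shows "c \<le> artanh c" "artanh c \<le> c / (1 - c\<^sup>2)"
proof -
  have "\<exists>x>0. x < c \<and> artanh c - artanh 0 = (c - 0) * (1 / (1 - x\<^sup>2))"
    using assms by (intro MVT2) (auto intro!: artanh_real_has_field_derivative)
  then obtain x where x: "0 < x" "x < c" "artanh c = c / (1 - x\<^sup>2)" by auto
  have "0 < x\<^sup>2" "x\<^sup>2 \<le> c\<^sup>2" "c\<^sup>2 < 1" using x assms by (auto intro: power_mono simp: abs_square_less_1)
  then have "c / 1 \<le> c / (1 - x\<^sup>2)" "c / (1 - x\<^sup>2) \<le> c / (1 - c\<^sup>2)"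
    using assms by (auto intro!: divide_left_mono simp del: div_by_1)
  then show "c \<le> artanh c" "artanh c \<le> c / (1 - c\<^sup>2)" unfolding x(3) by simp_all
qed

text \<open>The complementary angle y = pi/2 - arcsin s has sine c and cosine s. By the mean value
  theorem c = y cos x with 0 < x < y, and cos x >= cos y = s >= 1/2.\<close>

lemma arcsin_lower_bound:
  assumes cs: "0 < c" "0 < s" "c\<^sup>2 + s\<^sup>2 = 1" and "1/2 \<le> s"
  shows "pi/2 - 2 * c \<le> arcsin s"
proof -
  define y where "y = pi/2 - arcsin s"
  have "0 < c\<^sup>2" using cs by simp
  then have "s\<^sup>2 < 1\<^sup>2" using cs(3) unfolding one_power2 by linarith
  then have s1: "s < 1" by (rule power_less_imp_less_base) simp
  have y: "0 < y" "y < pi/2" unfolding y_def using s1 cs arcsin_less_arcsin[of 0 s] arcsin_lt_bounded[of s] by auto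
  have cy: "cos y = s" using s1 cs by (simp add: y_def cos_diff)
  have "(sin y)\<^sup>2 = c\<^sup>2" using sin_cos_squared_add[of y] cs(3) unfolding cy by linarith
  then have sy: "sin y = c" using y cs(1) sin_gt_zero[of y] by (simp add: power2_eq_iff_nonneg)
  have "\<exists>x>0. x < y \<and> sin y - sin 0 = (y - 0) * cos x"
    using y by (intro MVT2) (auto intro!: derivative_eq_intros)
  then obtain x where x: "0 < x" "x < y" "sin y = y * cos x" by auto
  have "cos y \<le> cos x" using x y by (intro cos_monotone_0_pi_le) auto
  then have "1/2 \<le> cos x" using cy assms(4) by simp
  then have "y * (1/2) \<le> y * cos x" using y by (intro mult_left_mono) auto
  then have "y \<le> 2 * c" using x(3) unfolding sy by linarith
  then show ?thesis by (simp add: y_def)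
qed

lemma quad_modulus_bounds:
  assumes cs: "0 < c" "0 < s" "c\<^sup>2 + s\<^sup>2 = 1" and le: "c \<le> s"
  defines "m \<equiv> quad_modulus (quad_verts c s)"
  shows "pi / 2 / c - 48 \<le> m" "m \<le> pi / 2 / c + 24"
proof -
  have m: "1 \<le> m" "conformal_onto_rectangle (quad_verts c s) m" using quad_modulus_quad_verts[OF cs] by (simp_all add: m_def)
  have "c\<^sup>2 \<le> s\<^sup>2" using cs le by (auto intro: power_mono)
  then have h: "c\<^sup>2 \<le> 1/2" "1/2 \<le> s\<^sup>2" using cs(3) by linarith+
  \<comment> \<open>A rational just above 1 / sqrt 2, small enough that pi/2 - 2 c >= 3/2 - 17/12 =
    1/12 is still positive.\<close>
  have "c\<^sup>2 \<le> (17/24)\<^sup>2" using h by (simp add: power2_eq_square)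
  then have c1: "c \<le> 17/24" by (rule power2_le_imp_le) simp
  have "(1/2)\<^sup>2 \<le> s\<^sup>2" using h by (simp add: power2_eq_square)
  then have s1: "1/2 \<le> s" by (rule power2_le_imp_le) (use cs in simp)
  note y = arcsin_lower_bound[OF cs s1]
  have y1: "1/12 \<le> arcsin s" using y c1 pi_gt3 by linarith
  note e = artanh_bounds[OF cs(1)]
  have "c < 1" using c1 by simp
  then have e: "c \<le> artanh c" "artanh c \<le> c / (1 - c\<^sup>2)" using e by auto
  have "c / (1 - c\<^sup>2) \<le> 2 * c" using h cs(1) by (simp add: divide_le_eq)
  then have e2: "artanh c \<le> 2 * c" using e by simp
  have p: "0 < pi / 2 / c" using cs by simp
  have "pi / 2 / c - 48 \<le> m \<and> m \<le> pi / 2 / c + 24"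
    using modulus_estimates[OF cs m]
  proof
    \<comment> \<open>The exchanged pairing: 1 <= m <= 24 c, where 24 is 12 from \<open>y1\<close>
      times 2 from \<open>e2\<close>. So c >= 1/24, and pi < 4 gives pi / (2 c) <= 48.\<close>
    assume "arcsin s * m \<le> artanh c"
    moreover have "1/12 * m \<le> arcsin s * m" using y1 m(1) by (intro mult_right_mono) auto
    ultimately have m24: "m \<le> 24 * c" using e2 by linarith
    then have "1/24 \<le> c" using m(1) by linarith
    then have "pi / 2 / c \<le> pi / 2 / (1/24)" by (intro divide_left_mono) auto
    then have "pi / 2 / c \<le> 48" using pi_less_4 by simp
    then show ?thesis using m(1) m24 \<open>c < 1\<close> p by linarith
  next
    assume "2 * artanh c * m \<le> pi \<and> arcsin s \<le> artanh c * m"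
    then have B: "2 * artanh c * m \<le> pi" "arcsin s \<le> artanh c * m" by auto
    have "c * m \<le> artanh c * m" using e m(1) by (intro mult_right_mono) auto
    then have up: "m \<le> pi / 2 / c" using B(1) cs(1) by (simp add: le_divide_eq mult_ac)
    have "artanh c * m \<le> c / (1 - c\<^sup>2) * m" using e m(1) by (intro mult_right_mono) auto
    then have "pi/2 - 2 * c \<le> c / (1 - c\<^sup>2) * m" using y B(2) by linarith
    then have "(pi/2 - 2 * c) * (1 - c\<^sup>2) \<le> c * m" using h by (simp add: le_divide_eq)
    \<comment> \<open>The factor 1 - c^2 loses at most 2 c; together with the 2 c of
      \<open>arcsin_lower_bound\<close> this gives the error 4 after division by c.\<close>
    moreover have "pi/2 * c\<^sup>2 \<le> 2 * c"
    proof -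
      have "pi/2 * c \<le> 2 * 1" using pi_less_4 \<open>c < 1\<close> cs(1) by (intro mult_mono) auto
      then show ?thesis using cs(1) by (simp add: power2_eq_square mult_ac)
    qed
    moreover have "0 \<le> 2 * c * c\<^sup>2" using cs by simp
    ultimately have "pi/2 - 4 * c \<le> c * m" by (simp add: algebra_simps)
    then have "pi / 2 / c \<le> m + 4" using cs(1) by (simp add: divide_le_eq algebra_simps)
    then show ?thesis using up by linarith
  qed
  then show "pi / 2 / c - 48 \<le> m" "m \<le> pi / 2 / c + 24" by auto
qed

text \<open>A quarter turn exchanges c and s, so c <= s may be assumed; this makes 1 / c^2, and not
  1 / s^2, the value of the cross ratio.\<close>

lemma quad_verts_swap: "(*) \<i> ` quad_verts c s = quad_verts s c"
proof -
  have "\<i> * Complex a b = Complex (- b) a" for a b by (simp add: complex_eq_iff)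
  then show ?thesis unfolding quad_verts_def by auto
qed

theorem theorem7p1:
  shows "\<exists>c1 c2 :: real. c1 \<ge> 0 \<and> c2 \<ge> 0 \<and>
    (\<forall>V. ideal_vertices V \<longrightarrow>
       pi / 2 * sqrt (quad_cross_ratio V) - c1 \<le> quad_modulus V \<and>
       quad_modulus V \<le> pi / 2 * sqrt (quad_cross_ratio V) + c2)"
proof -
  have *: "pi / 2 * sqrt (quad_cross_ratio V) - 48 \<le> quad_modulus V \<and>
      quad_modulus V \<le> pi / 2 * sqrt (quad_cross_ratio V) + 24" if V: "ideal_vertices V" for V
  proof -
    have cb: "V \<subseteq> cball 0 1" using V by (auto simp: ideal_vertices_def)
    obtain c s where cs: "0 < c" "0 < s" "c\<^sup>2 + s\<^sup>2 = 1" "isom_image V (quad_verts c s)" using normal_form[OF V] .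
    obtain c s where cs: "0 < c" "0 < s" "c\<^sup>2 + s\<^sup>2 = 1" "isom_image V (quad_verts c s)" "c \<le> s"
    proof (cases "c \<le> s")
      case True then show ?thesis using that cs by blast
    next
      case False
      have "isom_image (quad_verts c s) (quad_verts s c)"
        using isom_image_rotation[of \<i> "quad_verts c s"] unfolding quad_verts_swap by simp
      then have "isom_image V (quad_verts s c)" using isom_image_trans[OF cs(4) _ cb] by blast
      then show ?thesis using that[of s c] cs False by (simp add: add.commute)
    qed
    note inv = isom_image_invariants(1,2)[OF cs(4) cb]
    have "sqrt (quad_cross_ratio V) = 1 / c"
      using cs(1) quad_cross_ratio_quad_verts[OF cs(1-3,5)] by (simp add: inv(2) real_sqrt_divide)
    then show ?thesis using quad_modulus_bounds[OF cs(1-3,5)] inv(1) by simp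
  qed
  show ?thesis by (rule exI[of _ 48], rule exI[of _ 24]) (use * in simp)
qed

end
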